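(* Let $\Pi$ be a compact right-angled convex polyhedron in $\mathbb{H}^3$ with $k\ge 18$ faces, let $S$ be the set of hyperbolic reflections in the planes of the faces of $\Pi$, let $G=\langle S\rangle$ be the reflection group of $\Pi$, and let $\Gamma$ be the Cayley graph of $G$ with respect to $S$. Then $$p_{\mathrm c}(\Gamma)<p_{\mathrm u}(\Gamma)$$ both for bond Bernoulli percolation on $\Gamma$ and for site Bernoulli percolation on $\Gamma$.
   Context: Polyhedra. A convex polyhedron in hyperbolic $3$-space $\mathbb{H}^3$ is an intersection of finitely many closed half-spaces of $\mathbb{H}^3$ with non-empty interior. For a plane supporting the polyhedron (meeting it so that the polyhedron lies on one side of the plane), the intersection of the plane with the polyhedron is called a face, an edge or a vertex if it is $2$-, $1$- or $0$-dimensional, respectively. The polyhedron is right-angled if the dihedral angle at each of its edges is $\pi/2$. Cayley graph. The reflection group of $\Pi$ is the subgroup of $\mathrm{Isom}(\mathbb{H}^3)$ generated by the set $S$ of reflections in the planes of the faces of $\Pi$. The Cayley graph $\Gamma$ is the undirected simple graph with vertex set $G$ in which $v,w$ are joined by an edge iff $v=ws$ for some $s\in S$. Percolation. Let $p\in[0,1]$. In bond Bernoulli percolation on $\Gamma$ with parameter $p$, each edge is kept with probability $p$ and deleted with probability $1-p$, independently for all edges; $\omega^{(p)}$ is the random subgraph consisting of all vertices and the kept edges. In site Bernoulli percolation, each vertex is kept with probability $p$ and deleted with probability $1-p$, independently; $\omega^{(p)}$ is the subgraph induced by the kept vertices. Clusters are connected components of $\omega^{(p)}$. For either model, $$p_{\mathrm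 c}(\Gamma)=\inf\{p\in[0,1]:\mathrm P(\omega^{(p)}\text{ has some infinite cluster})>0\},$$ $$p_{\mathrm u}(\Gamma)=\inf\{p\in[0,1]:\text{almost surely there is a unique infinite cluster in }\omega^{(p)}\}.$$ *)

theory Defs
  imports
    "HOL-Probability.Probability"
    "HOL-Algebra.Elementary_Groups"
    "HOL-Algebra.Bij"
begin

section \<open>Hyperbolic 3-space\<close>

text \<open>
  We use the hyperboloid model. A point \<open>(u, t)\<close> of \<open>(real^3) \<times> real\<close> has three spatial
  coordinates \<open>u\<close> and one time coordinate \<open>t\<close>.
\<close>

type_synonym minkowski = "(real ^ 3) \<times> real"

definition lorentz :: "minkowski \<Rightarrow> minkowski \<Rightarrow> real" where
  "lorentz x y = fst x \<bullet> fst y - snd x * snd y"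

definition H3 :: "minkowski set" where
  "H3 = {x. lorentz x x = -1 \<and> snd x > 0}"

definition hdist :: "minkowski \<Rightarrow> minkowski \<Rightarrow> real" where
  "hdist x y = arcosh (- lorentz x y)"

text \<open>
  The topology of the metric \<open>hdist\<close> on \<open>H3\<close> is the subspace topology inherited from
  \<open>(real^3) \<times> real\<close>. Compactness is therefore the library's \<open>compact\<close>, and interiors in
  hyperbolic space are taken in \<open>top_of_set H3\<close>.
\<close>

definition Isom_H3 :: "(minkowski \<Rightarrow> minkowski) monoid" where
  "Isom_H3 = (BijGroup H3)
     \<lparr>carrier := {f \<in> Bij H3. \<forall>x\<in>H3. \<forall>y\<in>H3. hdist (f x) (f y) = hdist x y}\<rparr>"

text \<open>
  Planes and half-spaces are described by unit (spacelike) normal vectors; \<open>n\<close> and \<open>- n\<close>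
  give the same plane and the same reflection, but opposite half-spaces. For the half-space
  below, \<open>n\<close> is the outward normal.
\<close>

definition unit_normal :: "minkowski \<Rightarrow> bool" where
  "unit_normal n \<longleftrightarrow> lorentz n n = 1"

definition hplane :: "minkowski \<Rightarrow> minkowski set" where
  "hplane n = {x \<in> H3. lorentz x n = 0}"

definition half_space :: "minkowski \<Rightarrow> minkowski set" where
  "half_space n = {x \<in> H3. lorentz x n \<le> 0}"

definition hreflection :: "minkowski \<Rightarrow> minkowski \<Rightarrow> minkowski" where
  "hreflection n = (\<lambda>x\<in>H3. x - (2 * lorentz x n) *\<^sub>R n)"

text \<open>
  Hyperbolic subspaces are the intersections of \<open>H3\<close> with linear subspaces of one dimension
  more, so the dimension of (the hyperbolic span of) a subset of \<open>H3\<close> is one less than its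
  linear dimension. The empty set gets dimension \<open>-1\<close>, as for \<open>aff_dim\<close>.
\<close>

definition hdim :: "minkowski set \<Rightarrow> int" where
  "hdim A = int (dim A) - 1"


section \<open>Polyhedra\<close>

definition convex_polyhedron :: "minkowski set \<Rightarrow> bool" where
  "convex_polyhedron P \<longleftrightarrow>
     (\<exists>N. finite N \<and> (\<forall>n\<in>N. unit_normal n) \<and> P = H3 \<inter> (\<Inter>n\<in>N. half_space n)) \<and>
     (top_of_set H3) interior_of P \<noteq> {}"

text \<open>
  Every supporting plane is \<open>hplane n\<close> for an outward unit normal \<open>n\<close>.
\<close>

definition supporting_normal :: "minkowski set \<Rightarrow> minkowski \<Rightarrow> bool" where
  "supporting_normal P n \<longleftrightarrow> unit_normal n \<and> P \<subseteq> half_space n \<and> hplane n \<inter> P \<noteq> {}"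

definition face_normals :: "minkowski set \<Rightarrow> minkowski set" where
  "face_normals P = {n. supporting_normal P n \<and> hdim (hplane n \<inter> P) = 2}"

definition faces :: "minkowski set \<Rightarrow> minkowski set set" where
  "faces P = {hplane n \<inter> P | n. supporting_normal P n \<and> hdim (hplane n \<inter> P) = 2}"

definition edges :: "minkowski set \<Rightarrow> minkowski set set" where
  "edges P = {hplane n \<inter> P | n. supporting_normal P n \<and> hdim (hplane n \<inter> P) = 1}"

text \<open>
  The angle between the outward normals of two faces meeting at an edge is \<open>arccos\<close> of their
  Lorentz product (the normal plane of the edge is positive definite); the interior dihedral
  angle of the polyhedron is its supplement.
\<close>

definition dihedral_angle :: "minkowski \<Rightarrow> minkowski \<Rightarrow> real" where
  "dihedral_angle m n = pi - arccos (lorentz m n)"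

definition right_angled :: "minkowski set \<Rightarrow> bool" where
  "right_angled P \<longleftrightarrow>
     (\<forall>e\<in>edges P. \<forall>m\<in>face_normals P. \<forall>n\<in>face_normals P.
        m \<noteq> n \<and> e \<subseteq> hplane m \<and> e \<subseteq> hplane n \<longrightarrow> dihedral_angle m n = pi / 2)"

definition face_reflections :: "minkowski set \<Rightarrow> (minkowski \<Rightarrow> minkowski) set" where
  "face_reflections P = hreflection ` face_normals P"

text \<open>
  Reflections are isometries of \<open>H3\<close>, so \<open>subgroup_generated\<close>, which intersects the generators
  with the carrier, discards none of them.
\<close>

definition reflection_group :: "minkowski set \<Rightarrow> (minkowski \<Rightarrow> minkowski) monoid" where
  "reflection_group P = subgroup_generated Isom_H3 (face_reflections P)"


section \<open>Graphs\<close>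

text \<open>
  A simple graph is a pair of a vertex set and a set of edges, each of which is a set of two
  vertices.
\<close>

type_synonym 'a ugraph = "'a set \<times> 'a set set"

definition cayley_graph :: "('a, 'b) monoid_scheme \<Rightarrow> 'a set \<Rightarrow> 'a ugraph" where
  "cayley_graph G S =
     (carrier G,
      {{v, w} | v w. v \<in> carrier G \<and> w \<in> carrier G \<and> v \<noteq> w \<and> (\<exists>s\<in>S. v = w \<otimes>\<^bsub>G\<^esub> s)})"

definition connected_components :: "'a ugraph \<Rightarrow> 'a set set" where
  "connected_components g =
     fst g // {(v, w) \<in> fst g \<times> fst g. (v, w) \<in> {(x, y). {x, y} \<in> snd g}\<^sup>*}"


section \<open>Bernoulli percolation\<close>

text \<open>
  A configuration assigns to each edge (bond percolation) or vertex (site percolation) whether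
  it is kept.
\<close>

definition bond_measure :: "'a ugraph \<Rightarrow> real \<Rightarrow> ('a set \<Rightarrow> bool) measure" where
  "bond_measure g p = PiM (snd g) (\<lambda>_. measure_pmf (bernoulli_pmf p))"

definition bond_subgraph :: "'a ugraph \<Rightarrow> ('a set \<Rightarrow> bool) \<Rightarrow> 'a ugraph" where
  "bond_subgraph g \<omega> = (fst g, {e \<in> snd g. \<omega> e})"

definition site_measure :: "'a ugraph \<Rightarrow> real \<Rightarrow> ('a \<Rightarrow> bool) measure" where
  "site_measure g p = PiM (fst g) (\<lambda>_. measure_pmf (bernoulli_pmf p))"

definition site_subgraph :: "'a ugraph \<Rightarrow> ('a \<Rightarrow> bool) \<Rightarrow> 'a ugraph" where
  "site_subgraph g \<omega> = ({v \<in> fst g. \<omega> v}, {e \<in> snd g. \<forall>v\<in>e. \<omega> v})"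

text \<open>
  The two thresholds of a percolation model, given by the law \<open>M p\<close> of the configuration with
  parameter \<open>p\<close> and the random subgraph \<open>sub \<omega>\<close> of a configuration \<open>\<omega>\<close>.
\<close>

definition critical_prob :: "(real \<Rightarrow> 'w measure) \<Rightarrow> ('w \<Rightarrow> 'a ugraph) \<Rightarrow> real" where
  "critical_prob M sub =
     Inf {p \<in> {0..1}.
       measure (M p) {\<omega> \<in> space (M p). \<exists>C\<in>connected_components (sub \<omega>). infinite C} > 0}"

definition uniqueness_prob :: "(real \<Rightarrow> 'w measure) \<Rightarrow> ('w \<Rightarrow> 'a ugraph) \<Rightarrow> real" where
  "uniqueness_prob M sub =
     Inf {p \<in> {0..1}.
       AE \<omega> in M p. \<exists>!C. C \<in> connected_components (sub \<omega>) \<and> infinite C}"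

definition pc_bond :: "'a ugraph \<Rightarrow> real" where
  "pc_bond g = critical_prob (bond_measure g) (bond_subgraph g)"

definition pu_bond :: "'a ugraph \<Rightarrow> real" where
  "pu_bond g = uniqueness_prob (bond_measure g) (bond_subgraph g)"

definition pc_site :: "'a ugraph \<Rightarrow> real" where
  "pc_site g = critical_prob (site_measure g) (site_subgraph g)"

definition pu_site :: "'a ugraph \<Rightarrow> real" where
  "pu_site g = uniqueness_prob (site_measure g) (site_subgraph g)"

end

(*  The outward normals of a right-angled polyhedron are pairwise orthogonal or have product at
    most -1: otherwise the two planes meet inside the polyhedron, at an edge with a wrong angle.
    Hence the reflection group is a right-angled Coxeter group, in which the descents of an element
    are pairwise orthogonal normals, so there are at most three of them. Signature (3,1) also
    shows that two distinct normals have at most two common orthogonal ones, which bounds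
    the number of orthogonal pairs by k (k + 20) / 12; no Euler formula is needed.

    Lower bound for p_u: with at most three descents, the number of non-backtracking walks of length n
    between x and y is at most C mu^n a^d(x,y) with mu = 2k/3 + 1/4 and a < 1. For p < 1/mu
    connection probabilities therefore decay exponentially, which excludes a unique infinite cluster.

    Upper bound for p_c: the ShortLex normal forms span a tree in the Cayley graph. The clique
    polynomial of the forbidden letters of a node is a super-eigenvector of the child relation with
    eigenvalue 2k/3 + 1/2 > mu, so percolation on this tree survives for some p < 1/mu.  *)
theory Submission
  imports Defs
begin

section \<open>Right-angled Coxeter groups and ShortLex normal forms\<close>

text \<open>A walk between two fixed elements goes down in length about as often as it goes up, and
  each step down has at most three choices; a path in the tree only goes up. This is why the walks
  can be fewer than the tree is large. The upper bound for the walks and the lower bound for the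
  tree are linear in k with common slope 2/3, so their gap 1/4 persists for all k \<ge> 18, and a
  percolation parameter fits between the reciprocals. The Coxeter theory rests on one rule,
  \<open>D_up\<close>: right multiplication by a generator \<open>s\<close> that is not a descent
  makes \<open>s\<close> a descent and keeps just the old descents commuting with \<open>s\<close>.
  Reduced words, exchange and normal forms are read off from it; geometry enters only through the
  verification of the rule and the bounds on orthogonal normals. Bond and site percolation are
  handled at once: every step of a path carries the one random variable that has to be open for it,
  and the steps of a self-avoiding path carry pairwise different variables.\<close>

locale right_angled_coxeter = group G for G (structure) +
  fixes S :: "'s set" and r :: "'s \<Rightarrow> 'a" and nb :: "'s \<Rightarrow> 's \<Rightarrow> bool"
    and D :: "'a \<Rightarrow> 's set" and len :: "'a \<Rightarrow> nat"
  assumes finite_S: "finite S"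
    and r_closed: "s \<in> S \<Longrightarrow> r s \<in> carrier G"
    and r_r: "s \<in> S \<Longrightarrow> r s \<otimes> r s = \<one>"
    and nb_sym: "nb s t \<Longrightarrow> nb t s"
    and nb_irrefl: "\<not> nb s s"
    and D_subset: "x \<in> carrier G \<Longrightarrow> D x \<subseteq> S"
    and len_one: "len \<one> = 0"
    and len_eq_0: "x \<in> carrier G \<Longrightarrow> len x = 0 \<Longrightarrow> x = \<one>"
    and len_pos: "x \<in> carrier G \<Longrightarrow> len x > 0 \<Longrightarrow> D x \<noteq> {}"
    and len_down: "x \<in> carrier G \<Longrightarrow> s \<in> D x \<Longrightarrow> Suc (len (x \<otimes> r s)) = len x"
    and len_up: "x \<in> carrier G \<Longrightarrow> s \<in> S \<Longrightarrow> s \<notin> D x \<Longrightarrow> len (x \<otimes> r s) = Suc (len x)"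
    and D_up: "x \<in> carrier G \<Longrightarrow> s \<in> S \<Longrightarrow> s \<notin> D x \<Longrightarrow> D (x \<otimes> r s) = insert s {t \<in> D x. nb s t}"
begin

lemma nb_commute: "nb s t \<longleftrightarrow> nb t s"
  using nb_sym by blast

lemma D_one: "D \<one> = {}"
  using len_down[of \<one>] len_one by (metis all_not_in_conv nat.distinct(1) one_closed)

lemma r_r_cancel [simp]: "x \<in> carrier G \<Longrightarrow> s \<in> S \<Longrightarrow> x \<otimes> r s \<otimes> r s = x"
  by (simp add: m_assoc r_closed r_r)

lemma D_r: "s \<in> S \<Longrightarrow> D (r s) = {s}"
  using D_up[of \<one> s] D_one r_closed by auto

lemma in_D_step_iff: "x \<in> carrier G \<Longrightarrow> s \<in> S \<Longrightarrow> s \<in> D (x \<otimes> r s) \<longleftrightarrow> s \<notin> D x"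
proof -
  assume x: "x \<in> carrier G" and s: "s \<in> S"
  have xs: "x \<otimes> r s \<in> carrier G" using x s r_closed by simp
  show ?thesis
  proof (cases "s \<in> D x")
    case True
    have "Suc (len x) = len (x \<otimes> r s)" if "s \<in> D (x \<otimes> r s)"
      using len_down[OF xs that] x s by simp
    then show ?thesis using True len_down[OF x True] by auto
  next
    case False
    then show ?thesis using D_up[OF x s False] by simp
  qed
qed

primrec act :: "'a \<Rightarrow> 's list \<Rightarrow> 'a" where
  "act x [] = x"
| "act x (s # w) = act (x \<otimes> r s) w"

lemma act_append: "act x (u @ v) = act (act x u) v"
  by (induction u arbitrary: x) auto

lemma act_closed [intro]: "x \<in> carrier G \<Longrightarrow> set w \<subseteq> S \<Longrightarrow> act x w \<in> carrier G"
  by (induction w arbitrary: x) (auto simp: r_closed)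

lemma act_mult: "x \<in> carrier G \<Longrightarrow> y \<in> carrier G \<Longrightarrow> set w \<subseteq> S \<Longrightarrow> act (x \<otimes> y) w = x \<otimes> act y w"
  by (induction w arbitrary: y) (auto simp: r_closed m_assoc)

lemma act_one: "x \<in> carrier G \<Longrightarrow> set w \<subseteq> S \<Longrightarrow> act x w = x \<otimes> act \<one> w"
  using act_mult[of x \<one> w] by simp

lemma len_act_le: "x \<in> carrier G \<Longrightarrow> set w \<subseteq> S \<Longrightarrow> len (act x w) \<le> len x + length w"
proof (induction w arbitrary: x)
  case (Cons s w)
  have "len (x \<otimes> r s) \<le> Suc (len x)"
    using Cons.prems len_up[of x s] len_down[of x s] by (cases "s \<in> D x") auto
  then show ?case using Cons.IH[of "x \<otimes> r s"] Cons.prems r_closed by auto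
qed auto

lemma ex_reduced: "x \<in> carrier G \<Longrightarrow> \<exists>w. set w \<subseteq> S \<and> x = act \<one> w \<and> length w = len x"
proof (induction "len x" arbitrary: x)
  case 0
  then show ?case using len_eq_0 by (intro exI[of _ "[]"]) auto
next
  case (Suc n)
  then obtain s where s: "s \<in> D x" using len_pos by fastforce
  with Suc have sS: "s \<in> S" using D_subset by auto
  have "len (x \<otimes> r s) = n" using Suc len_down[of x s] s by auto
  then obtain w where w: "set w \<subseteq> S" "x \<otimes> r s = act \<one> w" "length w = n" using Suc sS r_closed
    by (metis m_closed)
  then have "x = act \<one> (w @ [s])" using Suc sS by (simp add: act_append flip: w(2))
  then show ?case using w sS Suc by (intro exI[of _ "w @ [s]"]) auto
qed

lemma len_mult_le: "x \<in> carrier G \<Longrightarrow> y \<in> carrier G \<Longrightarrow> len (x \<otimes> y) \<le> len x + len y"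
  by (metis act_one ex_reduced len_act_le)

lemma countable_carrier: "countable (carrier G)"
proof -
  have "carrier G \<subseteq> act \<one> ` lists S" using ex_reduced by (auto simp: lists_eq_set)
  moreover have "countable (act \<one> ` lists S)"
    using finite_S by (intro countable_image countable_lists) (auto intro: countable_finite)
  ultimately show ?thesis using countable_subset by blast
qed

section \<open>Ascending words and the exchange condition\<close>

primrec ascending :: "'a \<Rightarrow> 's list \<Rightarrow> bool" where
  "ascending x [] = True"
| "ascending x (s # w) \<longleftrightarrow> s \<in> S - D x \<and> ascending (x \<otimes> r s) w"

lemma ascending_set: "ascending x w \<Longrightarrow> set w \<subseteq> S"
  by (induction w arbitrary: x) auto

lemma len_ascending: "x \<in> carrier G \<Longrightarrow> ascending x w \<Longrightarrow> len (act x w) = len x + length w"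
  by (induction w arbitrary: x) (auto simp: r_closed len_up)

lemma ascending_cong:
  "x \<in> carrier G \<Longrightarrow> y \<in> carrier G \<Longrightarrow> D x = D y \<Longrightarrow> ascending x w \<Longrightarrow> ascending y w"
proof (induction w arbitrary: x y)
  case (Cons s w)
  then have "D (x \<otimes> r s) = D (y \<otimes> r s)" by (simp add: D_up)
  then show ?case using Cons r_closed by (auto intro: Cons.IH[of "x \<otimes> r s" "y \<otimes> r s"])
qed auto

text \<open>An additional descent \<open>a\<close> survives only while the letters read commute with
  \<open>a\<close>. By the last hypothesis a letter that does not commute with it precedes every
  \<open>a\<close> in the word; from that letter on both descent sets agree.\<close>

lemma ascending_insert:
  assumes "x \<in> carrier G" "y \<in> carrier G" "D y = insert a (D x)" "a \<notin> D x" "ascending x w"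
    and "\<And>u v. w = u @ a # v \<Longrightarrow> \<exists>b\<in>set u. \<not> nb b a"
  shows "ascending y w"
  using assms
proof (induction w arbitrary: x y)
  case (Cons s w)
  have sa: "s \<noteq> a" using Cons.prems(6)[of "[]" w] by auto
  have s: "s \<in> S" "s \<notin> D x" "s \<notin> D y" using Cons.prems sa by auto
  have Dx: "D (x \<otimes> r s) = insert s {t \<in> D x. nb s t}"
    and Dy: "D (y \<otimes> r s) = insert s {t \<in> insert a (D x). nb s t}"
    using D_up s Cons.prems by auto
  show ?case
  proof (cases "nb s a")
    case True
    have "ascending (y \<otimes> r s) w"
    proof (rule Cons.IH[of "x \<otimes> r s"])
      show "\<exists>b\<in>set u. \<not> nb b a" if "w = u @ a # v" for u v
        using Cons.prems(6)[of "s # u" v] that True by auto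
    qed (use Cons.prems s sa True r_closed in \<open>auto simp: Dx Dy\<close>)
    then show ?thesis using s by simp
  next
    case False
    then have "D (x \<otimes> r s) = D (y \<otimes> r s)" using Dx Dy by auto
    then have "ascending (y \<otimes> r s) w"
      using ascending_cong Cons.prems s r_closed by (meson ascending.simps(2) m_closed)
    then show ?thesis using s by simp
  qed
qed auto

text \<open>The exchange condition for left multiplication. If no occurrence of \<open>a\<close>
  could be moved to the front of \<open>w\<close>, then \<open>w\<close> would stay ascending when
  started at \<open>r a\<close>, whose only descent is \<open>a\<close>, and left multiplication by
  \<open>r a\<close> would increase the length.\<close>

lemma left_descent_split:
  assumes "a \<in> S" "ascending \<one> w" "len (r a \<otimes> act \<one> w) < len (act \<one> w)"
  obtains u v where "w = u @ a # v" "\<forall>b\<in>set u. nb b a"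
proof (rule ccontr)
  assume "\<not> thesis"
  then have no: "\<exists>b\<in>set u. \<not> nb b a" if "w = u @ a # v" for u v
    using that \<open>\<And>u v. w = u @ a # v \<Longrightarrow> \<forall>b\<in>set u. nb b a \<Longrightarrow> thesis\<close> by blast
  have "ascending (r a) w"
    by (rule ascending_insert[of \<one> "r a" a])
      (use assms(1,2) no in \<open>simp_all add: r_closed D_r D_one\<close>)
  then have "len (act (r a) w) = len (r a) + length w"
    using len_ascending r_closed assms(1) by simp
  moreover have "len (act \<one> w) = length w" using assms len_ascending len_one by fastforce
  moreover have "act (r a) w = r a \<otimes> act \<one> w"
    using act_one[OF r_closed[OF assms(1)] ascending_set[OF assms(2)]] .
  ultimately show False using assms by simp
qed

section \<open>The ShortLex automaton\<close>

definition rk :: "'s \<Rightarrow> nat" where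
  "rk = to_nat_on S"

lemma inj_on_rk: "inj_on rk S"
  unfolding rk_def by (simp add: countable_finite finite_S inj_on_to_nat_on)

text \<open>The ShortLex automaton over a subset \<open>T\<close> of the generators: the state \<open>X\<close> is the set of
  letters that may not come next.\<close>

definition upd :: "'s set \<Rightarrow> 's set \<Rightarrow> 's \<Rightarrow> 's set" where
  "upd T X s = insert s {a. nb a s \<and> (a \<in> X \<or> a \<in> T \<and> rk a < rk s)}"

primrec run :: "'s set \<Rightarrow> 's set \<Rightarrow> 's list \<Rightarrow> 's set" where
  "run T X [] = X"
| "run T X (s # w) = run T (upd T X s) w"

primrec adm :: "'s set \<Rightarrow> 's set \<Rightarrow> 's list \<Rightarrow> bool" where
  "adm T X [] = True"
| "adm T X (s # w) \<longleftrightarrow> s \<in> T - X \<and> adm T (upd T X s) w"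

lemma run_append: "run T X (u @ v) = run T (run T X u) v"
  by (induction u arbitrary: X) auto

lemma adm_append: "adm T X (u @ v) \<longleftrightarrow> adm T X u \<and> adm T (run T X u) v"
  by (induction u arbitrary: X) auto

lemma adm_set: "adm T X w \<Longrightarrow> set w \<subseteq> T"
  by (induction w arbitrary: X) auto

lemma adm_antimono: "Y \<subseteq> X \<Longrightarrow> adm T X w \<Longrightarrow> adm T Y w"
proof (induction w arbitrary: X Y)
  case (Cons s w)
  then have "upd T Y s \<subseteq> upd T X s" by (auto simp: upd_def)
  then show ?case using Cons by auto
qed auto

lemma run_subset: "T \<subseteq> S \<Longrightarrow> X \<subseteq> T \<Longrightarrow> adm T X w \<Longrightarrow> run T X w \<subseteq> T"
proof (induction w arbitrary: X)
  case (Cons s w)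
  then have "upd T X s \<subseteq> T" by (auto simp: upd_def)
  then show ?case using Cons by auto
qed auto

text \<open>Descents and forbidden letters follow the same update, except that the automaton also
  forbids smaller commuting letters. Hence the forbidden set dominates the descent set along the
  whole word.\<close>

lemma adm_ascending:
  "x \<in> carrier G \<Longrightarrow> T \<subseteq> S \<Longrightarrow> D x \<subseteq> X \<Longrightarrow> adm T X w \<Longrightarrow> ascending x w"
proof (induction w arbitrary: x X)
  case (Cons s w)
  have s: "s \<in> S" "s \<notin> D x" using Cons.prems by auto
  have "D (x \<otimes> r s) \<subseteq> upd T X s"
    using Cons.prems s by (auto simp: D_up upd_def nb_commute)
  then show ?case using Cons s r_closed by auto
qed auto

lemma forbidden_not_adm: "a \<in> X \<Longrightarrow> \<forall>b\<in>set u. nb b a \<Longrightarrow> \<not> adm T X (u @ a # v)"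
proof (induction u arbitrary: X)
  case (Cons b u)
  then have "a \<in> upd T X b" by (auto simp: upd_def nb_commute)
  then show ?case using Cons by auto
qed auto

text \<open>If the smaller letter \<open>a\<close> began an admissible word for the same element, it
  would be a left descent and could be moved to the front of \<open>b # v\<close>. So it commutes
  with \<open>b\<close> and with everything else before it: reading \<open>b\<close> forbids it, and
  it is still forbidden when its turn comes.\<close>

lemma adm_first_letter_le:
  assumes T: "T \<subseteq> S" and "adm T {} (a # u)" "adm T {} (b # v)" "act \<one> (a # u) = act \<one> (b # v)"
  shows "\<not> rk a < rk b"
proof
  assume ab: "rk a < rk b"
  have S: "a \<in> S" "set u \<subseteq> S" "set v \<subseteq> S" "b \<in> S" using assms adm_set by fastforce+
  have asc: "ascending \<one> (a # u)" "ascending \<one> (b # v)"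
    by (rule adm_ascending[OF one_closed T _ assms(2)] adm_ascending[OF one_closed T _ assms(3)],
        simp add: D_one)+
  let ?g = "act \<one> (b # v)"
  have g: "?g = r a \<otimes> act \<one> u" using S assms(4) act_one[of "r a" u] r_closed by simp
  have uc: "act \<one> u \<in> carrier G" using S by auto
  have "r a \<otimes> ?g = act \<one> u"
    unfolding g using S uc by (simp add: r_closed r_r flip: m_assoc)
  moreover have "len (act \<one> u) \<le> length u" using len_act_le[of \<one> u] S len_one by simp
  moreover have "len ?g = Suc (length u)"
    using len_ascending[OF one_closed asc(1)] assms(4) len_one by simp
  ultimately have "len (r a \<otimes> ?g) < len ?g" by simp
  then obtain u1 u2 where u: "b # v = u1 @ a # u2" "\<forall>c\<in>set u1. nb c a"
    using left_descent_split[OF \<open>a \<in> S\<close> asc(2)] by metis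
  then obtain u1' where u1: "u1 = b # u1'" using ab by (cases u1) auto
  then have "a \<in> upd T {} b" using u ab assms(2) by (auto simp: upd_def nb_commute)
  then show False using forbidden_not_adm[of a "upd T {} b" u1' T u2] u u1 assms(3) by auto
qed

lemma adm_act_inj:
  assumes T: "T \<subseteq> S" and "adm T {} w" "adm T {} w'" "act \<one> w = act \<one> w'"
  shows "w = w'"
proof -
  have len: "length w = length w'"
    using len_ascending[OF one_closed adm_ascending[OF one_closed T]] D_one assms
    by (metis add_0 empty_subsetI len_one)
  \<comment> \<open>Peeling off a common first letter moves the base point and enlarges the
    forbidden set; hence the arbitrary \<open>x\<close>, and the return to the empty set by
    \<open>adm_antimono\<close>.\<close>
  have "act x w = act x w' \<Longrightarrow> x \<in> carrier G \<Longrightarrow> adm T {} w \<Longrightarrow> adm T {} w' \<Longrightarrow> w = w'" for x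
    using len
  proof (induction w w' arbitrary: x rule: list_induct2)
    case (Cons a u b v)
    have S: "a \<in> S" "set u \<subseteq> S" "set v \<subseteq> S" "b \<in> S" using Cons.prems T adm_set by fastforce+
    then have "act \<one> (a # u) = act \<one> (b # v)"
      using Cons.prems act_one[of x "a # u"] act_one[of x "b # v"] act_closed[of \<one> "a # u"]
        act_closed[of \<one> "b # v"] by simp
    then have "rk a = rk b"
      using adm_first_letter_le[OF T] Cons.prems(3,4) by (metis linorder_neqE_nat)
    then have ab: "a = b" using inj_on_rk S by (auto dest: inj_onD)
    show ?case
      using Cons.IH[of "x \<otimes> r a"] Cons.prems S ab r_closed adm_antimono[of "{}"] by auto
  qed auto
  from this[of \<one>] show ?thesis using assms by auto
qed

end

section \<open>Clique polynomials\<close>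

definition cliques :: "('s \<Rightarrow> 's \<Rightarrow> bool) \<Rightarrow> 's set \<Rightarrow> 's set set" where
  "cliques nb X = {c. c \<subseteq> X \<and> (\<forall>s\<in>c. \<forall>t\<in>c. s \<noteq> t \<longrightarrow> nb s t)}"

text \<open>At z = t / (1 + t) this is the reciprocal of the growth series at t of the right-angled
  Coxeter group on \<open>X\<close> with commuting pairs \<open>nb\<close>.\<close>

definition clique_poly :: "('s \<Rightarrow> 's \<Rightarrow> bool) \<Rightarrow> 's set \<Rightarrow> real \<Rightarrow> real" where
  "clique_poly nb X z = (\<Sum>c\<in>cliques nb X. (- z) ^ card c)"

lemma finite_cliques: "finite X \<Longrightarrow> finite (cliques nb X)"
  by (rule finite_subset[of _ "Pow X"]) (auto simp: cliques_def)

lemma clique_poly_empty [simp]: "clique_poly nb {} z = 1"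
proof -
  have "cliques nb {} = {{}}" by (auto simp: cliques_def)
  then show ?thesis by (simp add: clique_poly_def)
qed

text \<open>Cliques containing \<open>s\<close> arise from cliques among the neighbours of
  \<open>s\<close> by adding one vertex, which contributes a factor \<open>- z\<close>.\<close>

lemma clique_poly_insert:
  assumes "finite X" "s \<notin> X" and sym: "\<And>s t. nb s t \<Longrightarrow> nb t s"
  shows "clique_poly nb (insert s X) z = clique_poly nb X z - z * clique_poly nb {t \<in> X. nb s t} z"
proof -
  let ?N = "{t \<in> X. nb s t}"
  have split: "cliques nb (insert s X) = cliques nb X \<union> insert s ` cliques nb ?N"
  proof (intro equalityI subsetI)
    fix c assume c: "c \<in> cliques nb (insert s X)"
    show "c \<in> cliques nb X \<union> insert s ` cliques nb ?N"
    proof (cases "s \<in> c")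
      case True
      then have "c = insert s (c - {s})" "c - {s} \<in> cliques nb ?N"
        using c by (auto simp: cliques_def)
      then show ?thesis by blast
    qed (use c in \<open>auto simp: cliques_def\<close>)
  qed (auto simp: cliques_def intro: sym)
  have s: "s \<notin> c" if "c \<in> cliques nb ?N" for c using that assms(2) by (auto simp: cliques_def)
  have fin: "finite c" if "c \<in> cliques nb ?N" for c
    using that assms(1) by (auto simp: cliques_def intro: finite_subset)
  have "clique_poly nb (insert s X) z
      = clique_poly nb X z + (\<Sum>c\<in>insert s ` cliques nb ?N. (- z) ^ card c)"
    unfolding clique_poly_def split
    by (rule sum.union_disjoint) (use assms in \<open>auto simp: finite_cliques cliques_def\<close>)
  also have "(\<Sum>c\<in>insert s ` cliques nb ?N. (- z) ^ card c)
      = (\<Sum>c\<in>cliques nb ?N. (- z) ^ card (insert s c))"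
    by (subst sum.reindex) (auto simp: inj_on_def dest!: s dest: insert_ident[THEN iffD1, rotated 2])
  also have "\<dots> = (\<Sum>c\<in>cliques nb ?N. (- z) * (- z) ^ card c)"
    using s fin by (intro sum.cong) auto
  also have "\<dots> = - z * clique_poly nb ?N z"
    unfolding clique_poly_def sum_distrib_left ..
  finally show ?thesis by simp
qed

section \<open>Counting edges by degrees and common neighbours\<close>

lemma card_edge_cliques:
  assumes "finite S" and sym: "\<And>s t. nb s t \<Longrightarrow> nb t s" and irrefl: "\<And>s. \<not> nb s s"
  shows "2 * card {c \<in> cliques nb S. card c = 2} = (\<Sum>s\<in>S. card {t \<in> S. nb s t})"
proof -
  let ?C = "{c \<in> cliques nb S. card c = 2}"
  have fC: "finite ?C" using finite_cliques[OF assms(1)] by auto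
  have "card {t \<in> S. nb s t} = card {c \<in> ?C. s \<in> c}" if "s \<in> S" for s
  proof (rule bij_betw_same_card[of "\<lambda>t. {s, t}"], rule bij_betwI')
    fix c assume c: "c \<in> {c \<in> ?C. s \<in> c}"
    then obtain a b where "c = {a, b}" "a \<noteq> b" by (auto simp: card_2_iff)
    with c obtain t where t: "c = {s, t}" "s \<noteq> t" by (cases "s = a") auto
    then have "t \<in> {t \<in> S. nb s t}" using c by (auto simp: cliques_def)
    then show "\<exists>t\<in>{t \<in> S. nb s t}. c = {s, t}" using t by blast
  next
    fix t assume t: "t \<in> {t \<in> S. nb s t}"
    then have "s \<noteq> t" using irrefl by auto
    then show "{s, t} \<in> {c \<in> ?C. s \<in> c}"
      using t that by (auto simp: cliques_def intro: sym)
  qed (auto simp: doubleton_eq_iff)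
  then have "(\<Sum>s\<in>S. card {t \<in> S. nb s t}) = (\<Sum>s\<in>S. \<Sum>c | c \<in> ?C \<and> s \<in> c. 1)" by simp
  also have "\<dots> = (\<Sum>c\<in>?C. \<Sum>s | s \<in> S \<and> s \<in> c. 1)"
    by (rule sum.swap_restrict) (use assms(1) fC in auto)
  also have "\<dots> = (\<Sum>c\<in>?C. 2)"
  proof (rule sum.cong)
    fix c assume "c \<in> ?C"
    then have "{s \<in> S. s \<in> c} = c" "card c = 2" by (auto simp: cliques_def)
    then show "(\<Sum>s | s \<in> S \<and> s \<in> c. 1) = (2::nat)" by simp
  qed auto
  finally show ?thesis by simp
qed

text \<open>Without cliques of more than three vertices the polynomial is a cubic. Its last term,
  minus z ^ 3 times the number of triangles, is dropped.\<close>

lemma clique_poly_le: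
  fixes z :: real
  assumes "finite S" "z \<ge> 0" and four: "\<And>c. c \<in> cliques nb S \<Longrightarrow> card c \<le> 3"
  shows "clique_poly nb S z \<le> 1 - card S * z + card {c \<in> cliques nb S. card c = 2} * z\<^sup>2"
proof -
  let ?C = "\<lambda>n. {c \<in> cliques nb S. card c = n}"
  have fin: "finite (?C n)" for n using finite_cliques[OF assms(1)] by auto
  have f: "finite c" if "c \<in> cliques nb S" for c
    using that assms(1) by (auto simp: cliques_def intro: finite_subset)
  have "(\<Sum>c\<in>cliques nb S. (- z) ^ card c) = (\<Sum>n\<in>{..3}. \<Sum>c\<in>?C n. (- z) ^ card c)"
    by (rule sum.group[symmetric]) (use assms finite_cliques four in auto)
  also have "\<dots> = (\<Sum>n\<in>{..3}. card (?C n) * (- z) ^ n)"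
    by (intro sum.cong) auto
  also have "\<dots> = card (?C 0) - card (?C 1) * z + card (?C 2) * z\<^sup>2 - card (?C 3) * z ^ 3"
    by (simp add: numeral_3_eq_3 numeral_2_eq_2 algebra_simps)
  also have "?C 0 = {{}}" using f by (auto simp: cliques_def)
  also have "?C 1 = (\<lambda>s. {s}) ` S" using f by (auto simp: cliques_def card_1_singleton_iff)
  also have "card ((\<lambda>s. {s}) ` S) = card S" by (rule card_image) auto
  finally show ?thesis using assms(2) by (simp add: clique_poly_def)
qed

text \<open>Count vertices together with an ordered pair of distinct neighbours. A vertex of degree
  d contributes d (d - 1), and each pair is counted at most twice, so the sum of d (d - 1) is at
  most 2 k (k - 1). The integer inequality d (d - 1) \<ge> 12 d - 42 makes this linear in the
  degrees.\<close>

lemma sum_degree_le: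
  assumes "finite S" and sym: "\<And>s t. nb s t \<Longrightarrow> nb t s"
    and common: "\<And>u v. u \<in> S \<Longrightarrow> v \<in> S \<Longrightarrow> u \<noteq> v \<Longrightarrow> card {s \<in> S. nb s u \<and> nb s v} \<le> 2"
  shows "6 * (\<Sum>s\<in>S. card {t \<in> S. nb s t}) \<le> card S * (card S + 20)"
proof -
  define d where "d s = card {t \<in> S. nb s t}" for s
  define k where "k = card S"
  let ?P = "{(u, v) \<in> S \<times> S. u \<noteq> v}"
  have fP: "finite ?P"
    by (rule finite_subset[of _ "S \<times> S"]) (use assms(1) in auto)
  have card_off_diag: "int (card {(u, v) \<in> A \<times> A. u \<noteq> v}) = int (card A) * (int (card A) - 1)"
    if "finite A" for A :: "'a set"
  proof -
    have "{(u, v) \<in> A \<times> A. u \<noteq> v} = A \<times> A - (\<lambda>u. (u, u)) ` A" by auto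
    moreover have "card (A \<times> A - (\<lambda>u. (u, u)) ` A) = card (A \<times> A) - card ((\<lambda>u. (u, u)) ` A)"
      using that by (intro card_Diff_subset) auto
    moreover have "card ((\<lambda>u. (u, u)) ` A) = card A" by (rule card_image) (auto simp: inj_on_def)
    moreover have "card A \<le> card A * card A" by (cases "card A") auto
    ultimately show ?thesis
      by (simp add: card_cartesian_product of_nat_diff algebra_simps)
  qed
  have "(\<Sum>s\<in>S. card {(u, v) \<in> ?P. nb s u \<and> nb s v}) = (\<Sum>s\<in>S. \<Sum>q | q \<in> ?P \<and> nb s (fst q) \<and> nb s (snd q). 1)"
    by (intro sum.cong) (auto intro!: arg_cong[of _ _ card])
  also have "\<dots> = (\<Sum>q\<in>?P. \<Sum>s | s \<in> S \<and> nb s (fst q) \<and> nb s (snd q). 1)"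
    by (rule sum.swap_restrict) (use assms(1) fP in auto)
  also have "\<dots> \<le> (\<Sum>q\<in>?P. 2)"
    using common by (intro sum_mono) auto
  finally have "(\<Sum>s\<in>S. card {(u, v) \<in> ?P. nb s u \<and> nb s v}) \<le> 2 * card ?P" by simp
  then have "int (\<Sum>s\<in>S. card {(u, v) \<in> ?P. nb s u \<and> nb s v}) \<le> int (2 * card ?P)"
    unfolding of_nat_le_iff .
  also have "\<dots> = 2 * int (card ?P)" by simp
  also have "int (card ?P) = int k * (int k - 1)" using card_off_diag assms(1) by (simp add: k_def)
  finally have le: "(\<Sum>s\<in>S. int (card {(u, v) \<in> ?P. nb s u \<and> nb s v})) \<le> 2 * (int k * (int k - 1))"
    by simp
  \<comment> \<open>\<open>(d - 6) * (d - 7) \<ge> 0\<close> for integers \<open>d\<close>; 6 is near the extremal degree for \<open>k = 18\<close>\<close>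
  have "12 * int (d s) - 42 \<le> int (card {(u, v) \<in> ?P. nb s u \<and> nb s v})" for s
  proof -
    have "{(u, v) \<in> ?P. nb s u \<and> nb s v} = {(u, v) \<in> {t \<in> S. nb s t} \<times> {t \<in> S. nb s t}. u \<noteq> v}" by auto
    then have "int (card {(u, v) \<in> ?P. nb s u \<and> nb s v}) = int (d s) * (int (d s) - 1)"
      using card_off_diag[of "{t \<in> S. nb s t}"] assms(1) by (simp add: d_def)
    moreover have "0 \<le> (int (d s) - 6) * (int (d s) - 7)"
      by (cases "d s \<le> 6") (auto intro: mult_nonpos_nonpos)
    ultimately show ?thesis by (simp add: algebra_simps)
  qed
  then have "(\<Sum>s\<in>S. 12 * int (d s) - 42) \<le> 2 * (int k * (int k - 1))"
    by (intro order_trans[OF sum_mono le])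
  then have "12 * int (\<Sum>s\<in>S. d s) \<le> 2 * (int k * (int k + 20))"
    by (simp add: sum_subtractf k_def sum_distrib_left algebra_simps)
  then have "int (6 * (\<Sum>s\<in>S. d s)) \<le> int (k * (k + 20))" by simp
  then show ?thesis unfolding d_def k_def of_nat_le_iff .
qed

context right_angled_coxeter
begin

text \<open>The new state consists of \<open>s\<close> and some neighbours of \<open>s\<close>. A
  vertex joined to all others splits off the factor 1 - z.\<close>

lemma clique_poly_upd:
  assumes "T \<subseteq> S" "X \<subseteq> T" "s \<in> T - X"
  shows "clique_poly nb (upd T X s) z
    = (1 - z) * clique_poly nb {t \<in> X \<union> {a \<in> T. rk a < rk s}. nb s t} z"
proof -
  let ?N = "{t \<in> X \<union> {a \<in> T. rk a < rk s}. nb s t}"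
  have "finite ?N" using assms finite_S by (auto intro: finite_subset[of _ S])
  moreover have "upd T X s = insert s ?N" using assms nb_irrefl by (auto simp: upd_def nb_commute)
  moreover have "{t \<in> ?N. nb s t} = ?N" by auto
  ultimately show ?thesis
    using clique_poly_insert[of ?N s nb z] nb_irrefl nb_sym by (auto simp: algebra_simps)
qed

text \<open>Adding the letters of \<open>T - X\<close> to \<open>X\<close> one at a time, in increasing order, telescopes.\<close>

lemma sum_clique_poly_upd:
  fixes z :: real
  assumes "T \<subseteq> S" "X \<subseteq> T"
  shows "z * (\<Sum>s\<in>T - X. clique_poly nb (upd T X s) z)
    = (1 - z) * (clique_poly nb X z - clique_poly nb T z)"
proof -
  have fT: "finite T" using assms finite_S finite_subset by blast
  \<comment> \<open>\<open>Y m\<close> is the state after all letters of rank below \<open>m\<close>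
    have been added, and \<open>N s\<close> collects the neighbours of \<open>s\<close> present when
    \<open>s\<close> is added; these are the sets that occur in
    \<open>clique_poly_upd\<close>.\<close>
  define Y where "Y m = X \<union> {a \<in> T. rk a < m}" for m
  define N where "N s = {t \<in> Y (rk s). nb s t}" for s
  have fY: "finite (Y m)" for m
    using assms fT by (auto simp: Y_def intro: finite_subset[of _ T])
  have step: "z * (\<Sum>s | s \<in> T - X \<and> rk s < m. clique_poly nb (N s) z)
      = clique_poly nb X z - clique_poly nb (Y m) z" for m
  proof (induction m)
    case (Suc m)
    show ?case
    proof (cases "\<exists>s\<in>T - X. rk s = m")
      case True
      then obtain s where s: "s \<in> T - X" "rk s = m" by auto
      have uniq: "a = s" if "a \<in> T" "rk a = m" for a
        using that s assms inj_on_rk by (auto dest: inj_onD)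
      have "{a \<in> T - X. rk a < Suc m} = insert s {a \<in> T - X. rk a < m}"
        using s uniq by (auto simp: less_Suc_eq)
      then have "(\<Sum>a | a \<in> T - X \<and> rk a < Suc m. clique_poly nb (N a) z)
          = clique_poly nb (N s) z + (\<Sum>a | a \<in> T - X \<and> rk a < m. clique_poly nb (N a) z)"
        using s fT by (simp add: finite_subset)
      moreover have "Y (Suc m) = insert s (Y m)" "s \<notin> Y m"
        using s uniq by (auto simp: Y_def less_Suc_eq)
      moreover have "N s = {t \<in> Y m. nb s t}" by (simp add: N_def s)
      ultimately show ?thesis
        using Suc.IH clique_poly_insert[OF fY \<open>s \<notin> Y m\<close>, of nb z] nb_sym by (simp add: algebra_simps)
    next
      case False
      then have "{a \<in> T - X. rk a < Suc m} = {a \<in> T - X. rk a < m}" "Y (Suc m) = Y m"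
        by (auto simp: Y_def less_Suc_eq)
      then show ?thesis using Suc.IH by simp
    qed
  qed (simp add: Y_def)
  obtain m where m: "\<forall>s\<in>T. rk s < m"
    using fT finite_nat_set_iff_bounded[of "rk ` T"] by auto
  have "Y m = T" using m assms by (auto simp: Y_def)
  moreover have "{s \<in> T - X. rk s < m} = T - X" using m by auto
  ultimately have "z * (\<Sum>s\<in>T - X. clique_poly nb (N s) z) = clique_poly nb X z - clique_poly nb T z"
    using step[of m] by simp
  moreover have "(\<Sum>s\<in>T - X. clique_poly nb (upd T X s) z)
      = (1 - z) * (\<Sum>s\<in>T - X. clique_poly nb (N s) z)"
    unfolding sum_distrib_left by (rule sum.cong) (auto simp: clique_poly_upd[OF assms] N_def Y_def)
  ultimately show ?thesis by (metis mult.left_commute)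
qed

end

section \<open>Lorentzian linear algebra\<close>

lemma lorentz_commute: "lorentz x y = lorentz y x"
  by (simp add: lorentz_def inner_commute mult.commute)

lemma lorentz_simps [simp]:
  "lorentz (x + y) z = lorentz x z + lorentz y z"
  "lorentz z (x + y) = lorentz z x + lorentz z y"
  "lorentz (x - y) z = lorentz x z - lorentz y z"
  "lorentz z (x - y) = lorentz z x - lorentz z y"
  "lorentz (- x) z = - lorentz x z"
  "lorentz z (- x) = - lorentz z x"
  "lorentz (c *\<^sub>R x) z = c * lorentz x z"
  "lorentz z (c *\<^sub>R x) = c * lorentz z x"
  "lorentz 0 z = 0"
  "lorentz z 0 = 0"
  by (simp_all add: lorentz_def inner_simps algebra_simps)

lemma lorentz_sum_left: "lorentz (\<Sum>a\<in>A. f a) z = (\<Sum>a\<in>A. lorentz (f a) z)"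
  by (induction A rule: infinite_finite_induct) simp_all

text \<open>Time reversal turns the Lorentz form into the inner product, so that dimension counts
  for Euclidean hyperplanes can be used.\<close>

definition tflip :: "minkowski \<Rightarrow> minkowski" where
  "tflip x = (fst x, - snd x)"

lemma lorentz_eq_inner: "lorentz x y = tflip y \<bullet> x"
  by (simp add: lorentz_def tflip_def inner_prod_def inner_commute)

lemma tflip_eq_0_iff [simp]: "tflip x = 0 \<longleftrightarrow> x = 0"
  by (simp add: tflip_def prod_eq_iff)

lemma lorentz_nondegenerate: "(\<And>y. lorentz y x = 0) \<Longrightarrow> x = 0"
  by (metis inner_eq_zero_iff lorentz_eq_inner tflip_eq_0_iff)

lemma tendsto_lorentz [tendsto_intros]:
  "(f \<longlongrightarrow> a) F \<Longrightarrow> (g \<longlongrightarrow> b) F \<Longrightarrow> ((\<lambda>x. lorentz (f x) (g x)) \<longlongrightarrow> lorentz a b) F"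
  unfolding lorentz_def by (intro tendsto_intros)

lemma subspace_lorentz: "subspace {x. lorentz x n = 0}"
  by (simp add: subspace_def)

lemma dim_lorentz_orthogonal: "n \<noteq> 0 \<Longrightarrow> dim {x. lorentz x n = 0} = 3"
  using dim_hyperplane[of "tflip n"] by (simp add: lorentz_eq_inner)

lemma lorentz_independent:
  assumes "finite A" "\<And>a b. a \<in> A \<Longrightarrow> b \<in> A \<Longrightarrow> a \<noteq> b \<Longrightarrow> lorentz a b = 0"
    "\<And>a. a \<in> A \<Longrightarrow> lorentz a a \<noteq> 0"
  shows "independent A"
proof
  assume "dependent A"
  then obtain u v where uv: "v \<in> A" "u v \<noteq> 0" "(\<Sum>a\<in>A. u a *\<^sub>R a) = 0"
    using dependent_finite[OF assms(1)] by auto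
  have "0 = lorentz (\<Sum>a\<in>A. u a *\<^sub>R a) v" using uv by simp
  also have "\<dots> = (\<Sum>a\<in>A. u a * lorentz a v)" by (simp add: lorentz_sum_left)
  also have "\<dots> = (\<Sum>a\<in>A. if a = v then u v * lorentz v v else 0)"
    using assms(2) uv by (intro sum.cong) auto
  also have "\<dots> = u v * lorentz v v" using assms(1) uv by simp
  finally show False using uv assms(3) by simp
qed

section \<open>The future cone\<close>

definition future :: "minkowski \<Rightarrow> bool" where
  "future x \<longleftrightarrow> lorentz x x < 0 \<and> snd x > 0"

lemma future_iff: "future x \<longleftrightarrow> norm (fst x) < snd x"
proof -
  have "lorentz x x = (norm (fst x))\<^sup>2 - (snd x)\<^sup>2"
    by (simp add: lorentz_def dot_square_norm flip: power2_eq_square)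
  then show ?thesis
    unfolding future_def
    by (smt (verit) norm_ge_zero power2_less_imp_less power_strict_mono zero_less_numeral)
qed

lemma H3_future: "x \<in> H3 \<Longrightarrow> future x"
  by (simp add: H3_def future_def)

lemma future_add: "future x \<Longrightarrow> future y \<Longrightarrow> future (x + y)"
  unfolding future_iff using norm_triangle_ineq[of "fst x" "fst y"] by simp

lemma future_scale: "future x \<Longrightarrow> c > 0 \<Longrightarrow> future (c *\<^sub>R x)"
  unfolding future_iff by simp

lemma future_sum: "finite A \<Longrightarrow> A \<noteq> {} \<Longrightarrow> (\<And>a. a \<in> A \<Longrightarrow> future (f a)) \<Longrightarrow> future (\<Sum>a\<in>A. f a)"
  by (induction A rule: finite_ne_induct) (auto intro: future_add)

lemma future_normalize:
  assumes "future x"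
  obtains c where "c > 0" "c *\<^sub>R x \<in> H3"
proof
  let ?c = "1 / sqrt (- lorentz x x)"
  show "?c > 0" using assms by (simp add: future_def)
  have "?c * ?c = 1 / (- lorentz x x)" using assms by (simp add: future_def)
  then have "?c * (?c * lorentz x x) = -1"
    using assms by (simp add: future_def flip: mult.assoc)
  then show "?c *\<^sub>R x \<in> H3" using assms by (simp add: H3_def future_def)
qed

lemma future_lorentz_neg: "future x \<Longrightarrow> future y \<Longrightarrow> lorentz x y < 0"
proof -
  assume x: "future x" and y: "future y"
  have "fst x \<bullet> fst y \<le> norm (fst x) * norm (fst y)" by (rule norm_cauchy_schwarz)
  also have "\<dots> < snd x * snd y"
    using x y unfolding future_iff by (intro mult_strict_mono') auto
  finally show ?thesis by (simp add: lorentz_def)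
qed

lemma timelike_orthogonal_spacelike:
  assumes x: "future x" and "lorentz y x = 0" "y \<noteq> 0"
  shows "lorentz y y > 0"
proof -
  have eq: "fst y \<bullet> fst x = snd y * snd x" using assms by (simp add: lorentz_def)
  have sx: "snd x > 0" "norm (fst x) < snd x" using x unfolding future_def[of x] by (auto simp flip: future_iff simp: x)
  have y: "fst y \<noteq> 0"
  proof
    assume "fst y = 0"
    then have "snd y = 0" using eq sx by simp
    then show False using \<open>fst y = 0\<close> assms(3) by (simp add: prod_eq_iff)
  qed
  have "\<bar>snd y\<bar> * snd x = \<bar>fst y \<bullet> fst x\<bar>" using eq sx by (simp add: abs_mult)
  also have "\<dots> \<le> norm (fst y) * norm (fst x)" by (rule Cauchy_Schwarz_ineq2)
  also have "\<dots> < norm (fst y) * snd x" using y sx by simp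
  finally have "\<bar>snd y\<bar> < norm (fst y)" using sx by simp
  then have "(snd y)\<^sup>2 < (norm (fst y))\<^sup>2"
    by (metis abs_ge_zero power2_abs power_strict_mono zero_less_numeral)
  then show ?thesis by (simp add: lorentz_def dot_square_norm flip: power2_eq_square)
qed

text \<open>Timelike vectors form two opposite cones, and vectors of the same cone have negative
  product, so the product with one future vector tells the cones apart.\<close>

lemma futureI:
  assumes "future x" "lorentz y y < 0" "lorentz x y < 0"
  shows "future y"
proof -
  have "snd y \<noteq> 0"
    using assms(2) inner_ge_zero[of "fst y"] by (auto simp: lorentz_def simp del: inner_ge_zero)
  moreover have "\<not> snd y < 0"
  proof
    assume "snd y < 0"
    then have "future (- y)" using assms(2) by (simp add: future_def)
    then show False using future_lorentz_neg[OF assms(1)] assms(3) by fastforce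
  qed
  ultimately show ?thesis using assms(2) by (simp add: future_def)
qed

lemma eventually_future:
  assumes "future y"
  shows "eventually (\<lambda>e. future (y + e *\<^sub>R v)) (at_right 0)"
proof -
  have "((\<lambda>e. snd (y + e *\<^sub>R v) - norm (fst (y + e *\<^sub>R v))) \<longlongrightarrow>
      snd (y + 0 *\<^sub>R v) - norm (fst (y + 0 *\<^sub>R v))) (at_right 0)"
    by (intro tendsto_intros)
  moreover have "snd (y + 0 *\<^sub>R v) - norm (fst (y + 0 *\<^sub>R v)) > 0"
    using assms by (simp add: future_iff)
  ultimately have "eventually (\<lambda>e. snd (y + e *\<^sub>R v) - norm (fst (y + e *\<^sub>R v)) > 0) (at_right 0)"
    using order_tendstoD(1) by blast
  then show ?thesis by (simp add: future_iff)
qed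

text \<open>Three orthonormal spacelike vectors in signature (3,1) have a timelike line as
  orthogonal complement. Removing from (0, 1) its components along them gives a timelike
  \<open>t\<close>; a vector of the complement off the line of \<open>t\<close> would yield a fifth
  independent vector in dimension four.\<close>

lemma timelike_if_orthogonal_triple:
  assumes n: "lorentz a a = 1" "lorentz b b = 1" "lorentz c c = 1"
    and o: "lorentz a b = 0" "lorentz a c = 0" "lorentz b c = 0"
    and y: "lorentz y a = 0" "lorentz y b = 0" "lorentz y c = 0" "y \<noteq> 0"
  shows "lorentz y y < 0"
proof -
  define x :: minkowski where "x = (0, 1)"
  define t where "t = x - lorentz x a *\<^sub>R a - lorentz x b *\<^sub>R b - lorentz x c *\<^sub>R c"
  have x: "lorentz x x = -1" "future x" by (simp_all add: x_def lorentz_def future_def)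
  have o': "lorentz b a = 0" "lorentz c a = 0" "lorentz c b = 0"
    using o by (simp_all add: lorentz_commute)
  have ta: "lorentz t a = 0" "lorentz t b = 0" "lorentz t c = 0"
    by (simp_all add: t_def n o o')
  have "lorentz t t = lorentz t x - lorentz x a * lorentz t a - lorentz x b * lorentz t b
      - lorentz x c * lorentz t c"
    by (subst (2) t_def) simp
  also have "\<dots> = lorentz t x" by (simp add: ta)
  finally have tt: "lorentz t t = lorentz t x" .
  have sx: "lorentz a x = lorentz x a" "lorentz b x = lorentz x b" "lorentz c x = lorentz x c"
    by (rule lorentz_commute)+
  note tt
  also have "lorentz t x = -1 - (lorentz x a)\<^sup>2 - (lorentz x b)\<^sup>2 - (lorentz x c)\<^sup>2"
    by (simp add: t_def x sx power2_eq_square)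
  finally have tx: "lorentz t t < 0" "lorentz x t < 0"
    using tt lorentz_commute[of x t] zero_le_power2[of "lorentz x a"]
      zero_le_power2[of "lorentz x b"] zero_le_power2[of "lorentz x c"] by linarith+
  then have t: "future t" using futureI x by blast
  define z where "z = y - (lorentz y t / lorentz t t) *\<^sub>R t"
  have zt: "lorentz z t = 0" using tx by (simp add: z_def)
  have za: "lorentz z a = 0" "lorentz z b = 0" "lorentz z c = 0" by (simp_all add: z_def ta y)
  have "z = 0"
  proof (rule ccontr)
    assume "z \<noteq> 0"
    then have zz: "lorentz z z > 0" using timelike_orthogonal_spacelike[OF t zt] by simp
    have sym: "lorentz a z = 0" "lorentz b z = 0" "lorentz c z = 0" "lorentz t z = 0"
      "lorentz a t = 0" "lorentz b t = 0" "lorentz c t = 0"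
      using za zt ta by (simp_all add: lorentz_commute)
    have neq: "u \<noteq> v" if "lorentz u u \<noteq> 0" "lorentz u v = 0" for u v
      using that by auto
    have d: "distinct [a, b, c, t, z]"
      using tx zz by (simp add: neq n o sym)
    have "independent {a, b, c, t, z}"
    proof (rule lorentz_independent)
      show "lorentz u v = 0" if "u \<in> {a, b, c, t, z}" "v \<in> {a, b, c, t, z}" "u \<noteq> v" for u v
        using that by (elim insertE emptyE) (simp_all add: o o' za ta zt sym)
      show "lorentz u u \<noteq> 0" if "u \<in> {a, b, c, t, z}" for u
        using that n tx zz by (elim insertE emptyE) simp_all
    qed simp
    then have "card {a, b, c, t, z} \<le> DIM(minkowski)" using independent_card_le by blast
    moreover have "card {a, b, c, t, z} = 5" using d by simp
    ultimately show False by simp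
  qed
  then have yt: "y = (lorentz y t / lorentz t t) *\<^sub>R t" by (simp add: z_def)
  define q where "q = lorentz y t / lorentz t t"
  have "lorentz y y = q\<^sup>2 * lorentz t t" using yt[folded q_def]
    by (metis lorentz_simps(7,8) power2_eq_square mult.assoc)
  moreover have "q \<noteq> 0" using yt[folded q_def] y(4) by auto
  ultimately show ?thesis using tx by (simp add: mult_less_0_iff)
qed

lemma dim_lorentz_orthogonal_pair:
  assumes "lorentz m m = 1" "lorentz n n = 1" "\<bar>lorentz m n\<bar> < 1"
  shows "dim {x. lorentz x m = 0 \<and> lorentz x n = 0} = 2"
proof -
  let ?A = "span {tflip m, tflip n}"
  have "dim {y \<in> UNIV. \<forall>x\<in>?A. orthogonal x y} + dim ?A = dim (UNIV :: minkowski set)"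
    by (rule dim_subspace_orthogonal_to_vectors) auto
  moreover have "{y \<in> UNIV. \<forall>x\<in>?A. orthogonal x y} = {x. lorentz x m = 0 \<and> lorentz x n = 0}"
  proof safe
    fix y assume "\<forall>x\<in>?A. orthogonal x y"
    then have "orthogonal (tflip m) y" "orthogonal (tflip n) y" by (auto intro: span_base)
    then show "lorentz y m = 0" "lorentz y n = 0" by (simp_all add: lorentz_eq_inner orthogonal_def)
  next
    fix y x assume y: "lorentz y m = 0" "lorentz y n = 0" and x: "x \<in> ?A"
    have "orthogonal y x"
      by (rule orthogonal_to_span[OF x])
        (use y in \<open>auto simp: lorentz_eq_inner orthogonal_def inner_commute\<close>)
    then show "orthogonal x y" by (simp add: orthogonal_commute)
  qed simp_all
  moreover have "dim ?A = 2"
  proof -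
    have ne: "tflip n \<noteq> c *\<^sub>R tflip m" for c
    proof
      assume "tflip n = c *\<^sub>R tflip m"
      then have "n = c *\<^sub>R m" by (auto simp: tflip_def prod_eq_iff)
      then have "lorentz m n = c" "lorentz n n = c * c" using assms(1) by simp_all
      then have "\<bar>c\<bar> * \<bar>c\<bar> = 1" "\<bar>c\<bar> < 1" using assms by (auto simp: abs_mult_self_eq)
      then show False by (metis abs_ge_zero less_irrefl mult.right_neutral mult_strict_mono' zero_le_one)
    qed
    have "m \<noteq> 0" using assms by auto
    then have "independent {tflip n, tflip m}"
      using ne by (auto simp: independent_insert span_singleton)
    moreover have "tflip m \<noteq> tflip n" using ne[of 1] by auto
    ultimately show ?thesis by (metis card_2_iff dim_eq_card_independent dim_span insert_commute)
  qed
  ultimately show ?thesis by simp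
qed

text \<open>From a point strictly inside all constraints that do not vanish on \<open>Z\<close>, a
  small move in any direction of \<open>Z\<close> stays in the cone. Up to a factor, every direction
  is thus a difference of two cone vectors, and these are multiples of points of
  \<open>H3\<close>.\<close>

lemma cone_span:
  assumes "finite N" and Z: "subspace Z" "y \<in> Z" and y: "future y"
    and N: "\<And>n. n \<in> N \<Longrightarrow> lorentz y n < 0 \<or> (\<forall>v\<in>Z. lorentz v n = 0)"
  shows "Z \<subseteq> span {x \<in> H3 \<inter> Z. \<forall>n\<in>N. lorentz x n \<le> 0}" (is "_ \<subseteq> span ?C")
proof
  have in_span: "w \<in> span ?C" if "future w" "w \<in> Z" "\<forall>n\<in>N. lorentz w n \<le> 0" for w
  proof -
    obtain c where c: "c > 0" "c *\<^sub>R w \<in> H3" using future_normalize \<open>future w\<close> by blast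
    then have "c *\<^sub>R w \<in> ?C" using that Z by (auto simp: subspace_scale mult_le_0_iff)
    then have "(1 / c) *\<^sub>R (c *\<^sub>R w) \<in> span ?C" by (intro span_scale span_base)
    then show ?thesis using c by simp
  qed
  fix v assume v: "v \<in> Z"
  have "eventually (\<lambda>e. \<forall>n\<in>N. lorentz (y + e *\<^sub>R v) n \<le> 0) (at_right 0)"
  proof (intro eventually_ball_finite[OF assms(1)] ballI)
    fix n assume n: "n \<in> N"
    show "eventually (\<lambda>e. lorentz (y + e *\<^sub>R v) n \<le> 0) (at_right 0)"
    proof (cases "lorentz y n < 0")
      case True
      have "((\<lambda>e. lorentz (y + e *\<^sub>R v) n) \<longlongrightarrow> lorentz (y + 0 *\<^sub>R v) n) (at_right 0)"
        by (intro tendsto_intros)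
      then have "eventually (\<lambda>e. lorentz (y + e *\<^sub>R v) n < 0) (at_right 0)"
        by (rule order_tendstoD(2)) (use True in simp)
      then show ?thesis by eventually_elim simp
    next
      case False
      then show ?thesis using N[OF n] Z(2) v by simp
    qed
  qed
  then have "eventually (\<lambda>e. (\<forall>n\<in>N. lorentz (y + e *\<^sub>R v) n \<le> 0) \<and> future (y + e *\<^sub>R v) \<and> e > 0) (at_right 0)"
    using eventually_future[OF y, of v] eventually_at_right_less[of 0] by eventually_elim simp
  then obtain e where e: "\<forall>n\<in>N. lorentz (y + e *\<^sub>R v) n \<le> 0" "future (y + e *\<^sub>R v)" "e > 0"
    using eventually_happens'[OF trivial_limit_at_right_real] by blast
  have "y + e *\<^sub>R v \<in> span ?C" using e v Z by (intro in_span) (auto simp: subspace_add subspace_scale)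
  moreover have "y \<in> span ?C" using y Z N by (intro in_span ballI) (force dest: N)+
  ultimately have "(1 / e) *\<^sub>R ((y + e *\<^sub>R v) - y) \<in> span ?C" by (intro span_scale span_diff)
  then show "v \<in> span ?C" using e by simp
qed

text \<open>Take a subset of \<open>N\<close> of least cardinality that still describes
  \<open>C\<close>. Dropping \<open>n\<close> from it admits a point that violates \<open>n\<close>
  only; the positive combination of this point and \<open>z\<close> that is orthogonal to
  \<open>n\<close> is strictly inside all other constraints, so \<open>cone_span\<close> applies.
  With \<open>Z\<close> the whole space this produces the faces of a polyhedron, with
  \<open>Z\<close> a hyperplane the edges of a face.\<close>

lemma irredundant_description:
  assumes "finite N" and Z: "subspace Z" and z: "z \<in> H3 \<inter> Z" "\<And>n. n \<in> N \<Longrightarrow> lorentz z n < 0"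
    and C: "C = {x \<in> H3 \<inter> Z. \<forall>n\<in>N. lorentz x n \<le> 0}"
  shows "\<exists>A\<subseteq>N. C = {x \<in> H3 \<inter> Z. \<forall>n\<in>A. lorentz x n \<le> 0} \<and>
    (\<forall>n\<in>A. {v \<in> Z. lorentz v n = 0} \<subseteq> span {x \<in> C. lorentz x n = 0} \<and> (\<exists>y\<in>C. lorentz y n = 0))"
proof -
  define Q where "Q A \<longleftrightarrow> A \<subseteq> N \<and> C = {x \<in> H3 \<inter> Z. \<forall>n\<in>A. lorentz x n \<le> 0}" for A
  have "Q N" by (simp add: Q_def C)
  then obtain A where A: "Q A" "\<And>B. Q B \<Longrightarrow> card A \<le> card B"
    using ex_has_least_nat[of Q N card] by blast
  have fA: "finite A" using A(1) assms(1) finite_subset by (auto simp: Q_def)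
  have main: "\<exists>y. future y \<and> y \<in> Z \<and> lorentz y n = 0 \<and> (\<forall>n'\<in>A - {n}. lorentz y n' < 0)"
    if n: "n \<in> A" for n
  proof -
    have "\<not> Q (A - {n})" using A(2)[of "A - {n}"] n fA
      by (metis card_Diff1_less not_le)
    then have "C \<noteq> {x \<in> H3 \<inter> Z. \<forall>n'\<in>A - {n}. lorentz x n' \<le> 0}"
      using A(1) by (auto simp: Q_def)
    moreover have C: "C = {x \<in> H3 \<inter> Z. \<forall>n\<in>A. lorentz x n \<le> 0}" using A(1) by (simp add: Q_def)
    ultimately obtain x where x: "x \<in> H3 \<inter> Z" "\<forall>n'\<in>A - {n}. lorentz x n' \<le> 0"
      and "x \<notin> C" by blast
    then have "\<not> lorentz x n \<le> 0" unfolding C by blast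
    then have "lorentz x n > 0" by simp
    note x = x this
    define y where "y = lorentz x n *\<^sub>R z + (- lorentz z n) *\<^sub>R x"
    have zn: "lorentz z n' < 0" if "n' \<in> A" for n'
      using that A(1) z(2) unfolding Q_def by blast
    have "future y"
      unfolding y_def using x z zn[OF n] by (intro future_add future_scale) (auto intro: H3_future)
    moreover have "y \<in> Z" unfolding y_def using x z Z
      by (intro subspace_add subspace_scale) auto
    moreover have "lorentz y n = 0" by (simp add: y_def)
    moreover have "lorentz y n' < 0" if "n' \<in> A - {n}" for n'
    proof -
      have "lorentz x n * lorentz z n' < 0" using x(3) zn that by (simp add: mult_less_0_iff)
      moreover have "(- lorentz z n) * lorentz x n' \<le> 0"
        using zn[OF n] x(2) that by (auto simp: mult_le_0_iff zero_le_mult_iff)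
      ultimately show ?thesis unfolding y_def by simp
    qed
    ultimately show ?thesis by blast
  qed
  show ?thesis
  proof (intro exI[of _ A] conjI ballI)
    show "A \<subseteq> N" "C = {x \<in> H3 \<inter> Z. \<forall>n\<in>A. lorentz x n \<le> 0}" using A(1) by (auto simp: Q_def)
    fix n assume n: "n \<in> A"
    obtain y where y: "future y" "y \<in> Z" "lorentz y n = 0" "\<forall>n'\<in>A - {n}. lorentz y n' < 0"
      using main[OF n] by blast
    let ?Z = "{v \<in> Z. lorentz v n = 0}"
    have "subspace ?Z" using Z by (auto simp: subspace_def)
    then have "?Z \<subseteq> span {x \<in> H3 \<inter> ?Z. \<forall>n\<in>A. lorentz x n \<le> 0}"
      using fA y by (intro cone_span[of A ?Z y]) auto
    also have "{x \<in> H3 \<inter> ?Z. \<forall>n\<in>A. lorentz x n \<le> 0} = {x \<in> C. lorentz x n = 0}"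
      using A(1) by (auto simp: Q_def)
    finally show "?Z \<subseteq> span {x \<in> C. lorentz x n = 0}" .
    obtain c where c: "c > 0" "c *\<^sub>R y \<in> H3" using future_normalize y(1) by blast
    have "c *\<^sub>R y \<in> C"
    proof -
      have "lorentz (c *\<^sub>R y) n' \<le> 0" if "n' \<in> A" for n'
        using that y c(1) by (cases "n' = n") (auto simp: mult_le_0_iff less_imp_le)
      then show ?thesis using A(1) c y Z unfolding Q_def by (auto simp: subspace_scale)
    qed
    then show "\<exists>y\<in>C. lorentz y n = 0" using y(3) by (intro bexI[of _ "c *\<^sub>R y"]) simp_all
  qed
qed

section \<open>Normals of a right-angled polyhedron\<close>

text \<open>Moving an interior point on \<open>hplane n\<close> along \<open>n\<close> leaves the half-space.\<close>

lemma interior_point_strict: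
  assumes x: "x \<in> (top_of_set H3) interior_of P" and n: "unit_normal n" "P \<subseteq> half_space n"
  shows "lorentz x n < 0"
proof (rule ccontr)
  assume "\<not> lorentz x n < 0"
  obtain U where "openin (top_of_set H3) U" "x \<in> U" "U \<subseteq> P"
    using x by (auto simp: interior_of_def)
  then obtain W where W: "open W" "x \<in> W" "H3 \<inter> W \<subseteq> P" "x \<in> H3"
    by (auto simp: openin_open)
  then have "x \<in> P" by blast
  then have xn: "lorentz x n = 0" using \<open>\<not> lorentz x n < 0\<close> n by (auto simp: half_space_def)
  have nn: "lorentz n n = 1" using n by (simp add: unit_normal_def)
  have nx: "lorentz n x = 0" using xn by (simp add: lorentz_commute)
  \<comment> \<open>The factor on \<open>x\<close> keeps \<open>y e\<close> on the
    hyperboloid.\<close>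
  define y where "y e = sqrt (1 + e\<^sup>2) *\<^sub>R x + e *\<^sub>R n" for e :: real
  have yy: "lorentz (y e) (y e) = -1" for e
    using W(4) by (simp add: y_def H3_def xn nx nn power2_eq_square algebra_simps
        flip: real_sqrt_mult)
  have lim: "(y \<longlongrightarrow> y 0) (at_right 0)"
    unfolding y_def by (intro tendsto_intros)
  moreover have y0: "y 0 = x" by (simp add: y_def)
  ultimately have "eventually (\<lambda>e. y e \<in> W) (at_right 0)"
    using W topological_tendstoD by fastforce
  moreover have "eventually (\<lambda>e. snd (y e) > 0) (at_right 0)"
    using order_tendstoD(1)[OF tendsto_snd[OF lim], of 0] y0 W(4) by (simp add: H3_def)
  ultimately have "eventually (\<lambda>e. y e \<in> W \<and> snd (y e) > 0 \<and> e > 0) (at_right 0)"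
    using eventually_at_right_less[of 0] by eventually_elim simp
  then obtain e where e: "y e \<in> W" "snd (y e) > 0" "e > 0"
    using eventually_happens'[OF trivial_limit_at_right_real] by blast
  then have "y e \<in> P" using W yy by (auto simp: H3_def)
  then have "lorentz (y e) n \<le> 0" using n by (auto simp: half_space_def)
  then show False using e xn nn by (simp add: y_def)
qed

lemma card_4E:
  assumes "card q = 4"
  obtains a b c d where "q = {a, b, c, d}" "distinct [a, b, c, d]"
proof -
  have "finite q" using assms by (metis card.infinite zero_neq_numeral)
  then obtain xs where xs: "set xs = q" "distinct xs" using finite_distinct_list by blast
  then have "length xs = 4" using assms distinct_card[OF xs(2)] by simp
  then obtain a b c d where "xs = [a, b, c, d]" by (auto simp: numeral_eq_Suc length_Suc_conv)
  then show ?thesis using that[of a b c d] xs by auto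
qed

locale right_angled_polyhedron =
  fixes P :: "minkowski set" and x0 :: minkowski
  assumes ex_normals: "\<exists>N. finite N \<and> (\<forall>n\<in>N. unit_normal n) \<and> P = H3 \<inter> (\<Inter>n\<in>N. half_space n)"
    and x0_P: "x0 \<in> P"
    and x0_strict: "\<And>n. unit_normal n \<Longrightarrow> P \<subseteq> half_space n \<Longrightarrow> lorentz x0 n < 0"
    and right: "right_angled P"
    and two_faces: "card (faces P) \<ge> 2"
begin

section \<open>Faces and their normals\<close>

abbreviation \<Phi> where "\<Phi> \<equiv> face_normals P"

lemma P_H3: "P \<subseteq> H3"
  using ex_normals by auto

lemma x0_H3: "x0 \<in> H3"
  using x0_P P_H3 by blast

lemma face_normal:
  assumes "n \<in> \<Phi>"
  shows "lorentz n n = 1" "n \<noteq> 0" "P \<subseteq> half_space n" "lorentz x0 n < 0"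
    "\<And>x. x \<in> P \<Longrightarrow> lorentz x n \<le> 0"
  using assms x0_strict
  by (auto simp: face_normals_def supporting_normal_def unit_normal_def half_space_def)

lemma subspace_orthogonal_eq_span_face:
  assumes "n \<in> \<Phi>"
  shows "span (hplane n \<inter> P) = {v. lorentz v n = 0}"
proof -
  have "dim (hplane n \<inter> P) = 3" using assms by (simp add: face_normals_def hdim_def)
  then have "dim (span (hplane n \<inter> P)) = 3" by (simp only: dim_span)
  moreover have "span (hplane n \<inter> P) \<subseteq> {v. lorentz v n = 0}"
    by (intro span_minimal subspace_lorentz) (auto simp: hplane_def)
  ultimately show ?thesis
    using dim_lorentz_orthogonal[OF face_normal(2)[OF assms]]
    by (intro subspace_dim_equal subspace_span subspace_lorentz) auto
qed

text \<open>A face spans the hyperplane of its normal, so \<open>n\<close> is a multiple of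
  \<open>m\<close>. Both are unit vectors with negative product with \<open>x0\<close>, which leaves
  only the factor 1.\<close>

lemma face_normal_unique:
  assumes "m \<in> \<Phi>" "n \<in> \<Phi>" "\<And>x. x \<in> hplane m \<inter> P \<Longrightarrow> lorentz x n = 0"
  shows "m = n"
proof -
  have "span (hplane m \<inter> P) \<subseteq> {v. lorentz v n = 0}"
    using assms(3) by (intro span_minimal subspace_lorentz) auto
  then have sub: "{v. lorentz v m = 0} \<subseteq> {v. lorentz v n = 0}"
    by (simp add: subspace_orthogonal_eq_span_face[OF assms(1)])
  note mm = face_normal(1)[OF assms(1)] and nn = face_normal(1)[OF assms(2)]
  define c where "c = lorentz m n"
  have "lorentz w (n - c *\<^sub>R m) = 0" for w
  proof -
    have "w - lorentz w m *\<^sub>R m \<in> {v. lorentz v m = 0}" using mm by simp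
    then have "lorentz (w - lorentz w m *\<^sub>R m) n = 0" using sub by blast
    then show ?thesis by (simp add: c_def)
  qed
  then have n: "n = c *\<^sub>R m" using lorentz_nondegenerate[of "n - c *\<^sub>R m"] by simp
  then have "c * c = 1" using mm nn by simp
  moreover have "c > 0"
    using n face_normal(4)[OF assms(1)] face_normal(4)[OF assms(2)] by (simp add: mult_less_0_iff)
  ultimately have "c = 1" by (metis abs_of_pos abs_square_eq_1 power2_eq_square)
  then show ?thesis using n by simp
qed

lemma faces_eq: "faces P = (\<lambda>n. hplane n \<inter> P) ` \<Phi>"
  by (auto simp: faces_def face_normals_def)

lemma inj_on_face: "inj_on (\<lambda>n. hplane n \<inter> P) \<Phi>"
proof (rule inj_onI)
  fix m n assume mn: "m \<in> \<Phi>" "n \<in> \<Phi>" "hplane m \<inter> P = hplane n \<inter> P"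
  show "m = n"
    by (rule face_normal_unique[OF mn(1,2)], unfold mn(3)) (simp add: hplane_def)
qed

lemma card_normals: "card \<Phi> = card (faces P)"
  by (simp add: faces_eq card_image inj_on_face)

text \<open>Infinite sets have \<open>card\<close> 0, so \<open>two_faces\<close> also carries
  finiteness.\<close>

lemma finite_normals: "finite \<Phi>"
  using card_normals two_faces by (metis card.infinite not_numeral_le_zero)

lemma P_eq: "P = {x \<in> H3. \<forall>n\<in>\<Phi>. lorentz x n \<le> 0}"
proof
  show "P \<subseteq> {x \<in> H3. \<forall>n\<in>\<Phi>. lorentz x n \<le> 0}" using face_normal(5) P_H3 by auto
  obtain N where N: "finite N" "\<And>n. n \<in> N \<Longrightarrow> unit_normal n" "P = H3 \<inter> (\<Inter>n\<in>N. half_space n)"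
    using ex_normals by blast
  have half: "P \<subseteq> half_space n" if "n \<in> N" for n using that unfolding N(3) by blast
  have PN: "P = {x \<in> H3 \<inter> UNIV. \<forall>n\<in>N. lorentz x n \<le> 0}"
    unfolding N(3) by (auto simp: half_space_def)
  have "\<exists>A\<subseteq>N. P = {x \<in> H3 \<inter> UNIV. \<forall>n\<in>A. lorentz x n \<le> 0} \<and>
      (\<forall>n\<in>A. {v \<in> UNIV. lorentz v n = 0} \<subseteq> span {x \<in> P. lorentz x n = 0} \<and> (\<exists>y\<in>P. lorentz y n = 0))"
    by (rule irredundant_description[OF N(1) subspace_UNIV _ _ PN, of x0])
      (simp_all add: x0_H3 x0_strict N(2) half)
  then obtain A where A: "A \<subseteq> N" "P = {x \<in> H3 \<inter> UNIV. \<forall>n\<in>A. lorentz x n \<le> 0}"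
    and span: "\<And>n. n \<in> A \<Longrightarrow> {v \<in> UNIV. lorentz v n = 0} \<subseteq> span {x \<in> P. lorentz x n = 0}"
    and ex: "\<And>n. n \<in> A \<Longrightarrow> \<exists>y\<in>P. lorentz y n = 0"
    by blast
  have "A \<subseteq> \<Phi>"
  proof
    fix n assume n: "n \<in> A"
    then have u: "unit_normal n" "P \<subseteq> half_space n" using A(1) N(2)[of n] half[of n] by blast+
    then have "n \<noteq> 0" by (auto simp: unit_normal_def)
    have eq: "{x \<in> P. lorentz x n = 0} = hplane n \<inter> P" using P_H3 by (auto simp: hplane_def)
    have "dim {v. lorentz v n = 0} \<le> dim (span (hplane n \<inter> P))"
      using span[OF n] unfolding eq by (intro dim_subset) simp
    then have "3 \<le> dim (hplane n \<inter> P)"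
      unfolding dim_span by (simp add: dim_lorentz_orthogonal[OF \<open>n \<noteq> 0\<close>])
    moreover have "dim (hplane n \<inter> P) \<le> dim {v. lorentz v n = 0}"
      by (rule dim_subset) (auto simp: hplane_def)
    ultimately have "dim (hplane n \<inter> P) = 3" using \<open>n \<noteq> 0\<close> by (simp add: dim_lorentz_orthogonal)
    moreover have "hplane n \<inter> P \<noteq> {}" using ex[OF n] unfolding eq[symmetric] by blast
    ultimately show "n \<in> \<Phi>" using u by (simp add: face_normals_def supporting_normal_def hdim_def)
  qed
  then show "{x \<in> H3. \<forall>n\<in>\<Phi>. lorentz x n \<le> 0} \<subseteq> P" unfolding A(2) by blast
qed

text \<open>Edges are cut out by supporting planes, so the common part of two faces has to be
  exhibited as such a section. The plane with normal proportional to \<open>m + n\<close> does this: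
  on \<open>P\<close> both products are nonpositive, so their sum vanishes only where both
  vanish.\<close>

lemma right_angle:
  assumes mn: "m \<in> \<Phi>" "n \<in> \<Phi>" "m \<noteq> n" and y: "y \<in> P" "lorentz y m = 0" "lorentz y n = 0"
    and span: "{v. lorentz v m = 0 \<and> lorentz v n = 0} \<subseteq> span (hplane m \<inter> hplane n \<inter> P)"
  shows "lorentz m n = 0"
proof -
  note m = face_normal(1)[OF mn(1)] and n = face_normal(1)[OF mn(2)]
  have fut: "future y" using y P_H3 by (auto intro: H3_future)
  have sum: "m + n \<noteq> 0"
    using face_normal(4)[OF mn(1)] face_normal(4)[OF mn(2)] lorentz_simps(2)[of x0 m n] by force
  have yo: "lorentz m y = 0" "lorentz n y = 0" using y by (simp_all add: lorentz_commute)
  have nm: "lorentz n m = lorentz m n" by (rule lorentz_commute)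
  have pos: "lorentz (m + n) (m + n) > 0"
    using timelike_orthogonal_spacelike[OF fut _ sum] yo by simp
  have "lorentz (m - n) (m - n) > 0"
    using timelike_orthogonal_spacelike[OF fut, of "m - n"] yo mn by simp
  then have lt: "\<bar>lorentz m n\<bar> < 1" using pos m n nm by simp
  define c where "c = 1 / sqrt (lorentz (m + n) (m + n))"
  define e where "e = c *\<^sub>R (m + n)"
  have c: "c > 0" using pos by (simp add: c_def)
  have "c * (c * lorentz (m + n) (m + n)) = 1"
    using pos unfolding c_def by (simp del: lorentz_simps flip: real_sqrt_mult)
  then have "unit_normal e" unfolding e_def unit_normal_def by (simp only: lorentz_simps(7,8))
  have le: "lorentz x e \<le> 0" if "x \<in> P" for x
  proof -
    have "lorentz x m + lorentz x n \<le> 0" using face_normal(5) that mn by (meson add_nonpos_nonpos)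
    then show ?thesis using c by (simp add: e_def mult_le_0_iff)
  qed
  have eq: "hplane e \<inter> P = hplane m \<inter> hplane n \<inter> P"
  proof
    show "hplane e \<inter> P \<subseteq> hplane m \<inter> hplane n \<inter> P"
    proof
      fix x assume x: "x \<in> hplane e \<inter> P"
      then have "lorentz x m + lorentz x n = 0" using c by (auto simp: hplane_def e_def)
      moreover have "lorentz x m \<le> 0" "lorentz x n \<le> 0" using face_normal(5) x mn by auto
      ultimately show "x \<in> hplane m \<inter> hplane n \<inter> P" using x by (simp add: hplane_def)
    qed
  qed (auto simp: hplane_def e_def)
  have sup: "supporting_normal P e"
    using \<open>unit_normal e\<close> le y P_H3 unfolding supporting_normal_def
    by (auto simp: half_space_def hplane_def e_def)
  have "dim (hplane e \<inter> P) = 2"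
  proof (rule antisym)
    have "dim (hplane e \<inter> P) \<le> dim {v. lorentz v m = 0 \<and> lorentz v n = 0}"
      unfolding eq by (rule dim_subset) (auto simp: hplane_def)
    then show "dim (hplane e \<inter> P) \<le> 2" by (simp add: dim_lorentz_orthogonal_pair[OF m n lt])
    have "dim {v. lorentz v m = 0 \<and> lorentz v n = 0} \<le> dim (span (hplane e \<inter> P))"
      unfolding eq by (rule dim_subset[OF span])
    then show "2 \<le> dim (hplane e \<inter> P)"
      by (simp only: dim_lorentz_orthogonal_pair[OF m n lt] dim_span)
  qed
  then have edge: "hplane e \<inter> P \<in> edges P"
    using sup unfolding edges_def by (intro CollectI exI[of _ e]) (simp add: hdim_def)
  have "m \<noteq> n \<and> hplane e \<inter> P \<subseteq> hplane m \<and> hplane e \<inter> P \<subseteq> hplane n"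
    unfolding eq using mn(3) by blast
  then have "dihedral_angle m n = pi / 2"
    using right[unfolded right_angled_def, THEN bspec, OF edge, THEN bspec, OF mn(1), THEN bspec, OF mn(2)]
    by (rule mp[rotated])
  then have "arccos (lorentz m n) = pi / 2" by (simp add: dihedral_angle_def)
  then show ?thesis using lt by (metis abs_less_iff cos_arccos cos_pi_half less_eq_real_def minus_less_iff)
qed

text \<open>Only the faces orthogonal to a given face bound it, so that the orthogonal projection to
  its plane maps the polyhedron into the face.\<close>

lemma plane_in_P:
  assumes m: "m \<in> \<Phi>" and x: "x \<in> H3" "lorentz x m = 0"
    and le: "\<And>j. j \<in> \<Phi> \<Longrightarrow> lorentz j m = 0 \<Longrightarrow> lorentz x j \<le> 0"
  shows "x \<in> P"
proof -
  let ?Z = "{v. lorentz v m = 0}"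
  let ?N = "\<Phi> - {m}"
  have "\<exists>z. z \<in> hplane m \<inter> P \<and> lorentz z j < 0" if "j \<in> ?N" for j
  proof (rule ccontr)
    assume *: "\<nexists>z. z \<in> hplane m \<inter> P \<and> lorentz z j < 0"
    have "m = j"
    proof (rule face_normal_unique[OF m])
      show "lorentz x j = 0" if "x \<in> hplane m \<inter> P" for x
        using * that face_normal(5)[of j x] \<open>j \<in> ?N\<close> by (meson DiffD1 IntD2 antisym not_less)
    qed (use that in auto)
    then show False using that by simp
  qed
  then obtain f where f: "\<And>j. j \<in> ?N \<Longrightarrow> f j \<in> hplane m \<inter> P" "\<And>j. j \<in> ?N \<Longrightarrow> lorentz (f j) j < 0"
    by metis
  have fin: "finite ?N" using finite_normals by simp
  have ne: "?N \<noteq> {}"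
    using two_faces card_normals finite_normals m
    by (metis card_1_singleton_iff insert_Diff insert_absorb2 numeral_le_one_iff semiring_norm(69)
        One_nat_def)
  \<comment> \<open>Each \<open>f j\<close> is a point of the face strictly inside the half-space of
    \<open>j\<close> and weakly inside the others, so the sum is strictly inside all of
    them.\<close>
  define z where "z = (\<Sum>j\<in>?N. f j)"
  have fP: "f j \<in> P" "f j \<in> H3" "lorentz (f j) m = 0" if "j \<in> ?N" for j
    using f(1)[OF that] by (auto simp: hplane_def)
  have "future z" unfolding z_def using fP by (intro future_sum fin ne H3_future)
  have "lorentz z m = 0" using fP by (simp add: z_def lorentz_sum_left)
  have z_strict: "lorentz z j < 0" if "j \<in> ?N" for j
  proof -
    have "lorentz z j = lorentz (f j) j + (\<Sum>i\<in>?N - {j}. lorentz (f i) j)"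
      unfolding z_def lorentz_sum_left by (rule sum.remove[OF fin that])
    moreover have "(\<Sum>i\<in>?N - {j}. lorentz (f i) j) \<le> 0"
      using fP(1) face_normal(5)[of j] that by (intro sum_nonpos) blast
    ultimately show ?thesis using f(2)[OF that] by simp
  qed
  obtain c where c: "c > 0" "c *\<^sub>R z \<in> H3" using future_normalize \<open>future z\<close> by blast
  have zc: "c *\<^sub>R z \<in> H3 \<inter> ?Z" using c \<open>lorentz z m = 0\<close> by simp
  have zs: "lorentz (c *\<^sub>R z) j < 0" if "j \<in> ?N" for j
    using z_strict[OF that] c by (simp add: mult_less_0_iff)
  define C where "C = {x \<in> H3 \<inter> ?Z. \<forall>n\<in>?N. lorentz x n \<le> 0}"
  \<comment> \<open>Inside the hyperplane of \<open>m\<close>, each constraint kept in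
    \<open>A\<close> meets the face in a set that spans the intersection of both hyperplanes. This
    is an edge, and its right angle makes the normal orthogonal to \<open>m\<close>.\<close>
  have "\<exists>A\<subseteq>?N. C = {x \<in> H3 \<inter> ?Z. \<forall>n\<in>A. lorentz x n \<le> 0} \<and>
      (\<forall>n\<in>A. {v \<in> ?Z. lorentz v n = 0} \<subseteq> span {x \<in> C. lorentz x n = 0} \<and> (\<exists>y\<in>C. lorentz y n = 0))"
    by (rule irredundant_description[OF fin subspace_lorentz zc zs C_def])
  then obtain A where A: "A \<subseteq> ?N" "C = {x \<in> H3 \<inter> ?Z. \<forall>n\<in>A. lorentz x n \<le> 0}"
    and span: "\<And>n. n \<in> A \<Longrightarrow> {v \<in> ?Z. lorentz v n = 0} \<subseteq> span {x \<in> C. lorentz x n = 0}"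
    and ex: "\<And>n. n \<in> A \<Longrightarrow> \<exists>y\<in>C. lorentz y n = 0"
    by blast
  have C: "C = hplane m \<inter> P"
    by (subst P_eq) (use m in \<open>auto simp: C_def hplane_def\<close>)
  have "lorentz j m = 0" if j: "j \<in> A" for j
  proof -
    obtain y where y: "y \<in> C" "lorentz y j = 0" using ex[OF j] by blast
    have "{x \<in> C. lorentz x j = 0} = hplane m \<inter> hplane j \<inter> P" by (auto simp: C hplane_def)
    then have "lorentz m j = 0"
      using A(1) j m y span[OF j]
      by (intro right_angle[of m j y]) (auto simp: C hplane_def)
    then show ?thesis by (simp add: lorentz_commute)
  qed
  then have "x \<in> C" unfolding A(2) using x le A(1) by blast
  then show ?thesis by (simp add: C)
qed

section \<open>Products of distinct normals\<close>

lemma future_in_cone: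
  assumes m: "m \<in> \<Phi>" and x: "future x" "lorentz x m = 0"
    and le: "\<And>j. j \<in> \<Phi> \<Longrightarrow> lorentz j m = 0 \<Longrightarrow> lorentz x j \<le> 0"
  obtains c where "c > 0" "c *\<^sub>R x \<in> P"
proof -
  obtain c where c: "c > 0" "c *\<^sub>R x \<in> H3" using future_normalize x(1) by blast
  have "c *\<^sub>R x \<in> P"
    using c x le by (intro plane_in_P[OF m]) (auto simp: mult_le_0_iff)
  then show ?thesis using c that by blast
qed

lemma future_shift:
  assumes "x \<in> H3" "lorentz (x + w) (x + w) < 0" "lorentz x w \<le> 0"
  shows "future (x + w)"
proof (rule futureI[OF H3_future[OF assms(1)] assms(2)])
  show "lorentz x (x + w) < 0" using assms by (simp add: H3_def)
qed

text \<open>Project a point \<open>x\<close> of the face of \<open>n\<close> orthogonally to the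
  plane of \<open>m\<close>. This can only lower the constraints that matter there, those orthogonal
  to \<open>m\<close>: it leaves them unchanged. So the image lies in the cone over
  \<open>P\<close>, and its product with \<open>n\<close>, which is nonpositive, is a positive
  multiple of \<open>lorentz m n\<close>.\<close>

lemma normals_nonpos:
  assumes mn: "m \<in> \<Phi>" "n \<in> \<Phi>" "m \<noteq> n"
  shows "lorentz m n \<le> 0"
proof -
  have "\<exists>x. x \<in> hplane n \<inter> P \<and> lorentz x m < 0"
    using face_normal_unique[OF mn(2,1)] mn(3) face_normal(5)[OF mn(1)]
    by (metis IntD2 less_eq_real_def)
  then obtain x where x: "x \<in> P" "x \<in> H3" "lorentz x n = 0" "lorentz x m < 0"
    by (auto simp: hplane_def)
  note mm = face_normal(1)[OF mn(1)]
  have mx: "lorentz m x = lorentz x m" by (rule lorentz_commute)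
  define y where "y = x + (- lorentz x m) *\<^sub>R m"
  have "lorentz y y = -1 - (lorentz x m)\<^sup>2"
    using x(2) mm mx by (simp add: y_def H3_def power2_eq_square algebra_simps)
  then have "lorentz y y < 0" using zero_le_power2[of "lorentz x m"] by linarith
  then have fut: "future y"
    unfolding y_def using x by (intro future_shift) (auto simp: mult_le_0_iff)
  have "lorentz y m = 0" by (simp add: y_def mm)
  moreover have "lorentz y j \<le> 0" if "j \<in> \<Phi>" "lorentz j m = 0" for j
    using face_normal(5)[OF that(1) x(1)] that(2) lorentz_commute[of m j] by (simp add: y_def)
  ultimately obtain c where c: "c > 0" "c *\<^sub>R y \<in> P" using future_in_cone[OF mn(1) fut] by blast
  then have "lorentz y n \<le> 0" using face_normal(5)[OF mn(2) c(2)] by (simp add: mult_le_0_iff)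
  then show ?thesis using x by (simp add: y_def zero_le_mult_iff mult_le_0_iff)
qed

text \<open>With a product strictly between -1 and 0 the two planes would cross. On the face of
  \<open>n\<close>, \<open>L\<close> is the orthogonal projection to their intersection, and it maps
  the face into the cone over \<open>P\<close>: the multiple of \<open>n\<close> that it adds is
  nonnegative, and \<open>n\<close> has nonpositive product with the other normals. So the faces
  share an edge, whose right angle makes the product 0.\<close>

lemma normals_orthogonal_or_disjoint:
  assumes mn: "m \<in> \<Phi>" "n \<in> \<Phi>" "m \<noteq> n"
  shows "lorentz m n = 0 \<or> lorentz m n \<le> -1"
proof (rule ccontr)
  define a where "a = lorentz m n"
  assume "\<not> ?thesis"
  then have a: "-1 < a" "a < 0" using normals_nonpos[OF mn] by (auto simp: a_def)
  then have a2: "1 - a * a > 0" by (simp add: abs_square_less_1 flip: power2_eq_square)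
  note mm = face_normal(1)[OF mn(1)] and nn = face_normal(1)[OF mn(2)]
  have nm: "lorentz n m = a" "lorentz m n = a" by (simp_all add: a_def lorentz_commute)
  \<comment> \<open>The coefficient solves \<open>lorentz (L x) m = 0\<close>; the one of
    \<open>n\<close> in \<open>L\<close> then keeps \<open>lorentz x n = 0\<close> intact.\<close>
  define \<alpha> where "\<alpha> x = - lorentz x m / (1 - a * a)" for x
  define L where "L x = x + \<alpha> x *\<^sub>R m + (- a * \<alpha> x) *\<^sub>R n" for x
  have Lm: "lorentz (L x) m = 0" for x
  proof -
    have "\<alpha> x * (1 - a * a) = - lorentz x m" using a2 by (simp add: \<alpha>_def)
    then show ?thesis by (simp add: L_def mm nm algebra_simps)
  qed
  have Ln: "lorentz (L x) n = 0" if "lorentz x n = 0" for x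
    using that by (simp add: L_def nn nm)
  have cone: "\<exists>c>0. c *\<^sub>R L x \<in> P" if x: "x \<in> hplane n \<inter> P" for x
  proof -
    have x': "x \<in> H3" "lorentz x n = 0" "lorentz x m \<le> 0"
      using x face_normal(5)[OF mn(1)] by (auto simp: hplane_def)
    have al: "\<alpha> x \<ge> 0" using x' a2 by (simp add: \<alpha>_def divide_nonpos_pos)
    have "lorentz (L x) (L x) = lorentz (L x) x"
      using Lm[of x] Ln[OF x'(2)] by (subst (2) L_def) simp
    also have "\<dots> = -1 + \<alpha> x * lorentz x m"
      using x' by (simp add: L_def H3_def lorentz_commute[of m] lorentz_commute[of n])
    also have "\<dots> < 0" using al x' by (smt (verit) mult_nonneg_nonpos)
    finally have "lorentz (L x) (L x) < 0" .
    moreover have "lorentz x (\<alpha> x *\<^sub>R m + (- a * \<alpha> x) *\<^sub>R n) \<le> 0"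
      using al x' by (simp add: mult_le_0_iff)
    ultimately have fut: "future (L x)"
      using x'(1) future_shift[of x "\<alpha> x *\<^sub>R m + (- a * \<alpha> x) *\<^sub>R n"] by (simp only: L_def add.assoc)
    have "lorentz (L x) j \<le> 0" if j: "j \<in> \<Phi>" "lorentz j m = 0" for j
    proof -
      have "j \<noteq> n" using j a nm by auto
      then have "lorentz n j \<le> 0" using normals_nonpos[OF mn(2) j(1)] by blast
      moreover have "lorentz x j \<le> 0" using face_normal(5)[OF j(1)] x by blast
      moreover have "- a * \<alpha> x \<ge> 0" using a al by (simp add: mult_le_0_iff)
      ultimately have "lorentz x j + (- a * \<alpha> x) * lorentz n j \<le> 0"
        by (meson add_nonpos_nonpos mult_nonneg_nonpos)
      then show ?thesis using j by (simp add: L_def lorentz_commute[of m j])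
    qed
    then show ?thesis using future_in_cone[OF mn(1) fut Lm] by blast
  qed
  have "\<alpha> (x + y) = \<alpha> x + \<alpha> y" "\<alpha> (c *\<^sub>R x) = c * \<alpha> x" for x y c
    by (simp_all add: \<alpha>_def diff_divide_distrib)
  then have lin: "linear L"
    unfolding L_def by (intro linearI) (simp_all add: algebra_simps)
  have "hplane n \<inter> P \<noteq> {}"
    using mn(2) by (simp add: face_normals_def supporting_normal_def)
  then obtain x c where x: "x \<in> hplane n \<inter> P" "c *\<^sub>R L x \<in> P" using cone by blast
  have "lorentz m n = 0"
  proof (rule right_angle[OF mn x(2)])
    show "lorentz (c *\<^sub>R L x) m = 0" by (simp add: Lm)
    show "lorentz (c *\<^sub>R L x) n = 0" using x(1) by (simp add: Ln hplane_def)
    show "{v. lorentz v m = 0 \<and> lorentz v n = 0} \<subseteq> span (hplane m \<inter> hplane n \<inter> P)"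
    proof
      fix v assume v: "v \<in> {v. lorentz v m = 0 \<and> lorentz v n = 0}"
      then have "L v = v" by (simp add: L_def \<alpha>_def)
      moreover have "v \<in> span (hplane n \<inter> P)"
        using v by (simp add: subspace_orthogonal_eq_span_face[OF mn(2)])
      ultimately have "v \<in> span (L ` (hplane n \<inter> P))"
        by (metis image_eqI linear_span_image lin)
      moreover have "L ` (hplane n \<inter> P) \<subseteq> span (hplane m \<inter> hplane n \<inter> P)"
      proof
        fix w assume "w \<in> L ` (hplane n \<inter> P)"
        then obtain x c where w: "w = L x" "x \<in> hplane n \<inter> P" "c > 0" "c *\<^sub>R L x \<in> P"
          using cone by blast
        then have "c *\<^sub>R w \<in> hplane m \<inter> hplane n \<inter> P"
          using Lm[of x] Ln[of x] P_H3 by (auto simp: hplane_def)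
        then have "(1 / c) *\<^sub>R (c *\<^sub>R w) \<in> span (hplane m \<inter> hplane n \<inter> P)"
          by (intro span_scale span_base)
        then show "w \<in> span (hplane m \<inter> hplane n \<inter> P)" using w by simp
      qed
      ultimately show "v \<in> span (hplane m \<inter> hplane n \<inter> P)"
        by (meson span_minimal subspace_span subsetD)
    qed
  qed
  then show False using a by (simp add: a_def)
qed

lemma no_orthogonal_quadruple:
  assumes "a \<in> \<Phi>" "b \<in> \<Phi>" "c \<in> \<Phi>" "d \<in> \<Phi>"
    and "lorentz a b = 0" "lorentz a c = 0" "lorentz a d = 0" "lorentz b c = 0" "lorentz b d = 0"
      "lorentz c d = 0"
  shows False
proof -
  have "lorentz d d < 0"
    using assms face_normal by (intro timelike_if_orthogonal_triple[of a b c]) (auto simp: lorentz_commute)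
  then show False using face_normal(1)[OF assms(4)] by simp
qed

section \<open>The orthogonality graph of the normals\<close>

definition nb :: "minkowski \<Rightarrow> minkowski \<Rightarrow> bool" where
  "nb m n \<longleftrightarrow> m \<in> \<Phi> \<and> n \<in> \<Phi> \<and> lorentz m n = 0"

lemma nb_sym: "nb m n \<Longrightarrow> nb n m"
  by (simp add: nb_def lorentz_commute)

lemma nb_irrefl: "\<not> nb n n"
  using face_normal(1) by (auto simp: nb_def)

lemma card_clique_le:
  assumes "c \<in> {c. c \<subseteq> \<Phi> \<and> (\<forall>m\<in>c. \<forall>n\<in>c. m \<noteq> n \<longrightarrow> nb m n)}"
  shows "card c \<le> 3"
proof (rule ccontr)
  assume "\<not> card c \<le> 3"
  then have "4 \<le> card c" by simp
  then obtain q where q: "q \<subseteq> c" "card q = 4" by (rule obtain_subset_with_card_n)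
  obtain a b d e where abde: "q = {a, b, d, e}" "distinct [a, b, d, e]"
    using card_4E[OF q(2)] by metis
  have "nb m n" if "m \<in> q" "n \<in> q" "m \<noteq> n" for m n using that q(1) assms by blast
  then have "nb a b" "nb a d" "nb a e" "nb b d" "nb b e" "nb d e"
    using abde by (simp_all del: prod.inject)
  then show False using no_orthogonal_quadruple[of a b d e] by (simp add: nb_def)
qed

text \<open>No two of \<open>u\<close>, \<open>v\<close>, \<open>w\<close> are orthogonal, as they
  would form an orthogonal quadruple with \<open>i\<close> and \<open>j\<close>; so their products
  are at most -1. The combination \<open>y\<close> of \<open>v\<close> and \<open>w\<close>
  orthogonal to \<open>u\<close> is orthogonal to the triple \<open>i\<close>, \<open>j\<close>,
  \<open>u\<close> and hence timelike, but the signs of the products make its square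
  positive.\<close>

lemma common_neighbours_orthogonal:
  assumes ij: "i \<in> \<Phi>" "j \<in> \<Phi>" "lorentz i j = 0"
    and uvw: "u \<in> \<Phi>" "v \<in> \<Phi>" "w \<in> \<Phi>" "u \<noteq> v" "u \<noteq> w" "v \<noteq> w"
    and o: "\<And>s. s \<in> {u, v, w} \<Longrightarrow> lorentz s i = 0 \<and> lorentz s j = 0"
  shows False
proof -
  have F: "s \<in> \<Phi>" if "s \<in> {u, v, w}" for s using that uvw by blast
  have o': "lorentz i s = 0" "lorentz j s = 0" if "s \<in> {u, v, w}" for s
    using o[OF that] by (simp_all only: lorentz_commute[of i] lorentz_commute[of j])
  have quad: "lorentz s t \<noteq> 0" if "s \<in> {u, v, w}" "t \<in> {u, v, w}" for s t
    using no_orthogonal_quadruple[OF ij(1,2) F[OF that(1)] F[OF that(2)] ij(3)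
        o'(1)[OF that(1)] o'(1)[OF that(2)] o'(2)[OF that(1)] o'(2)[OF that(2)]] by blast
  define p q s where "p = lorentz u v" and "q = lorentz u w" and "s = lorentz v w"
  have sym: "lorentz v u = p" "lorentz w u = q" "lorentz w v = s"
    unfolding p_def q_def s_def by (rule lorentz_commute)+
  have le: "p \<le> -1" "q \<le> -1" "s \<le> -1"
    using normals_orthogonal_or_disjoint[of u v] normals_orthogonal_or_disjoint[of u w]
      normals_orthogonal_or_disjoint[of v w] quad[of u v] quad[of u w] quad[of v w] uvw
    by (auto simp: p_def q_def s_def)
  define y where "y = q *\<^sub>R v - p *\<^sub>R w"
  have "lorentz y y = q * q + p * p - 2 * (p * q * s)"
    using face_normal(1) uvw by (simp add: y_def sym s_def[symmetric] algebra_simps)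
  moreover have "p * q \<ge> 0" using le by (simp add: zero_le_mult_iff)
  then have "p * q * s \<le> 0" using le by (simp add: mult_nonneg_nonpos)
  moreover have "q * q > 0" using le by (simp add: zero_less_mult_iff)
  ultimately have yy: "lorentz y y > 0" by (smt (verit) zero_le_square)
  have "lorentz y y < 0"
  proof (rule timelike_if_orthogonal_triple[of i j u])
    show "lorentz y u = 0" by (simp add: y_def sym)
    show "y \<noteq> 0" using yy by auto
    show "lorentz y i = 0" "lorentz y j = 0" using o by (simp_all add: y_def)
  qed (simp_all add: ij uvw face_normal(1) o')
  then show False using yy by simp
qed

text \<open>As \<open>i + j\<close> is not spacelike, nothing orthogonal to \<open>i\<close> and
  \<open>j\<close> with negative product with \<open>x0\<close> is timelike. For sums of
  \<open>u\<close>, \<open>v\<close>, \<open>w\<close> this bounds the products below, so at most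
  one of them is -1 and the others are 0. If all are 0, an orthogonal quadruple with
  \<open>i\<close> arises. If \<open>lorentz a b = -1\<close>, then \<open>a + b\<close> is a null
  vector orthogonal to the triple \<open>i\<close>, \<open>a\<close>, \<open>c\<close>, whose
  complement is timelike.\<close>

lemma common_neighbours_disjoint:
  assumes ij: "i \<in> \<Phi>" "j \<in> \<Phi>" "lorentz i j \<le> -1"
    and uvw: "u \<in> \<Phi>" "v \<in> \<Phi>" "w \<in> \<Phi>" "u \<noteq> v" "u \<noteq> w" "v \<noteq> w"
    and o: "\<And>s. s \<in> {u, v, w} \<Longrightarrow> lorentz s i = 0 \<and> lorentz s j = 0"
  shows False
proof -
  have o': "lorentz i s = 0" if "s \<in> {u, v, w}" for s
    using o[OF that] by (simp only: lorentz_commute[of i])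
  have ji: "lorentz j i = lorentz i j" by (rule lorentz_commute)
  have K: "lorentz b b \<ge> 0" if b: "lorentz b i = 0" "lorentz b j = 0" "lorentz x0 b < 0" for b
  proof (rule ccontr)
    assume "\<not> lorentz b b \<ge> 0"
    then have "future b" using futureI[OF H3_future[OF x0_H3]] b by simp
    moreover have "lorentz (i + j) b = 0" using b lorentz_commute[of i b] lorentz_commute[of j b] by simp
    moreover have "i + j \<noteq> 0"
      using face_normal(4)[OF ij(1)] face_normal(4)[OF ij(2)] lorentz_simps(2)[of x0 i j] by force
    ultimately have "lorentz (i + j) (i + j) > 0" by (rule timelike_orthogonal_spacelike)
    then show False using ij face_normal(1) ji by simp
  qed
  define p q s where "p = lorentz u v" and "q = lorentz u w" and "s = lorentz v w"
  have sym: "lorentz v u = p" "lorentz w u = q" "lorentz w v = s"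
    unfolding p_def q_def s_def by (rule lorentz_commute)+
  note sims = sym p_def[symmetric] q_def[symmetric] s_def[symmetric]
  have n: "lorentz u u = 1" "lorentz v v = 1" "lorentz w w = 1" using face_normal(1) uvw by auto
  have neg: "lorentz x0 u < 0" "lorentz x0 v < 0" "lorentz x0 w < 0" using face_normal(4) uvw by auto
  have "0 \<le> lorentz (u + v) (u + v)" "0 \<le> lorentz (u + w) (u + w)" "0 \<le> lorentz (v + w) (v + w)"
    "0 \<le> lorentz (u + v + w) (u + v + w)"
    using o neg by (intro K; simp)+
  then have ge: "p \<ge> -1" "q \<ge> -1" "s \<ge> -1" "p + q + s \<ge> - 3 / 2"
    by (simp_all add: n sims)
  have "p = 0 \<or> p \<le> -1" "q = 0 \<or> q \<le> -1" "s = 0 \<or> s \<le> -1"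
    using normals_orthogonal_or_disjoint uvw by (auto simp: p_def q_def s_def)
  then have "p = 0 \<and> q = 0 \<and> s = 0 \<or> p = -1 \<and> q = 0 \<and> s = 0
      \<or> p = 0 \<and> q = -1 \<and> s = 0 \<or> p = 0 \<and> q = 0 \<and> s = -1" using ge by argo
  moreover have one: False if "a \<in> {u, v, w}" "b \<in> {u, v, w}" "c \<in> {u, v, w}"
    "lorentz a b = -1" "lorentz a c = 0" "lorentz b c = 0" for a b c
  proof -
    have F: "a \<in> \<Phi>" "b \<in> \<Phi>" "c \<in> \<Phi>" using that uvw by auto
    have sab: "lorentz b a = -1" using that lorentz_commute[of a b] by simp
    have "a + b \<noteq> 0"
      using face_normal(4)[OF F(1)] face_normal(4)[OF F(2)] lorentz_simps(2)[of x0 a b] by force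
    then have "lorentz (a + b) (a + b) < 0"
      by (intro timelike_if_orthogonal_triple[of i a c])
        (simp_all add: F face_normal(1) that(4-6) sab ij o[OF that(1)] o[OF that(2)]
          o'[OF that(1)] o'[OF that(3)])
    then show False using F face_normal(1) that sab by simp
  qed
  moreover have "\<not> (p = 0 \<and> q = 0 \<and> s = 0)"
    using no_orthogonal_quadruple[OF ij(1) uvw(1-3) o' o' o'] unfolding p_def q_def s_def by blast
  ultimately show False
    using one[of u v w] one[of u w v] one[of v w u] by (auto simp: sims)
qed

lemma card_common_neighbours:
  assumes ij: "i \<in> \<Phi>" "j \<in> \<Phi>" "i \<noteq> j"
  shows "card {s \<in> \<Phi>. nb s i \<and> nb s j} \<le> 2"
proof (rule ccontr)
  let ?A = "{s \<in> \<Phi>. nb s i \<and> nb s j}"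
  assume "\<not> card ?A \<le> 2"
  then have "3 \<le> card ?A" by simp
  then obtain q where q: "q \<subseteq> ?A" "card q = 3" by (rule obtain_subset_with_card_n)
  then obtain u v w where uvw: "q = {u, v, w}" "u \<noteq> v" "u \<noteq> w" "v \<noteq> w"
    unfolding card_3_iff by blast
  have F: "u \<in> \<Phi>" "v \<in> \<Phi>" "w \<in> \<Phi>" using q(1) uvw(1) by blast+
  have o: "lorentz s i = 0 \<and> lorentz s j = 0" if "s \<in> {u, v, w}" for s
    using q(1) that unfolding uvw(1) nb_def by blast
  show False
    using normals_orthogonal_or_disjoint[OF ij]
      common_neighbours_orthogonal[OF ij(1,2) _ F uvw(2-4) o]
      common_neighbours_disjoint[OF ij(1,2) _ F uvw(2-4) o] by blast
qed

end

section \<open>The reflection group as a Coxeter group\<close>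

text \<open>The linear reflection of the whole space. Its restriction \<open>hreflection\<close> is
  extensional, as elements of a bijection group are.\<close>

definition reflect :: "minkowski \<Rightarrow> minkowski \<Rightarrow> minkowski" where
  "reflect n x = x - (2 * lorentz x n) *\<^sub>R n"

lemma lorentz_reflect_left: "lorentz (reflect n x) u = lorentz x u - 2 * lorentz x n * lorentz n u"
  by (simp add: reflect_def)

lemma reflect_isometry: "lorentz n n = 1 \<Longrightarrow> lorentz (reflect n x) (reflect n y) = lorentz x y"
  by (simp add: reflect_def lorentz_commute[of n y] algebra_simps)

lemma reflect_refl: "lorentz n n = 1 \<Longrightarrow> reflect n (reflect n x) = x"
  by (simp add: reflect_def algebra_simps)

lemma reflect_commute: "lorentz m n = 0 \<Longrightarrow> reflect m (reflect n x) = reflect n (reflect m x)"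
  by (simp add: reflect_def lorentz_commute[of n m] algebra_simps)

lemma reflect_H3:
  assumes n: "lorentz n n = 1" and x: "x \<in> H3"
  shows "reflect n x \<in> H3"
proof -
  have eq: "lorentz (reflect n x) (reflect n x) = -1" using reflect_isometry[OF n] x by (simp add: H3_def)
  have "lorentz x (reflect n x) = -1 - 2 * (lorentz x n)\<^sup>2"
    using x by (simp add: reflect_def H3_def power2_eq_square)
  then have "lorentz x (reflect n x) < 0" using zero_le_power2[of "lorentz x n"] by linarith
  then have "future (reflect n x)" using futureI[OF H3_future[OF x]] eq by simp
  then show ?thesis using eq by (simp add: H3_def future_def)
qed

lemma hreflection_eq: "hreflection n = restrict (reflect n) H3"
  by (auto simp: hreflection_def reflect_def)

lemma hreflection_Bij: "lorentz n n = 1 \<Longrightarrow> hreflection n \<in> Bij H3"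
  unfolding Bij_def hreflection_eq
  by (auto intro!: bij_betwI[where g = "reflect n"] simp: reflect_H3 reflect_refl)

lemma group_Isom_H3: "group Isom_H3"
proof -
  let ?K = "{f \<in> Bij H3. \<forall>x\<in>H3. \<forall>y\<in>H3. hdist (f x) (f y) = hdist x y}"
  interpret B: group "BijGroup H3" by (rule group_BijGroup)
  have Bij: "f \<in> Bij H3 \<longleftrightarrow> f \<in> carrier (BijGroup H3)" for f by (simp add: BijGroup_def)
  have map: "f x \<in> H3" if "f \<in> Bij H3" "x \<in> H3" for f x
    using that by (auto simp: Bij_def bij_betw_def)
  have "subgroup ?K (BijGroup H3)"
  proof (rule B.subgroupI)
    show "?K \<subseteq> carrier (BijGroup H3)" by (auto simp: BijGroup_def)
    show "?K \<noteq> {}" using id_Bij[of H3] by (auto intro!: exI[of _ "\<lambda>x\<in>H3. x"])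
    fix f assume f: "f \<in> ?K"
    have inv: "inv\<^bsub>BijGroup H3\<^esub> f = (\<lambda>x\<in>H3. inv_into H3 f x)" using f inv_BijGroup by auto
    have fB: "f ` H3 = H3" using f by (auto simp: Bij_def bij_betw_def)
    have "hdist (inv_into H3 f x) (inv_into H3 f y) = hdist x y" if "x \<in> H3" "y \<in> H3" for x y
    proof -
      have xy: "x \<in> f ` H3" "y \<in> f ` H3" using that fB by auto
      then have "hdist (f (inv_into H3 f x)) (f (inv_into H3 f y)) = hdist (inv_into H3 f x) (inv_into H3 f y)"
        using f by (simp add: inv_into_into)
      then show ?thesis using xy by (simp add: f_inv_into_f)
    qed
    moreover have "inv\<^bsub>BijGroup H3\<^esub> f \<in> Bij H3" using f Bij B.inv_closed by auto
    ultimately show "inv\<^bsub>BijGroup H3\<^esub> f \<in> ?K" unfolding inv by simp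
  next
    fix f g assume fg: "f \<in> ?K" "g \<in> ?K"
    then have "f \<otimes>\<^bsub>BijGroup H3\<^esub> g = compose H3 f g" by (simp add: BijGroup_def)
    then show "f \<otimes>\<^bsub>BijGroup H3\<^esub> g \<in> ?K" using fg by (auto simp: compose_Bij compose_eq map)
  qed
  then show ?thesis unfolding Isom_H3_def by (rule B.subgroup_imp_group)
qed

context right_angled_polyhedron
begin

section \<open>The group generated by the face reflections\<close>

abbreviation (input) G where "G \<equiv> reflection_group P"

lemma hreflection_Isom: "n \<in> \<Phi> \<Longrightarrow> hreflection n \<in> carrier Isom_H3"
  using hreflection_Bij[of n] face_normal(1)[of n] reflect_isometry[of n]
  by (auto simp: Isom_H3_def hreflection_eq hdist_def)

lemma face_reflections_Isom: "face_reflections P \<subseteq> carrier Isom_H3"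
  using hreflection_Isom by (auto simp: face_reflections_def)

sublocale G: group G
  unfolding reflection_group_def by (rule group.group_subgroup_generated[OF group_Isom_H3])

lemma carrier_G: "carrier G = generate Isom_H3 (face_reflections P)"
  using face_reflections_Isom
  by (simp add: reflection_group_def carrier_subgroup_generated Int_absorb1)

lemma carrier_G_Bij: "carrier G \<subseteq> Bij H3"
proof -
  have "carrier G \<subseteq> carrier Isom_H3"
    unfolding carrier_G by (rule group.generate_incl[OF group_Isom_H3 face_reflections_Isom])
  also have "\<dots> \<subseteq> Bij H3" unfolding Isom_H3_def by auto
  finally show ?thesis .
qed

lemma mult_G:
  assumes "f \<in> carrier G" "g \<in> carrier G"
  shows "f \<otimes>\<^bsub>G\<^esub> g = compose H3 f g"
proof -
  have "f \<in> Bij H3" "g \<in> Bij H3" using assms by (simp_all add: subsetD[OF carrier_G_Bij])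
  moreover have "f \<otimes>\<^bsub>G\<^esub> g = f \<otimes>\<^bsub>BijGroup H3\<^esub> g"
    by (simp add: reflection_group_def Isom_H3_def)
  ultimately show ?thesis by (simp add: BijGroup_def)
qed

lemma one_G: "\<one>\<^bsub>G\<^esub> = (\<lambda>x\<in>H3. x)"
  by (simp add: reflection_group_def Isom_H3_def BijGroup_def)

lemma hreflection_G: "n \<in> \<Phi> \<Longrightarrow> hreflection n \<in> carrier G"
  unfolding carrier_G by (auto simp: face_reflections_def intro: generate.incl)

lemma hreflection_mult:
  assumes "m \<in> \<Phi>" "n \<in> \<Phi>"
  shows "hreflection m \<otimes>\<^bsub>G\<^esub> hreflection n = (\<lambda>x\<in>H3. reflect m (reflect n x))"
proof -
  have "hreflection m \<otimes>\<^bsub>G\<^esub> hreflection n = compose H3 (hreflection m) (hreflection n)"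
    by (intro mult_G hreflection_G assms)
  then show ?thesis
    unfolding compose_def hreflection_eq
    using reflect_H3[OF face_normal(1)[OF assms(2)]] by (simp cong: restrict_cong)
qed

lemma hreflection_square: "n \<in> \<Phi> \<Longrightarrow> hreflection n \<otimes>\<^bsub>G\<^esub> hreflection n = \<one>\<^bsub>G\<^esub>"
  by (simp add: hreflection_mult one_G reflect_refl face_normal(1))

lemma inv_hreflection: "n \<in> \<Phi> \<Longrightarrow> inv\<^bsub>G\<^esub> hreflection n = hreflection n"
  by (simp add: G.inv_equality hreflection_G hreflection_square)

lemma hreflection_commute:
  assumes "m \<in> \<Phi>" "n \<in> \<Phi>" "lorentz m n = 0"
  shows "hreflection m \<otimes>\<^bsub>G\<^esub> hreflection n = hreflection n \<otimes>\<^bsub>G\<^esub> hreflection m"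
  by (simp only: hreflection_mult[OF assms(1,2)] hreflection_mult[OF assms(2,1)] reflect_commute[OF assms(3)])

text \<open>The position of the chamber \<open>g\<close> relative to the walls of the fundamental chamber.\<close>

definition coord :: "(minkowski \<Rightarrow> minkowski) \<Rightarrow> minkowski \<Rightarrow> real" where
  "coord g n = lorentz ((inv\<^bsub>G\<^esub> g) x0) n"

lemma coord_one: "coord \<one>\<^bsub>G\<^esub> n = lorentz x0 n"
proof -
  have "inv\<^bsub>G\<^esub> \<one>\<^bsub>G\<^esub> = \<one>\<^bsub>G\<^esub>" by simp
  then show ?thesis unfolding coord_def by (simp only: one_G) (simp add: x0_H3)
qed

lemma coord_mult:
  assumes "g \<in> carrier G" "s \<in> \<Phi>"
  shows "coord (g \<otimes>\<^bsub>G\<^esub> hreflection s) n = coord g n - 2 * coord g s * lorentz s n"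
proof -
  have ig: "inv\<^bsub>G\<^esub> g \<in> carrier G" using assms by simp
  have "inv\<^bsub>G\<^esub> (g \<otimes>\<^bsub>G\<^esub> hreflection s) = hreflection s \<otimes>\<^bsub>G\<^esub> inv\<^bsub>G\<^esub> g"
    using assms by (simp add: G.inv_mult_group hreflection_G inv_hreflection)
  also have "\<dots> = compose H3 (hreflection s) (inv\<^bsub>G\<^esub> g)"
    using assms by (simp add: mult_G hreflection_G)
  finally have "(inv\<^bsub>G\<^esub> (g \<otimes>\<^bsub>G\<^esub> hreflection s)) x0 = hreflection s ((inv\<^bsub>G\<^esub> g) x0)"
    by (simp add: compose_eq x0_H3)
  moreover have "(inv\<^bsub>G\<^esub> g) x0 \<in> H3"
    using subsetD[OF carrier_G_Bij ig] x0_H3 by (auto simp: Bij_def bij_betw_def)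
  ultimately show ?thesis by (simp add: coord_def hreflection_eq lorentz_reflect_left)
qed

text \<open>The coordinate is positive when the wall labelled \<open>s\<close> of the chamber of
  \<open>g\<close> separates it from the fundamental chamber: the geometric form of a right
  descent.\<close>

definition D :: "(minkowski \<Rightarrow> minkowski) \<Rightarrow> minkowski set" where
  "D g = {s \<in> \<Phi>. coord g s > 0}"

text \<open>Galleries that cross every wall away from the fundamental chamber. Invariants can be
  proved along them before a length function is available.\<close>

inductive Up :: "nat \<Rightarrow> (minkowski \<Rightarrow> minkowski) \<Rightarrow> bool" where
  Up_one: "Up 0 \<one>\<^bsub>G\<^esub>"
| Up_mult: "Up n g \<Longrightarrow> s \<in> \<Phi> \<Longrightarrow> coord g s < 0 \<Longrightarrow> Up (Suc n) (g \<otimes>\<^bsub>G\<^esub> hreflection s)"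

lemma Up_carrier: "Up n g \<Longrightarrow> g \<in> carrier G"
  by (induction rule: Up.induct) (auto simp: hreflection_G)

text \<open>The second clause says that two non-orthogonal walls cannot both be descents, in a
  quantitative form that survives a step up.\<close>

lemma Up_invariant:
  "Up n g \<Longrightarrow> (\<forall>u\<in>\<Phi>. coord g u \<noteq> 0) \<and>
    (\<forall>s\<in>\<Phi>. \<forall>t\<in>\<Phi>. s \<noteq> t \<longrightarrow> lorentz s t \<noteq> 0 \<longrightarrow> coord g t > 0 \<longrightarrow> coord g s + coord g t < 0)"
proof (induction rule: Up.induct)
  case Up_one
  have "coord \<one>\<^bsub>G\<^esub> u < 0" if "u \<in> \<Phi>" for u using face_normal(4)[OF that] by (simp add: coord_one)
  then show ?case by (metis less_asym less_irrefl)
next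
  case (Up_mult n g s)
  let ?h = "g \<otimes>\<^bsub>G\<^esub> hreflection s"
  define y where "y u = coord g u" for u
  define y' where "y' u = coord ?h u" for u
  have s: "s \<in> \<Phi>" "y s < 0" using Up_mult by (auto simp: y_def)
  have nz: "y u \<noteq> 0" if "u \<in> \<Phi>" for u using Up_mult that by (auto simp: y_def)
  have sep: "y u + y t < 0" if "u \<in> \<Phi>" "t \<in> \<Phi>" "u \<noteq> t" "lorentz u t \<noteq> 0" "y t > 0" for u t
    using Up_mult that by (auto simp: y_def)
  have y': "y' u = y u - 2 * y s * lorentz s u" for u
    unfolding y_def y'_def using Up_mult.hyps Up_carrier by (intro coord_mult)
  have y's: "y' s = - y s" using face_normal(1)[OF s(1)] by (simp add: y')
  have y'0: "y' u = y u" if "lorentz s u = 0" for u using that by (simp add: y')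
  \<comment> \<open>A product of at most -1 lowers the coordinate of \<open>u\<close> by at least
    \<open>- 2 * y s\<close>, while a positive \<open>y u\<close> is below \<open>- y s\<close> by
    the separation hypothesis.\<close>
  have far: "y' u < y s" if u: "u \<in> \<Phi>" "u \<noteq> s" "lorentz s u \<noteq> 0" for u
  proof -
    have c: "lorentz s u \<le> -1" using normals_orthogonal_or_disjoint[OF s(1) u(1)] u by auto
    have "y s * lorentz s u \<ge> y s * (-1)" using c s by (intro mult_left_mono_neg) auto
    then have le: "y' u \<le> y u + 2 * y s" by (simp add: y')
    show ?thesis
    proof (cases "y u > 0")
      case True
      then show ?thesis using sep[of s u] u s le by auto
    next
      case False
      then show ?thesis using nz[OF u(1)] s le by auto
    qed
  qed
  have "y' u \<noteq> 0" if "u \<in> \<Phi>" for u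
    using far[of u] y'0[of u] nz[OF that] s y's that by (cases "u = s"; cases "lorentz s u = 0") auto
  moreover have "y' u + y' t < 0"
    if ut: "u \<in> \<Phi>" "t \<in> \<Phi>" "u \<noteq> t" "lorentz u t \<noteq> 0" "y' t > 0" for u t
  proof (cases "t = s")
    case True
    then show ?thesis using far[of u] ut y's lorentz_commute[of u s] by auto
  next
    case False
    then have t0: "lorentz s t = 0" using far[of t] ut s by (auto intro: ccontr)
    then have t: "y' t = y t" by (rule y'0)
    have us: "u \<noteq> s" using ut t0 by auto
    have "y' u \<le> y u"
    proof (cases "lorentz s u = 0")
      case False
      then have "lorentz s u \<le> -1" using normals_orthogonal_or_disjoint[OF s(1) ut(1)] us by auto
      then have "y s * lorentz s u \<ge> 0" using s by (simp add: zero_le_mult_iff)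
      then show ?thesis by (simp add: y')
    qed (simp add: y'0)
    then show ?thesis using sep[OF ut(1-4)] ut(5) t by simp
  qed
  ultimately show ?case by (auto simp: y'_def)
qed

lemma D_orthogonal: "Up n g \<Longrightarrow> s \<in> D g \<Longrightarrow> t \<in> D g \<Longrightarrow> s \<noteq> t \<Longrightarrow> lorentz s t = 0"
  using Up_invariant[of n g] by (fastforce simp: D_def)

lemma D_mult:
  assumes g: "Up n g" and s: "s \<in> \<Phi>" "s \<notin> D g"
  shows "coord g s < 0" "D (g \<otimes>\<^bsub>G\<^esub> hreflection s) = insert s {t \<in> D g. lorentz s t = 0}"
proof -
  show neg: "coord g s < 0" using Up_invariant[OF g] s by (auto simp: D_def)
  note eq = coord_mult[OF Up_carrier[OF g] s(1)]
  have h: "Up (Suc n) (g \<otimes>\<^bsub>G\<^esub> hreflection s)" using g s(1) neg by (rule Up_mult)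
  have sD: "s \<in> D (g \<otimes>\<^bsub>G\<^esub> hreflection s)"
    using neg s face_normal(1)[OF s(1)] by (simp add: D_def eq)
  show "D (g \<otimes>\<^bsub>G\<^esub> hreflection s) = insert s {t \<in> D g. lorentz s t = 0}"
  proof (intro equalityI subsetI)
    fix t assume t: "t \<in> D (g \<otimes>\<^bsub>G\<^esub> hreflection s)"
    then show "t \<in> insert s {t \<in> D g. lorentz s t = 0}"
      using D_orthogonal[OF h sD t] by (cases "t = s") (auto simp: D_def eq)
  next
    fix t assume "t \<in> insert s {t \<in> D g. lorentz s t = 0}"
    then show "t \<in> D (g \<otimes>\<^bsub>G\<^esub> hreflection s)" using sD by (auto simp: D_def eq)
  qed
qed

section \<open>Length as the number of ascents\<close>

lemma mult_cancel: "g \<in> carrier G \<Longrightarrow> s \<in> \<Phi> \<Longrightarrow>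
    g \<otimes>\<^bsub>G\<^esub> hreflection s \<otimes>\<^bsub>G\<^esub> hreflection s = g"
  by (simp add: G.m_assoc hreflection_G hreflection_square)

text \<open>A descent \<open>s\<close> other than the last letter \<open>t\<close> commutes with
  \<open>t\<close> and was a descent before. By induction the gallery before \<open>t\<close> can be
  shortened by \<open>s\<close>; then \<open>t\<close> is still an ascent and is appended
  again.\<close>

lemma Up_down: "Up n g \<Longrightarrow> s \<in> D g \<Longrightarrow> \<exists>m. n = Suc m \<and> Up m (g \<otimes>\<^bsub>G\<^esub> hreflection s)"
proof (induction arbitrary: s rule: Up.induct)
  case Up_one
  then show ?case using face_normal(4)[of s] by (auto simp: D_def coord_one)
next
  case (Up_mult n g t)
  note g = Up_carrier[OF Up_mult.hyps(1)]
  have t: "t \<notin> D g" using Up_mult.hyps by (simp add: D_def)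
  show ?case
  proof (cases "s = t")
    case True
    then show ?thesis using Up_mult.hyps g by (simp add: mult_cancel)
  next
    case False
    then have s: "s \<in> D g" "lorentz t s = 0"
      using Up_mult.prems D_mult(2)[OF Up_mult.hyps(1,2) t] by auto
    have sF: "s \<in> \<Phi>" using s by (simp add: D_def)
    obtain m where m: "n = Suc m" "Up m (g \<otimes>\<^bsub>G\<^esub> hreflection s)" using Up_mult.IH[OF s(1)] by blast
    have "coord (g \<otimes>\<^bsub>G\<^esub> hreflection s) t < 0"
      using Up_mult.hyps s lorentz_commute[of s t] by (simp add: coord_mult[OF g sF])
    then have "Up (Suc m) (g \<otimes>\<^bsub>G\<^esub> hreflection s \<otimes>\<^bsub>G\<^esub> hreflection t)"
      using m(2) Up_mult.hyps(2) Up.Up_mult by blast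
    moreover have "g \<otimes>\<^bsub>G\<^esub> hreflection s \<otimes>\<^bsub>G\<^esub> hreflection t = g \<otimes>\<^bsub>G\<^esub> hreflection t \<otimes>\<^bsub>G\<^esub> hreflection s"
      using hreflection_commute[OF Up_mult.hyps(2) sF s(2)] g Up_mult.hyps(2) sF
      by (simp add: G.m_assoc hreflection_G)
    ultimately show ?thesis using m by simp
  qed
qed

lemma Up_unique: "Up n g \<Longrightarrow> Up m g \<Longrightarrow> n = m"
proof (induction arbitrary: m rule: Up.induct)
  case Up_one
  have D1: "D \<one>\<^bsub>G\<^esub> = {}" using face_normal(4) by (fastforce simp: D_def coord_one)
  from Up_one show ?case
  proof cases
    case (Up_mult n g s)
    then have "s \<in> D (g \<otimes>\<^bsub>G\<^esub> hreflection s)" using D_mult(2)[of n g s] by (auto simp: D_def)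
    then show ?thesis using D1 Up_mult by simp
  qed simp
next
  case (Up_mult n g s)
  have "s \<in> D (g \<otimes>\<^bsub>G\<^esub> hreflection s)"
    using D_mult(2)[OF Up_mult.hyps(1,2)] Up_mult.hyps(3) by (auto simp: D_def)
  then obtain m' where "m = Suc m'" "Up m' (g \<otimes>\<^bsub>G\<^esub> hreflection s \<otimes>\<^bsub>G\<^esub> hreflection s)"
    using Up_down[OF Up_mult.prems] by blast
  then show ?case using Up_mult.IH[of m'] Up_mult.hyps Up_carrier by (simp add: mult_cancel)
qed

lemma Up_step: "Up n g \<Longrightarrow> s \<in> \<Phi> \<Longrightarrow> \<exists>m. Up m (g \<otimes>\<^bsub>G\<^esub> hreflection s)"
  using Up_down D_mult(1) Up_mult by blast

lemma ex_Up: "g \<in> carrier G \<Longrightarrow> \<exists>n. Up n g"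
proof -
  have mult: "\<exists>m. Up m (f \<otimes>\<^bsub>G\<^esub> h)"
    if "h \<in> generate Isom_H3 (face_reflections P)" "Up n f" for f h n
    using that
  proof (induction arbitrary: f n rule: generate.induct)
    case one
    have "\<one>\<^bsub>Isom_H3\<^esub> = \<one>\<^bsub>G\<^esub>" by (simp add: reflection_group_def)
    then show ?case using one Up_carrier by auto
  next
    case (incl h)
    then show ?case using Up_step by (auto simp: face_reflections_def)
  next
    case (inv h)
    then obtain s where s: "s \<in> \<Phi>" "h = hreflection s" by (auto simp: face_reflections_def)
    have "inv\<^bsub>Isom_H3\<^esub> h = h"
    proof (rule group.inv_equality[OF group_Isom_H3])
      show "h \<otimes>\<^bsub>Isom_H3\<^esub> h = \<one>\<^bsub>Isom_H3\<^esub>"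
        using hreflection_square[OF s(1)] s(2) by (simp add: reflection_group_def)
    qed (use s hreflection_Isom in auto)
    then show ?case using Up_step[OF inv.prems s(1)] s(2) by simp
  next
    case (eng h1 h2)
    then obtain m where "Up m (f \<otimes>\<^bsub>G\<^esub> h1)" by blast
    then obtain m' where "Up m' (f \<otimes>\<^bsub>G\<^esub> h1 \<otimes>\<^bsub>G\<^esub> h2)" using eng.IH(2) by blast
    moreover have "h1 \<in> carrier G" "h2 \<in> carrier G" using eng.hyps by (simp_all add: carrier_G)
    moreover have "h1 \<otimes>\<^bsub>Isom_H3\<^esub> h2 = h1 \<otimes>\<^bsub>G\<^esub> h2" by (simp add: reflection_group_def)
    ultimately show ?case using Up_carrier[OF eng.prems] by (metis G.m_assoc)
  qed
  assume "g \<in> carrier G"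
  then show ?thesis using mult[of g 0 "\<one>\<^bsub>G\<^esub>"] Up_one by (simp add: carrier_G[symmetric])
qed

definition len :: "(minkowski \<Rightarrow> minkowski) \<Rightarrow> nat" where
  "len g = (THE n. Up n g)"

lemma Up_len: "g \<in> carrier G \<Longrightarrow> Up (len g) g"
  unfolding len_def using ex_Up Up_unique by (metis theI)

lemma len_eq: "Up n g \<Longrightarrow> len g = n"
  using Up_len Up_unique Up_carrier by blast

lemma coxeter: "right_angled_coxeter G \<Phi> hreflection nb D len"
proof (unfold_locales; (fact finite_normals hreflection_G hreflection_square nb_sym nb_irrefl)?)
  show "len \<one>\<^bsub>G\<^esub> = 0" by (rule len_eq) (rule Up_one)
next
  fix g assume g: "g \<in> carrier G"
  note up = Up_len[OF g]
  show "D g \<subseteq> \<Phi>" by (auto simp: D_def)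
  show "g = \<one>\<^bsub>G\<^esub>" if "len g = 0" using up unfolding that by cases
  show "D g \<noteq> {}" if "len g > 0"
  proof -
    from that obtain n where "Up (Suc n) g" using up by (cases "len g") auto
    then show ?thesis
    proof cases
      case (Up_mult h s)
      then show ?thesis using D_mult(2)[of n h s] by (auto simp: D_def)
    qed
  qed
  show "Suc (len (g \<otimes>\<^bsub>G\<^esub> hreflection s)) = len g" if "s \<in> D g" for s
    using Up_down[OF up that] len_eq by auto
  fix s assume s: "s \<in> \<Phi>" "s \<notin> D g"
  show "len (g \<otimes>\<^bsub>G\<^esub> hreflection s) = Suc (len g)"
    using Up_mult[OF up s(1) D_mult(1)[OF up s]] by (rule len_eq)
  show "D (g \<otimes>\<^bsub>G\<^esub> hreflection s) = insert s {t \<in> D g. nb s t}"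
    using D_mult(2)[OF up s] s by (auto simp: nb_def D_def)
qed

lemma card_D_le: "g \<in> carrier G \<Longrightarrow> card (D g) \<le> 3"
  using D_orthogonal[OF Up_len] by (intro card_clique_le) (auto simp: nb_def D_def)

end

section \<open>Product Bernoulli measures\<close>

definition bernoulli :: "'i set \<Rightarrow> real \<Rightarrow> ('i \<Rightarrow> bool) measure" where
  "bernoulli I p = PiM I (\<lambda>_. measure_pmf (bernoulli_pmf p))"

lemma space_bernoulli: "space (bernoulli I p) = (\<Pi>\<^sub>E i\<in>I. UNIV)"
  by (simp add: bernoulli_def space_PiM)

lemma prob_space_bernoulli: "prob_space (bernoulli I p)"
  unfolding bernoulli_def by (intro prob_space_PiM measure_pmf.prob_space_axioms)

lemma sets_bernoulli_coord: "i \<in> I \<Longrightarrow> {\<omega> \<in> space (bernoulli I p). \<omega> i} \<in> sets (bernoulli I p)"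
proof -
  assume "i \<in> I"
  then have "(\<lambda>\<omega>. \<omega> i) \<in> measurable (bernoulli I p) (measure_pmf (bernoulli_pmf p))"
    unfolding bernoulli_def by (rule measurable_component_singleton)
  then have "(\<lambda>\<omega>. \<omega> i) -` {True} \<inter> space (bernoulli I p) \<in> sets (bernoulli I p)"
    by (rule measurable_sets) simp
  also have "(\<lambda>\<omega>. \<omega> i) -` {True} \<inter> space (bernoulli I p) = {\<omega> \<in> space (bernoulli I p). \<omega> i}" by auto
  finally show ?thesis .
qed

lemma prob_bernoulli_coord:
  assumes "i \<in> I" "p \<in> {0..1}"
  shows "measure (bernoulli I p) {\<omega> \<in> space (bernoulli I p). \<omega> i} = p"
proof -
  let ?B = "measure_pmf (bernoulli_pmf p)"
  have meas: "(\<lambda>\<omega>. \<omega> i) \<in> measurable (bernoulli I p) ?B"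
    unfolding bernoulli_def using assms(1) by (rule measurable_component_singleton)
  have "distr (bernoulli I p) ?B (\<lambda>\<omega>. \<omega> i) = ?B"
    unfolding bernoulli_def using assms(1) by (intro distr_PiM_component measure_pmf.prob_space_axioms)
  then have "measure (distr (bernoulli I p) ?B (\<lambda>\<omega>. \<omega> i)) {True} = p"
    using assms(2) by (simp add: measure_pmf_single)
  then have "measure (bernoulli I p) ((\<lambda>\<omega>. \<omega> i) -` {True} \<inter> space (bernoulli I p)) = p"
    by (subst (asm) measure_distr[OF meas]) auto
  also have "(\<lambda>\<omega>. \<omega> i) -` {True} \<inter> space (bernoulli I p) = {\<omega> \<in> space (bernoulli I p). \<omega> i}" by auto
  finally show ?thesis .
qed

lemma indep_vars_bernoulli:
  fixes I :: "'i set"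
  assumes "I \<noteq> {}"
  shows "prob_space.indep_vars (bernoulli I p) (\<lambda>_. measure_pmf (bernoulli_pmf p)) (\<lambda>i \<omega>. \<omega> i) I"
proof -
  let ?B = "\<lambda>_::'i. measure_pmf (bernoulli_pmf p)"
  interpret prob_space "bernoulli I p" by (rule prob_space_bernoulli)
  have "distr (bernoulli I p) (PiM I ?B) (\<lambda>x. \<lambda>i\<in>I. x i)
      = distr (bernoulli I p) (bernoulli I p) (\<lambda>x. x)"
    by (rule distr_cong) (auto simp: bernoulli_def space_PiM fun_eq_iff PiE_def extensional_def)
  also have "\<dots> = PiM I ?B" by (simp add: bernoulli_def)
  also have "\<dots> = (\<Pi>\<^sub>M i\<in>I. distr (bernoulli I p) (?B i) (\<lambda>x. x i))"
    unfolding bernoulli_def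
    by (intro PiM_cong refl, subst distr_PiM_component) (auto intro: measure_pmf.prob_space_axioms)
  finally show ?thesis
    by (subst indep_vars_iff_distr_eq_PiM'[OF assms])
      (auto simp: bernoulli_def intro: measurable_component_singleton)
qed

definition depends_on :: "('i \<Rightarrow> bool) set \<Rightarrow> 'i set \<Rightarrow> 'i set \<Rightarrow> bool" where
  "depends_on A I K \<longleftrightarrow>
    (\<forall>\<omega>\<in>\<Pi>\<^sub>E i\<in>I. UNIV. \<forall>\<omega>'\<in>\<Pi>\<^sub>E i\<in>I. UNIV. (\<forall>i\<in>K. \<omega> i = \<omega>' i) \<longrightarrow> \<omega> \<in> A \<longrightarrow> \<omega>' \<in> A)"

lemma prob_INT_independent:
  fixes I :: "'i set"
  assumes L: "finite L" "L \<noteq> {}" and K: "\<And>j. j \<in> L \<Longrightarrow> K j \<subseteq> I" "disjoint_family_on K L"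
    and A: "\<And>j. j \<in> L \<Longrightarrow> A j \<in> sets (bernoulli I p)" "\<And>j. j \<in> L \<Longrightarrow> depends_on (A j) I (K j)"
    and "I \<noteq> {}"
  shows "measure (bernoulli I p) (\<Inter>j\<in>L. A j) = (\<Prod>j\<in>L. measure (bernoulli I p) (A j))"
proof -
  let ?B = "\<lambda>_::'i. measure_pmf (bernoulli_pmf p)"
  let ?M = "bernoulli I p"
  interpret prob_space ?M by (rule prob_space_bernoulli)
  have ind: "indep_vars (\<lambda>j. PiM (K j) ?B) (\<lambda>j \<omega>. restrict (\<lambda>i. \<omega> i) (K j)) L"
    by (rule indep_vars_restrict[OF indep_vars_bernoulli[OF \<open>I \<noteq> {}\<close>] K])
  \<comment> \<open>Coordinates outside \<open>K j\<close> get the arbitrary value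
    \<open>False\<close>, to which \<open>A j\<close> is blind; this expresses \<open>A j\<close>
    through the coordinates in \<open>K j\<close>.\<close>
  define ext where "ext j \<eta> = (\<lambda>i\<in>I. if i \<in> K j then \<eta> i else False)" for j and \<eta> :: "'i \<Rightarrow> bool"
  define C where "C j = ext j -` A j \<inter> space (PiM (K j) ?B)" for j
  have ext: "ext j \<in> measurable (PiM (K j) ?B) ?M" if "j \<in> L" for j
    unfolding bernoulli_def ext_def
  proof (rule measurable_restrict)
    fix i assume "i \<in> I"
    show "(\<lambda>\<eta>. if i \<in> K j then \<eta> i else False) \<in> measurable (PiM (K j) ?B) (?B i)"
      by (cases "i \<in> K j") (auto intro: measurable_component_singleton)
  qed
  have C: "C j \<in> sets (PiM (K j) ?B)" if "j \<in> L" for j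
    unfolding C_def using ext[OF that] A(1)[OF that] by (rule measurable_sets)
  have eq: "(\<lambda>\<omega>. restrict (\<lambda>i. \<omega> i) (K j)) -` C j \<inter> space ?M = A j" if j: "j \<in> L" for j
  proof -
    have "restrict (\<lambda>i. \<omega> i) (K j) \<in> C j \<longleftrightarrow> \<omega> \<in> A j" if "\<omega> \<in> space ?M" for \<omega>
    proof -
      let ?\<omega>' = "ext j (restrict (\<lambda>i. \<omega> i) (K j))"
      have "\<omega> \<in> (\<Pi>\<^sub>E i\<in>I. UNIV)" "?\<omega>' \<in> (\<Pi>\<^sub>E i\<in>I. UNIV)" using that by (auto simp: space_bernoulli ext_def)
      moreover have "\<forall>i\<in>K j. \<omega> i = ?\<omega>' i" using K(1)[OF j] by (auto simp: ext_def)
      ultimately have "\<omega> \<in> A j \<longleftrightarrow> ?\<omega>' \<in> A j" using A(2)[OF j] unfolding depends_on_def by metis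
      then show ?thesis by (simp add: C_def space_PiM)
    qed
    moreover have "A j \<subseteq> space ?M" using A(1)[OF j] by (rule sets.sets_into_space)
    ultimately show ?thesis by auto
  qed
  have "prob (\<Inter>j\<in>L. (\<lambda>\<omega>. restrict (\<lambda>i. \<omega> i) (K j)) -` C j \<inter> space ?M)
      = (\<Prod>j\<in>L. prob ((\<lambda>\<omega>. restrict (\<lambda>i. \<omega> i) (K j)) -` C j \<inter> space ?M))"
    using L C by (intro indep_varsD[OF ind]) auto
  then show ?thesis using eq by (simp cong: INF_cong)
qed

lemma prob_all_open:
  assumes "finite J" "J \<subseteq> I" "I \<noteq> {}" "p \<in> {0..1}"
  shows "measure (bernoulli I p) {\<omega> \<in> space (bernoulli I p). \<forall>i\<in>J. \<omega> i} = p ^ card J"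
proof (cases "J = {}")
  case True
  then show ?thesis using prob_space.prob_space[OF prob_space_bernoulli] by simp
next
  case False
  let ?A = "\<lambda>i. {\<omega> \<in> space (bernoulli I p). \<omega> i}"
  have "measure (bernoulli I p) (\<Inter>i\<in>J. ?A i) = (\<Prod>i\<in>J. measure (bernoulli I p) (?A i))"
    using assms False
    by (intro prob_INT_independent[where K = "\<lambda>i. {i}"] sets_bernoulli_coord)
      (auto simp: depends_on_def space_bernoulli disjoint_family_on_def)
  also have "\<dots> = (\<Prod>i\<in>J. p)"
    using assms by (intro prod.cong) (auto intro!: prob_bernoulli_coord)
  also have "(\<Inter>i\<in>J. ?A i) = {\<omega> \<in> space (bernoulli I p). \<forall>i\<in>J. \<omega> i}" using False by auto
  finally show ?thesis by simp
qed

lemma distr_bernoulli_reindex: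
  assumes "bij_betw \<phi> I I"
  shows "distr (bernoulli I p) (bernoulli I p) (\<lambda>\<omega>. \<lambda>i\<in>I. \<omega> (\<phi> i)) = bernoulli I p"
  unfolding bernoulli_def
  using assms by (intro distr_PiM_reindex measure_pmf.prob_space_axioms) (auto simp: bij_betw_def)

lemma measurable_bernoulli_reindex:
  assumes "bij_betw \<phi> I I"
  shows "(\<lambda>\<omega>. \<lambda>i\<in>I. \<omega> (\<phi> i)) \<in> measurable (bernoulli I p) (bernoulli I p)"
  unfolding bernoulli_def
proof (rule measurable_restrict)
  fix i assume "i \<in> I"
  then have "\<phi> i \<in> I" using assms by (auto simp: bij_betw_def)
  then show "(\<lambda>\<omega>. \<omega> (\<phi> i)) \<in> measurable (PiM I (\<lambda>_. measure_pmf (bernoulli_pmf p))) (measure_pmf (bernoulli_pmf p))"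
    by (rule measurable_component_singleton)
qed

lemma (in prob_space) Bonferroni:
  fixes n :: nat
  assumes "\<And>i. A i \<in> sets M"
  shows "(\<Sum>i<n. prob (A i)) - (\<Sum>j<n. \<Sum>i<j. prob (A i \<inter> A j)) \<le> prob (\<Union>i<n. A i)"
proof (induction n)
  case (Suc n)
  have U: "(\<Union>i<n. A i) \<in> sets M" using assms by auto
  have "(\<Union>i<Suc n. A i) = (\<Union>i<n. A i) \<union> A n" by (auto simp: less_Suc_eq)
  then have "prob (\<Union>i<Suc n. A i) = prob (\<Union>i<n. A i) + prob (A n) - prob (A n \<inter> (\<Union>i<n. A i))"
    using finite_measure_Union'[OF U assms[of n]] finite_measure_Diff'[OF assms[of n] U] by simp
  moreover have "prob (A n \<inter> (\<Union>i<n. A i)) \<le> (\<Sum>i<n. prob (A i \<inter> A n))"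
  proof -
    have eq: "A n \<inter> (\<Union>i<n. A i) = (\<Union>i<n. A i \<inter> A n)" by auto
    show ?thesis unfolding eq by (rule finite_measure_subadditive_finite) (use assms in auto)
  qed
  ultimately show ?case using Suc.IH by simp
qed simp

section \<open>Percolation on Cayley graphs of Coxeter groups\<close>

locale sparse_coxeter = right_angled_coxeter G S r nb D len
  for G :: "('a, 'b) monoid_scheme" (structure) and S :: "'s set" and r nb D len +
  assumes card_D: "x \<in> carrier G \<Longrightarrow> card (D x) \<le> 3"
    and card_clique: "c \<in> cliques nb S \<Longrightarrow> card c \<le> 3"
    and card_common: "s \<in> S \<Longrightarrow> t \<in> S \<Longrightarrow> s \<noteq> t \<Longrightarrow> card {u \<in> S. nb u s \<and> nb u t} \<le> 2"
    and card_S: "card S \<ge> 18"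

text \<open>The variable \<open>\<iota> x y\<close> is the one that a step from \<open>x\<close> to
  \<open>y\<close> has to find open: the edge \<open>{x, y}\<close> for bond percolation, the
  endpoint \<open>y\<close> for site percolation. In the latter case it says nothing about
  \<open>x\<close>, hence the premise \<open>x \<in> V \<omega>\<close> of \<open>E_I\<close>. Steps
  share a variable only if they end at the same place or are reverses of each other.\<close>

locale coxeter_percolation = sparse_coxeter G S r nb D len
  for G :: "('a, 'b) monoid_scheme" (structure) and S :: "'s set" and r nb D len +
  fixes I :: "'i set" and \<iota> :: "'a \<Rightarrow> 'a \<Rightarrow> 'i" and sub :: "('i \<Rightarrow> bool) \<Rightarrow> 'a ugraph"
    and V :: "('i \<Rightarrow> bool) \<Rightarrow> 'a set" and E :: "('i \<Rightarrow> bool) \<Rightarrow> ('a \<times> 'a) set"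
  defines "V \<equiv> \<lambda>\<omega>. fst (sub \<omega>)" and "E \<equiv> \<lambda>\<omega>. {(x, y). {x, y} \<in> snd (sub \<omega>)}"
  assumes countable_I: "countable I"
    and \<iota>_I: "x \<in> carrier G \<Longrightarrow> s \<in> S \<Longrightarrow> \<iota> x (x \<otimes> r s) \<in> I"
    and \<iota>_eq: "x \<in> carrier G \<Longrightarrow> y \<in> carrier G \<Longrightarrow> s \<in> S \<Longrightarrow> t \<in> S \<Longrightarrow>
      \<iota> x (x \<otimes> r s) = \<iota> y (y \<otimes> r t) \<Longrightarrow> x \<otimes> r s = y \<otimes> r t \<or> x = y \<otimes> r t \<and> y = x \<otimes> r s"
    and V_carrier: "V \<omega> \<subseteq> carrier G"
    and E_step: "(x, y) \<in> E \<omega> \<Longrightarrow> x \<in> V \<omega> \<and> y \<in> V \<omega> \<and> (\<exists>s\<in>S. y = x \<otimes> r s) \<and> \<omega> (\<iota> x y)"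
    and E_I: "x \<in> V \<omega> \<Longrightarrow> s \<in> S \<Longrightarrow> \<omega> (\<iota> x (x \<otimes> r s)) \<Longrightarrow> (x, x \<otimes> r s) \<in> E \<omega>"
    and V_I: "x \<in> carrier G \<Longrightarrow> s \<in> S \<Longrightarrow> \<omega> (\<iota> x (x \<otimes> r s)) \<Longrightarrow> x \<otimes> r s \<in> V \<omega>"
    and V_sets: "x \<in> carrier G \<Longrightarrow> {\<omega> \<in> space (bernoulli I p). x \<in> V \<omega>} \<in> sets (bernoulli I p)"
    and E_sets: "x \<in> carrier G \<Longrightarrow> y \<in> carrier G \<Longrightarrow>
      {\<omega> \<in> space (bernoulli I p). (x, y) \<in> E \<omega>} \<in> sets (bernoulli I p)"
    and translation: "g \<in> carrier G \<Longrightarrow> \<exists>\<phi>. bij_betw \<phi> I I \<and> (\<forall>\<omega>.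
      (\<forall>x\<in>carrier G. x \<in> V (\<lambda>i\<in>I. \<omega> (\<phi> i)) \<longleftrightarrow> g \<otimes> x \<in> V \<omega>) \<and>
      (\<forall>x\<in>carrier G. \<forall>y\<in>carrier G. (x, y) \<in> E (\<lambda>i\<in>I. \<omega> (\<phi> i)) \<longleftrightarrow> (g \<otimes> x, g \<otimes> y) \<in> E \<omega>))"
begin

section \<open>Clusters: measurability and invariance\<close>

abbreviation M where "M p \<equiv> bernoulli I p"

lemma E_carrier: "(x, y) \<in> E \<omega> \<Longrightarrow> x \<in> carrier G \<and> y \<in> carrier G"
  using E_step V_carrier by blast

lemma E_rtrancl_V: "(x, y) \<in> (E \<omega>)\<^sup>* \<Longrightarrow> x \<in> V \<omega> \<Longrightarrow> y \<in> V \<omega>"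
  by (induction rule: rtrancl_induct) (use E_step in auto)

definition cluster :: "('i \<Rightarrow> bool) \<Rightarrow> 'a \<Rightarrow> 'a set" where
  "cluster \<omega> x = {y. (x, y) \<in> (E \<omega>)\<^sup>*}"

definition in_infinite :: "('i \<Rightarrow> bool) \<Rightarrow> 'a \<Rightarrow> bool" where
  "in_infinite \<omega> x \<longleftrightarrow> x \<in> V \<omega> \<and> infinite (cluster \<omega> x)"

lemma connected_components_eq: "connected_components (sub \<omega>) = cluster \<omega> ` V \<omega>"
proof -
  have VE: "fst (sub \<omega>) = V \<omega>" "{(x, y). {x, y} \<in> snd (sub \<omega>)} = E \<omega>"
    by (simp_all add: V_def E_def)
  have "{(v, w) \<in> V \<omega> \<times> V \<omega>. (v, w) \<in> (E \<omega>)\<^sup>*} `` {x} = cluster \<omega> x" if "x \<in> V \<omega>" for x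
    using that E_rtrancl_V by (auto simp: cluster_def)
  then show ?thesis
    unfolding connected_components_def quotient_def VE by auto
qed

lemma ex_infinite_component_iff:
  "(\<exists>C\<in>connected_components (sub \<omega>). infinite C) \<longleftrightarrow> (\<exists>x\<in>carrier G. in_infinite \<omega> x)"
  using V_carrier by (auto simp: connected_components_eq in_infinite_def)

lemma ex1_infinite_componentD:
  assumes "\<exists>!C. C \<in> connected_components (sub \<omega>) \<and> infinite C"
  shows "\<exists>x\<in>carrier G. in_infinite \<omega> x"
    and "in_infinite \<omega> x \<Longrightarrow> in_infinite \<omega> y \<Longrightarrow> (x, y) \<in> (E \<omega>)\<^sup>*"
proof -
  show "\<exists>x\<in>carrier G. in_infinite \<omega> x" using assms unfolding ex_infinite_component_iff[symmetric] by blast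
  assume "in_infinite \<omega> x" "in_infinite \<omega> y"
  then have "cluster \<omega> x = cluster \<omega> y"
    using assms unfolding connected_components_eq in_infinite_def by (metis image_eqI)
  then show "(x, y) \<in> (E \<omega>)\<^sup>*" by (auto simp: cluster_def)
qed

lemma reach_sets:
  assumes "x \<in> carrier G" "y \<in> carrier G"
  shows "{\<omega> \<in> space (M p). (x, y) \<in> (E \<omega>)\<^sup>*} \<in> sets (M p)"
proof -
  have pow: "{\<omega> \<in> space (M p). (x, y) \<in> E \<omega> ^^ n} \<in> sets (M p)" if "y \<in> carrier G" for n y
    using that
  proof (induction n arbitrary: y)
    case 0
    then show ?case by (cases "x = y") auto
  next
    case (Suc n)
    have "{\<omega> \<in> space (M p). (x, y) \<in> E \<omega> ^^ Suc n} =
        (\<Union>z\<in>carrier G. {\<omega> \<in> space (M p). (x, z) \<in> E \<omega> ^^ n} \<inter> {\<omega> \<in> space (M p). (z, y) \<in> E \<omega>})"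
      using E_carrier by (auto simp: relcomp_unfold)
    also have "\<dots> \<in> sets (M p)"
      using Suc E_sets by (intro sets.countable_UN' countable_carrier) auto
    finally show ?case .
  qed
  have "{\<omega> \<in> space (M p). (x, y) \<in> (E \<omega>)\<^sup>*} = (\<Union>n. {\<omega> \<in> space (M p). (x, y) \<in> E \<omega> ^^ n})"
    by (auto simp: rtrancl_power)
  also have "\<dots> \<in> sets (M p)" using pow assms by auto
  finally show ?thesis .
qed

lemma in_infinite_sets:
  assumes x: "x \<in> carrier G"
  shows "{\<omega> \<in> space (M p). in_infinite \<omega> x} \<in> sets (M p)"
proof -
  \<comment> \<open>Numbering the group turns infinitude of a cluster into countable quantifiers
    over reachability events.\<close>
  define f where "f = to_nat_on (carrier G)"
  have f: "inj_on f (carrier G)" unfolding f_def by (intro inj_on_to_nat_on countable_carrier)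
  have inf: "in_infinite \<omega> x \<longleftrightarrow> x \<in> V \<omega> \<and> (\<forall>n. \<exists>y\<in>carrier G. f y \<ge> n \<and> (x, y) \<in> (E \<omega>)\<^sup>*)" for \<omega>
  proof (cases "x \<in> V \<omega>")
    case True
    then have sub: "cluster \<omega> x \<subseteq> carrier G"
      using E_rtrancl_V V_carrier unfolding cluster_def by blast
    then have "finite (cluster \<omega> x) \<longleftrightarrow> finite (f ` cluster \<omega> x)"
      using f by (meson finite_imageI finite_image_iff inj_on_subset)
    also have "\<dots> \<longleftrightarrow> (\<exists>n. \<forall>y\<in>cluster \<omega> x. f y < n)"
      unfolding finite_nat_set_iff_bounded by auto
    finally have "infinite (cluster \<omega> x) \<longleftrightarrow> (\<forall>n. \<exists>y\<in>cluster \<omega> x. f y \<ge> n)"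
      by (auto simp: not_less)
    moreover have "(\<exists>y\<in>cluster \<omega> x. f y \<ge> n) \<longleftrightarrow> (\<exists>y\<in>carrier G. f y \<ge> n \<and> (x, y) \<in> (E \<omega>)\<^sup>*)" for n
      using sub unfolding cluster_def by blast
    ultimately show ?thesis using True by (simp add: in_infinite_def)
  qed (simp add: in_infinite_def)
  have "{\<omega> \<in> space (M p). in_infinite \<omega> x} = {\<omega> \<in> space (M p). x \<in> V \<omega>} \<inter>
      (\<Inter>n. \<Union>y\<in>{y \<in> carrier G. f y \<ge> n}. {\<omega> \<in> space (M p). (x, y) \<in> (E \<omega>)\<^sup>*})"
    by (auto simp: inf)
  also have "\<dots> \<in> sets (M p)"
    using x reach_sets V_sets
    by (intro sets.Int sets.countable_INT sets.countable_UN' image_subsetI)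
      (auto intro: countable_subset[OF _ countable_carrier])
  finally show ?thesis .
qed

lemma ex_infinite_component_sets:
  "{\<omega> \<in> space (M p). \<exists>C\<in>connected_components (sub \<omega>). infinite C} \<in> sets (M p)"
proof -
  have "{\<omega> \<in> space (M p). \<exists>C\<in>connected_components (sub \<omega>). infinite C}
      = (\<Union>x\<in>carrier G. {\<omega> \<in> space (M p). in_infinite \<omega> x})"
    by (auto simp: ex_infinite_component_iff)
  also have "\<dots> \<in> sets (M p)"
    using in_infinite_sets by (intro sets.countable_UN' countable_carrier) auto
  finally show ?thesis .
qed

text \<open>Left multiplication is a graph automorphism, and permuting independent coordinates with
  the same law preserves the measure.\<close>

lemma prob_in_infinite:
  assumes g: "g \<in> carrier G"
  shows "measure (M p) {\<omega> \<in> space (M p). in_infinite \<omega> g}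
    = measure (M p) {\<omega> \<in> space (M p). in_infinite \<omega> \<one>}"
proof -
  obtain \<phi> where \<phi>: "bij_betw \<phi> I I"
    and V: "\<And>\<omega> x. x \<in> carrier G \<Longrightarrow> x \<in> V (\<lambda>i\<in>I. \<omega> (\<phi> i)) \<longleftrightarrow> g \<otimes> x \<in> V \<omega>"
    and E: "\<And>\<omega> x y. x \<in> carrier G \<Longrightarrow> y \<in> carrier G \<Longrightarrow>
      (x, y) \<in> E (\<lambda>i\<in>I. \<omega> (\<phi> i)) \<longleftrightarrow> (g \<otimes> x, g \<otimes> y) \<in> E \<omega>"
    using translation[OF g] by blast
  define T where "T \<omega> = (\<lambda>i\<in>I. \<omega> (\<phi> i))" for \<omega> :: "'i \<Rightarrow> bool"
  note V = V[folded T_def] and E = E[folded T_def]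
  have T: "T \<in> measurable (M p) (M p)" unfolding T_def by (rule measurable_bernoulli_reindex[OF \<phi>])
  have d: "distr (M p) (M p) T = M p" unfolding T_def by (rule distr_bernoulli_reindex[OF \<phi>])
  have forward: "y \<in> carrier G \<and> (g, g \<otimes> y) \<in> (E \<omega>)\<^sup>*" if "(\<one>, y) \<in> (E (T \<omega>))\<^sup>*" for y \<omega>
    using that
  proof (induction rule: rtrancl_induct)
    case (step y z)
    then have "(g \<otimes> y, g \<otimes> z) \<in> E \<omega>" "z \<in> carrier G" using E_carrier E by blast+
    then show ?case using step by (meson rtrancl.rtrancl_into_rtrancl)
  qed (use g in auto)
  have backward: "\<exists>y\<in>carrier G. z = g \<otimes> y \<and> (\<one>, y) \<in> (E (T \<omega>))\<^sup>*" if "(g, z) \<in> (E \<omega>)\<^sup>*" for z \<omega>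
    using that
  proof (induction rule: rtrancl_induct)
    case (step z z')
    then obtain y where y: "y \<in> carrier G" "z = g \<otimes> y" "(\<one>, y) \<in> (E (T \<omega>))\<^sup>*" by blast
    have z': "z' \<in> carrier G" using step E_carrier by blast
    define y' where "y' = inv g \<otimes> z'"
    have y': "y' \<in> carrier G" "z' = g \<otimes> y'" using z' g by (simp_all add: y'_def flip: m_assoc)
    then have "(y, y') \<in> E (T \<omega>)" using step(2) y E by blast
    then have "(\<one>, y') \<in> (E (T \<omega>))\<^sup>*" using y(3) by (rule rtrancl.rtrancl_into_rtrancl[rotated])
    then show ?case using y' by blast
  qed (use g in auto)
  have cl: "cluster \<omega> g = (\<lambda>y. g \<otimes> y) ` cluster (T \<omega>) \<one>" for \<omega>
    using forward backward unfolding cluster_def by blast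
  have "in_infinite (T \<omega>) \<one> \<longleftrightarrow> in_infinite \<omega> g" for \<omega>
  proof -
    have "inj_on (\<lambda>y. g \<otimes> y) (cluster (T \<omega>) \<one>)"
      using forward unfolding cluster_def by (intro inj_on_subset[OF inj_on_cmult[OF g]]) blast
    then have "infinite (cluster \<omega> g) \<longleftrightarrow> infinite (cluster (T \<omega>) \<one>)"
      unfolding cl by (simp add: finite_image_iff)
    moreover have "\<one> \<in> V (T \<omega>) \<longleftrightarrow> g \<in> V \<omega>" using V[of \<one>] g by simp
    ultimately show ?thesis by (simp add: in_infinite_def)
  qed
  then have eq: "T -` {\<omega> \<in> space (M p). in_infinite \<omega> \<one>} \<inter> space (M p)
      = {\<omega> \<in> space (M p). in_infinite \<omega> g}"
    using measurable_space[OF T] by auto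
  have "measure (M p) {\<omega> \<in> space (M p). in_infinite \<omega> \<one>}
      = measure (distr (M p) (M p) T) {\<omega> \<in> space (M p). in_infinite \<omega> \<one>}"
    by (simp add: d)
  also have "\<dots> = measure (M p) {\<omega> \<in> space (M p). in_infinite \<omega> g}"
    unfolding measure_distr[OF T in_infinite_sets[OF one_closed]] eq ..
  finally show ?thesis by simp
qed

end

section \<open>Non-uniqueness\<close>

context coxeter_percolation
begin

section \<open>Self-avoiding paths\<close>

primrec verts :: "'a \<Rightarrow> 's list \<Rightarrow> 'a list" where
  "verts x [] = []"
| "verts x (s # w) = (x \<otimes> r s) # verts (x \<otimes> r s) w"

primrec steps :: "'a \<Rightarrow> 's list \<Rightarrow> 'i list" where
  "steps x [] = []"
| "steps x (s # w) = \<iota> x (x \<otimes> r s) # steps (x \<otimes> r s) w"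

lemma length_steps [simp]: "length (steps x w) = length w"
  by (induction w arbitrary: x) auto

lemma steps_I: "x \<in> carrier G \<Longrightarrow> set w \<subseteq> S \<Longrightarrow> set (steps x w) \<subseteq> I"
  by (induction w arbitrary: x) (auto simp: \<iota>_I r_closed)

lemma steps_verts:
  "x \<in> carrier G \<Longrightarrow> set w \<subseteq> S \<Longrightarrow> i \<in> set (steps x w) \<Longrightarrow>
    \<exists>u\<in>carrier G. \<exists>t\<in>S. i = \<iota> u (u \<otimes> r t) \<and> u \<otimes> r t \<in> set (verts x w)"
proof (induction w arbitrary: x)
  case (Cons s w)
  show ?case
  proof (cases "i = \<iota> x (x \<otimes> r s)")
    case True
    then show ?thesis using Cons.prems by (intro bexI[of _ x] bexI[of _ s]) auto
  next
    case False
    then show ?thesis using Cons.IH[of "x \<otimes> r s"] Cons.prems r_closed by fastforce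
  qed
qed simp

text \<open>By \<open>\<iota>_eq\<close> a variable used twice would make the later step end at a
  vertex already visited. This is why an open self-avoiding path of length n costs exactly p ^
  n.\<close>

lemma distinct_steps:
  "x \<in> carrier G \<Longrightarrow> set w \<subseteq> S \<Longrightarrow> distinct (x # verts x w) \<Longrightarrow> distinct (steps x w)"
proof (induction w arbitrary: x)
  case (Cons s w)
  have s: "s \<in> S" "x \<otimes> r s \<in> carrier G" using Cons.prems r_closed by auto
  have "\<iota> x (x \<otimes> r s) \<notin> set (steps (x \<otimes> r s) w)"
  proof
    assume *: "\<iota> x (x \<otimes> r s) \<in> set (steps (x \<otimes> r s) w)"
    then obtain u t where ut: "u \<in> carrier G" "t \<in> S" "\<iota> x (x \<otimes> r s) = \<iota> u (u \<otimes> r t)"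
      "u \<otimes> r t \<in> set (verts (x \<otimes> r s) w)"
      using steps_verts[OF s(2) _ *] Cons.prems(2) by auto
    then have "x \<otimes> r s = u \<otimes> r t \<or> x = u \<otimes> r t"
      using \<iota>_eq[OF Cons.prems(1) ut(1) s(1) ut(2,3)] by blast
    then show False using ut Cons.prems by auto
  qed
  then show ?case using Cons s by auto
qed auto

lemma distinct_verts_adj:
  "x \<in> carrier G \<Longrightarrow> set w \<subseteq> S \<Longrightarrow> distinct (x # verts x w) \<Longrightarrow> distinct_adj w"
proof (induction w arbitrary: x)
  case (Cons s w)
  have "distinct_adj w" using Cons.IH[of "x \<otimes> r s"] Cons.prems r_closed by auto
  moreover have "s \<noteq> t" if "w = t # w'" for t w'
    using Cons.prems that by auto
  ultimately show ?case by (cases w) auto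
qed auto

lemma verts_suffix:
  "z \<in> set (verts x w) \<Longrightarrow> \<exists>u v. w = u @ v \<and> act x u = z \<and> (\<exists>l. verts x w = l @ [z] @ verts z v)
    \<and> set (steps z v) \<subseteq> set (steps x w)"
proof (induction w arbitrary: x)
  case (Cons s w)
  show ?case
  proof (cases "z = x \<otimes> r s")
    case True
    then show ?thesis by (intro exI[of _ "[s]"] exI[of _ w]) auto
  next
    case False
    then have "z \<in> set (verts (x \<otimes> r s) w)" using Cons.prems by simp
    from Cons.IH[OF this] obtain u v l where
      "w = u @ v" "act (x \<otimes> r s) u = z" "verts (x \<otimes> r s) w = l @ [z] @ verts z v"
      "set (steps z v) \<subseteq> set (steps (x \<otimes> r s) w)" by blast
    then show ?thesis
      by (intro exI[of _ "s # u"] exI[of _ v]) auto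
  qed
qed auto

lemma ex_open_path:
  assumes "(x, y) \<in> (E \<omega>)\<^sup>*" "x \<in> carrier G"
  shows "\<exists>w. set w \<subseteq> S \<and> act x w = y \<and> distinct (x # verts x w) \<and> (\<forall>i\<in>set (steps x w). \<omega> i)"
  using assms
proof (induction rule: converse_rtrancl_induct)
  case base
  show ?case by (rule exI[of _ "[]"]) auto
next
  case (step x z)
  obtain s where s: "s \<in> S" "z = x \<otimes> r s" "\<omega> (\<iota> x z)" using E_step[OF step.hyps(1)] by blast
  have "z \<in> carrier G" using step.hyps E_carrier by blast
  then obtain w where w: "set w \<subseteq> S" "act z w = y" "distinct (z # verts z w)"
    "\<forall>i\<in>set (steps z w). \<omega> i" using step.IH by blast
  show ?case
  proof (cases "x \<in> set (z # verts z w)")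
    case False
    then show ?thesis using w s by (intro exI[of _ "s # w"]) auto
  next
    \<comment> \<open>Loop erasure: if the path from \<open>z\<close> returns to \<open>x\<close>,
      only its part after that visit is kept.\<close>
    case True
    have "z \<noteq> x" using in_D_step_iff[OF step.prems s(1)] s(2) by auto
    then have "x \<in> set (verts z w)" using True by simp
    then obtain u v l where uv: "w = u @ v" "act z u = x" "verts z w = l @ [x] @ verts x v"
      "set (steps x v) \<subseteq> set (steps z w)" using verts_suffix by blast
    then show ?thesis using w by (intro exI[of _ v]) (auto simp: act_append)
  qed
qed

text \<open>Walks to \<open>\<one>\<close> without backtracking; the letter \<open>s\<close> is the one just read.\<close>

definition walks :: "nat \<Rightarrow> 'a \<Rightarrow> 's \<Rightarrow> 's list set" where
  "walks n x s = {w. length w = n \<and> set w \<subseteq> S \<and> distinct_adj (s # w) \<and> act x w = \<one>}"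

lemma finite_words: "finite {w. length w = n \<and> set w \<subseteq> S}"
  using finite_lists_length_eq[OF finite_S, of n] by (simp add: conj_commute)

lemma finite_walks: "finite (walks n x s)"
  by (rule finite_subset[OF _ finite_words[of n]]) (auto simp: walks_def)

text \<open>The weight \<open>decay ^ len x\<close>, with the factor \<open>6 / 5\<close> if the last step did not go up,
  approximates the Perron vector of the transfer matrix of non-backtracking walks between elements
  with three descents. Its eigenvalue is \<open>sqrt (3 k - 9) + sqrt (2 k - 8)\<close>, which is
  below \<open>2 k / 3\<close> for \<open>k \<ge> 18\<close>.\<close>

definition \<mu> :: real where "\<mu> = 2 / 3 * card S + 1 / 4"

text \<open>Near the optimal value at k = 18. Taking it proportional to 1 / k leaves inequalities
  that are linear in k up to multiples of 1 / k.\<close>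

definition decay :: real where "decay = 8 / card S"

lemma decay_bounds: "0 < decay" "decay < 1"
  using card_S by (auto simp: decay_def)

text \<open>A step down weighs more than a step up, so d = 3 is the worst case. The missing letter
  is the one just read: a descent in the first inequality, not a descent in the second.\<close>

lemma step_weight_le:
  fixes d k :: real
  assumes "d \<le> 3" "k \<ge> 18"
  shows "(d - 1) * (6 / 5 * (k / 8)) + (k - d) * (8 / k) \<le> 2 / 3 * k + 1 / 4"
    and "d * (6 / 5 * (k / 8)) + (k - d - 1) * (8 / k) \<le> (2 / 3 * k + 1 / 4) * (6 / 5)"
proof -
  have c: "6 / 5 * (k / 8) - 8 / k \<ge> 0"
  proof -
    have "8 / k \<le> 1" "1 \<le> 6 / 5 * (k / 8)" using assms by simp_all
    then show ?thesis by linarith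
  qed
  have "d * (6 / 5 * (k / 8) - 8 / k) \<le> 3 * (6 / 5 * (k / 8) - 8 / k)"
    using assms(1) c by (rule mult_right_mono)
  moreover have "(k - d) * (8 / k) = 8 - d * (8 / k)" "(k - d - 1) * (8 / k) = 8 - d * (8 / k) - 8 / k"
    using assms by (simp_all add: field_simps)
  \<comment> \<open>The tangent of 24 / k at k = 18 makes the remaining inequalities linear.\<close>
  moreover have "24 / k \<ge> 24 * (1 / 9 - k / 324)"
  proof -
    have "0 \<le> (k - 18)\<^sup>2" by simp
    then have "36 * k - k\<^sup>2 \<le> 324" by (simp add: power2_eq_square algebra_simps)
    then show ?thesis using assms by (simp add: field_simps power2_eq_square)
  qed
  moreover have "8 / k > 0" "24 / k = 3 * (8 / k)" using assms by simp_all
  ultimately show "(d - 1) * (6 / 5 * (k / 8)) + (k - d) * (8 / k) \<le> 2 / 3 * k + 1 / 4"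
    "d * (6 / 5 * (k / 8)) + (k - d - 1) * (8 / k) \<le> (2 / 3 * k + 1 / 4) * (6 / 5)"
    using assms(2) unfolding left_diff_distrib right_diff_distrib distrib_right by linarith+
qed

lemma card_walks_le:
  "x \<in> carrier G \<Longrightarrow> s \<in> S \<Longrightarrow>
    card (walks n x s) \<le> \<mu> ^ n * decay ^ len x * (if s \<in> D x then 1 else 6 / 5)"
proof (induction n arbitrary: x s)
  case 0
  show ?case
  proof (cases "x = \<one>")
    case True
    then have "walks 0 x s = {[]}" by (auto simp: walks_def)
    then show ?thesis using True by (simp add: len_one D_one)
  next
    case False
    then have "walks 0 x s = {}" by (auto simp: walks_def)
    then show ?thesis using decay_bounds by auto
  qed
next
  case (Suc n)
  \<comment> \<open>The ratio of the weights after and before reading \<open>t\<close>: the letter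
    of a step up is a descent afterwards and gets no extra factor, that of a step down does.\<close>
  define f where "f t = (if t \<in> D x then 6 / 5 * (1 / decay) else decay)" for t
  have \<mu>: "\<mu> \<ge> 0" by (simp add: \<mu>_def)
  have fin: "finite (D x)" by (rule finite_subset[OF D_subset[OF Suc.prems(1)] finite_S])
  have step: "card (walks n (x \<otimes> r t) t) \<le> \<mu> ^ n * decay ^ len x * f t" if t: "t \<in> S" for t
  proof -
    have "card (walks n (x \<otimes> r t) t) \<le> \<mu> ^ n * decay ^ len (x \<otimes> r t) * (if t \<in> D (x \<otimes> r t) then 1 else 6 / 5)"
      using Suc t r_closed by (intro Suc.IH) auto
    also have "\<dots> = \<mu> ^ n * decay ^ len x * f t"
    proof (cases "t \<in> D x")
      case True
      then have "len x = Suc (len (x \<otimes> r t))" using len_down Suc.prems by simp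
      then show ?thesis using True t Suc.prems decay_bounds by (simp add: f_def in_D_step_iff)
    next
      case False
      then show ?thesis using t Suc.prems by (simp add: f_def in_D_step_iff len_up)
    qed
    finally show ?thesis .
  qed
  have "walks (Suc n) x s \<subseteq> (\<Union>t\<in>S - {s}. (#) t ` walks n (x \<otimes> r t) t)"
  proof
    fix w assume w: "w \<in> walks (Suc n) x s"
    then obtain t v where "w = t # v" by (cases w) (auto simp: walks_def)
    then show "w \<in> (\<Union>t\<in>S - {s}. (#) t ` walks n (x \<otimes> r t) t)" using w by (auto simp: walks_def)
  qed
  then have "card (walks (Suc n) x s) \<le> card (\<Union>t\<in>S - {s}. (#) t ` walks n (x \<otimes> r t) t)"
    using finite_S by (intro card_mono) (auto simp: finite_walks)
  also have "\<dots> \<le> (\<Sum>t\<in>S - {s}. card ((#) t ` walks n (x \<otimes> r t) t))"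
    using finite_S by (intro card_UN_le) auto
  also have "\<dots> = (\<Sum>t\<in>S - {s}. card (walks n (x \<otimes> r t) t))"
    by (intro sum.cong card_image) auto
  finally have "real (card (walks (Suc n) x s)) \<le> (\<Sum>t\<in>S - {s}. real (card (walks n (x \<otimes> r t) t)))"
    unfolding of_nat_sum[symmetric] of_nat_le_iff .
  also have "\<dots> \<le> (\<Sum>t\<in>S - {s}. \<mu> ^ n * decay ^ len x * f t)" using step by (intro sum_mono) auto
  also have "\<dots> = \<mu> ^ n * decay ^ len x * (\<Sum>t\<in>S - {s}. f t)" by (simp add: sum_distrib_left)
  also have "\<dots> \<le> \<mu> ^ n * decay ^ len x * (\<mu> * (if s \<in> D x then 1 else 6 / 5))"
  proof (intro mult_left_mono)
    define k where "k = real (card S)"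
    define d where "d = real (card (D x))"
    have split1: "(d - 1) * A + (k - d) * B = d * A + (k - d) * B - A"
      and split2: "d * A + (k - d - 1) * B = d * A + (k - d) * B - B" for A B :: real
      by (simp_all add: algebra_simps)
    have k: "k \<ge> 18" using card_S by (simp add: k_def)
    have d: "d \<le> 3" using card_D Suc.prems by (simp add: d_def)
    have "(\<Sum>t\<in>S. f t) = (\<Sum>t\<in>D x. f t) + (\<Sum>t\<in>S - D x. f t)"
      using sum.subset_diff[OF D_subset[OF Suc.prems(1)] finite_S, of f] by simp
    also have "(\<Sum>t\<in>D x. f t) = d * (6 / 5 * (k / 8))"
      by (simp add: f_def decay_def d_def k_def)
    also have "(\<Sum>t\<in>S - D x. f t) = (k - d) * (8 / k)"
      using finite_S D_subset[of x] Suc.prems fin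
      by (simp add: f_def decay_def d_def k_def card_Diff_subset of_nat_diff card_mono)
    finally have tot: "(\<Sum>t\<in>S. f t) = d * (6 / 5 * (k / 8)) + (k - d) * (8 / k)" .
    have "(\<Sum>t\<in>S - {s}. f t) = (\<Sum>t\<in>S. f t) - f s"
      using finite_S Suc.prems by (simp add: sum_diff1)
    also have "\<dots> \<le> \<mu> * (if s \<in> D x then 1 else 6 / 5)"
    proof (cases "s \<in> D x")
      case True
      then have "f s = 6 / 5 * (k / 8)" by (simp add: f_def decay_def k_def)
      then show ?thesis using step_weight_le(1)[OF d k] True
        by (simp only: tot \<mu>_def k_def[symmetric] split1) simp
    next
      case False
      then have "f s = 8 / k" by (simp add: f_def decay_def k_def)
      then show ?thesis using step_weight_le(2)[OF d k] False
        by (simp only: tot \<mu>_def k_def[symmetric] split2) simp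
    qed
    finally show "(\<Sum>t\<in>S - {s}. f t) \<le> \<mu> * (if s \<in> D x then 1 else 6 / 5)" .
  qed (use \<mu> decay_bounds in auto)
  finally show ?case by (simp add: mult_ac)
qed

definition words :: "nat \<Rightarrow> 'a \<Rightarrow> 's list set" where
  "words n x = {w. length w = n \<and> set w \<subseteq> S \<and> distinct_adj w \<and> act x w = \<one>}"

lemma card_words_le:
  assumes x: "x \<in> carrier G"
  shows "card (words n x) \<le> 6 / 5 * card S * (\<mu> ^ n * decay ^ len x)"
proof -
  have "words n x \<subseteq> (\<Union>s\<in>S. walks n x s)"
  proof
    fix w assume w: "w \<in> words n x"
    \<comment> \<open>Any letter other than the first one of \<open>w\<close> may be taken as the
      letter read before; summing over it costs the factor \<open>card S\<close>.\<close>
    have "\<exists>s\<in>S. w = [] \<or> s \<noteq> hd w"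
    proof (rule ccontr)
      assume "\<not> ?thesis"
      then have "S \<subseteq> {hd w}" by auto
      then have "card S \<le> 1" using card_mono[of "{hd w}" S] by simp
      then show False using card_S by simp
    qed
    then show "w \<in> (\<Union>s\<in>S. walks n x s)"
      using w by (cases w) (auto simp: words_def walks_def)
  qed
  then have "card (words n x) \<le> card (\<Union>s\<in>S. walks n x s)"
    using finite_S by (intro card_mono) (auto simp: finite_walks)
  also have "\<dots> \<le> (\<Sum>s\<in>S. card (walks n x s))" using finite_S by (rule card_UN_le)
  finally have "real (card (words n x)) \<le> (\<Sum>s\<in>S. real (card (walks n x s)))"
    unfolding of_nat_sum[symmetric] of_nat_le_iff .
  also have "\<dots> \<le> (\<Sum>s\<in>S. \<mu> ^ n * decay ^ len x * (6 / 5))"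
  proof (rule sum_mono)
    fix s assume "s \<in> S"
    note card_walks_le[OF x this, of n]
    also have "\<mu> ^ n * decay ^ len x * (if s \<in> D x then 1 else 6 / 5) \<le> \<mu> ^ n * decay ^ len x * (6 / 5)"
      using decay_bounds by (intro mult_left_mono) (auto simp: \<mu>_def)
    finally show "real (card (walks n x s)) \<le> \<mu> ^ n * decay ^ len x * (6 / 5)" .
  qed
  finally show ?thesis by (simp add: mult_ac)
qed

lemma I_nonempty: "I \<noteq> {}"
proof -
  have "S \<noteq> {}" using card_S by auto
  then show ?thesis using \<iota>_I[OF one_closed] by blast
qed

lemma prob_reach_le:
  assumes p: "0 \<le> p" "p \<le> 1" "p * \<mu> < 1" and xy: "x \<in> carrier G" "y \<in> carrier G"
  shows "measure (M p) {\<omega> \<in> space (M p). (x, y) \<in> (E \<omega>)\<^sup>*}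
    \<le> 6 / 5 * card S / (1 - p * \<mu>) * decay ^ len (inv y \<otimes> x)"
proof -
  interpret prob_space "M p" by (rule prob_space_bernoulli)
  \<comment> \<open>Left translation by \<open>inv y\<close> moves the endpoint to
    \<open>\<one>\<close>, where walks have been counted. What follows is a union bound over
    self-avoiding paths by length, a convergent geometric series as
    \<open>p * \<mu> < 1\<close>.\<close>
  define h where "h = inv y \<otimes> x"
  have h: "h \<in> carrier G" using xy by (simp add: h_def)
  define c where "c = 6 / 5 * card S * decay ^ len h"
  define W where "W n = {w. length w = n \<and> set w \<subseteq> S \<and> act x w = y \<and> distinct (x # verts x w)}" for n
  have fW: "finite (W n)" for n by (rule finite_subset[OF _ finite_words[of n]]) (auto simp: W_def)
  have "W n \<subseteq> words n h" for n
  proof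
    fix w assume w: "w \<in> W n"
    then have "act h w = inv y \<otimes> act x w" unfolding h_def using xy by (intro act_mult) (auto simp: W_def)
    then show "w \<in> words n h" using w xy distinct_verts_adj[of x w] by (auto simp: W_def words_def)
  qed
  moreover have "finite (words n h)" for n
    by (rule finite_subset[OF _ finite_words[of n]]) (auto simp: words_def)
  ultimately have "real (card (W n)) \<le> c * \<mu> ^ n" for n
    using card_words_le[OF h, of n] card_mono[of "words n h" "W n"] by (simp add: c_def mult_ac)
  then have cW: "real (card (W n)) * p ^ n \<le> c * (p * \<mu>) ^ n" for n
    using p mult_right_mono[of "real (card (W n))" "c * \<mu> ^ n" "p ^ n"] by (simp add: power_mult_distrib mult_ac)
  define A where "A w = {\<omega> \<in> space (M p). \<forall>i\<in>set (steps x w). \<omega> i}" for w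
  define B where "B n = (\<Union>w\<in>W n. A w)" for n
  have A: "A w \<in> sets (M p)" if "w \<in> W n" for w n
  proof -
    have "set (steps x w) \<subseteq> I" using that xy by (intro steps_I) (auto simp: W_def)
    then show ?thesis
      unfolding A_def by (intro sets.sets_Collect_finite_All sets_bernoulli_coord) auto
  qed
  have B: "B n \<in> sets (M p)" for n unfolding B_def using A fW by (intro sets.finite_UN) auto
  have pB: "prob (B n) \<le> c * (p * \<mu>) ^ n" for n
  proof -
    have "prob (B n) \<le> (\<Sum>w\<in>W n. prob (A w))"
      unfolding B_def using fW A by (intro finite_measure_subadditive_finite) auto
    also have "\<dots> = (\<Sum>w\<in>W n. p ^ n)"
    proof (rule sum.cong)
      fix w assume w: "w \<in> W n"
      have "card (set (steps x w)) = n"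
        using w xy distinct_steps[of x w] distinct_card[of "steps x w"] by (simp add: W_def)
      then show "prob (A w) = p ^ n"
        unfolding A_def using prob_all_open[of "set (steps x w)" I p] steps_I[of x w] w xy p I_nonempty
        by (auto simp: W_def)
    qed simp
    also have "\<dots> \<le> c * (p * \<mu>) ^ n" using cW by simp
    finally show ?thesis .
  qed
  have \<mu>: "0 \<le> p * \<mu>" using p by (simp add: \<mu>_def)
  have sums: "(\<lambda>n. c * (p * \<mu>) ^ n) sums (c * (1 / (1 - p * \<mu>)))"
    using p(3) \<mu> by (intro sums_mult geometric_sums) simp
  have summ: "summable (\<lambda>n. prob (B n))"
    by (rule summable_comparison_test_ev[OF _ sums_summable[OF sums]]) (use pB in auto)
  have "{\<omega> \<in> space (M p). (x, y) \<in> (E \<omega>)\<^sup>*} \<subseteq> (\<Union>n. B n)"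
  proof safe
    fix \<omega> assume \<omega>: "\<omega> \<in> space (M p)" "(x, y) \<in> (E \<omega>)\<^sup>*"
    obtain w where w: "set w \<subseteq> S" "act x w = y" "distinct (x # verts x w)" "\<forall>i\<in>set (steps x w). \<omega> i"
      using ex_open_path[OF \<omega>(2) xy(1)] by blast
    then have "\<omega> \<in> B (length w)" using \<omega> unfolding B_def A_def W_def by blast
    then show "\<omega> \<in> (\<Union>n. B n)" by blast
  qed
  then have "prob {\<omega> \<in> space (M p). (x, y) \<in> (E \<omega>)\<^sup>*} \<le> prob (\<Union>n. B n)"
    using B by (intro finite_measure_mono) auto
  also have "\<dots> \<le> (\<Sum>n. prob (B n))"
    using B summ by (intro finite_measure_subadditive_countably) auto
  also have "\<dots> \<le> (\<Sum>n. c * (p * \<mu>) ^ n)"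
    using pB summ sums_summable[OF sums] by (intro suminf_le) auto
  also have "\<dots> = c * (1 / (1 - p * \<mu>))" using sums by (rule sums_unique[symmetric])
  finally show ?thesis by (simp add: c_def h_def)
qed

section \<open>Excluding a unique infinite cluster\<close>

lemma ex_len: "\<exists>x\<in>carrier G. len x = n"
proof (induction n)
  case (Suc n)
  then obtain x where x: "x \<in> carrier G" "len x = n" by blast
  have "\<not> S \<subseteq> D x"
  proof
    assume "S \<subseteq> D x"
    then have "D x = S" using D_subset[OF x(1)] by blast
    then show False using card_D[OF x(1)] card_S by simp
  qed
  then obtain s where "s \<in> S" "s \<notin> D x" by blast
  then show ?case using x len_up r_closed by (intro bexI[of _ "x \<otimes> r s"]) auto
qed (use len_one in auto)

text \<open>Points far apart are connected with small probability. If there were a unique infinite cluster,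
  many such points would lie in it with probability bounded below, contradicting Bonferroni's
  inequality. This avoids the correlation inequality.\<close>

lemma not_unique:
  assumes p: "0 \<le> p" "p \<le> 1" "p * \<mu> < 1"
  shows "\<not> (AE \<omega> in M p. \<exists>!C. C \<in> connected_components (sub \<omega>) \<and> infinite C)"
proof
  interpret prob_space "M p" by (rule prob_space_bernoulli)
  assume AE: "AE \<omega> in M p. \<exists>!C. C \<in> connected_components (sub \<omega>) \<and> infinite C"
  define \<theta> where "\<theta> = prob {\<omega> \<in> space (M p). in_infinite \<omega> \<one>}"
  have "\<theta> \<noteq> 0"
  proof
    assume "\<theta> = 0"
    then have "AE \<omega> in M p. \<not> in_infinite \<omega> x" if "x \<in> carrier G" for x
      using prob_in_infinite[OF that, of p] in_infinite_sets[OF that, of p]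
      by (intro AE_I'[of "{\<omega> \<in> space (M p). in_infinite \<omega> x}"])
        (auto simp: \<theta>_def null_sets_def emeasure_eq_measure)
    then have "AE \<omega> in M p. \<forall>x\<in>carrier G. \<not> in_infinite \<omega> x"
      by (intro AE_ball_countable' countable_carrier)
    with AE have "AE \<omega> in M p. False"
    proof eventually_elim
      case (elim \<omega>)
      then show False using ex1_infinite_componentD(1)[OF elim(1)] by blast
    qed
    then show False by (simp add: AE_False)
  qed
  then have "\<theta> > 0" using measure_nonneg[of "M p"] by (simp add: \<theta>_def less_le)
  \<comment> \<open>With \<open>N * \<theta> > 2\<close> and a total of less than 1 for the pairs,
    Bonferroni gives a probability above 1.\<close>
  obtain N :: nat where N: "2 / \<theta> < N" using reals_Archimedean2 by blast
  then have N\<theta>: "N * \<theta> > 2" using \<open>\<theta> > 0\<close> by (simp add: field_simps)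
  define C where "C = 6 / 5 * card S / (1 - p * \<mu>)"
  have C: "C \<ge> 0" using p by (simp add: C_def)
  have "(\<lambda>L. real N * real N * C * decay ^ L) \<longlonglongrightarrow> real N * real N * C * 0"
    using decay_bounds by (intro tendsto_intros LIMSEQ_realpow_zero) auto
  then have "eventually (\<lambda>L. real N * real N * C * decay ^ L < 1) sequentially"
    by (intro order_tendstoD(2)) auto
  then obtain L where L: "real N * real N * C * decay ^ L < 1" by (auto simp: eventually_sequentially)
  \<comment> \<open>Lengths in multiples of \<open>L\<close> keep the points at mutual distance at
    least \<open>L\<close> by the triangle inequality.\<close>
  have "\<exists>x. \<forall>i. x i \<in> carrier G \<and> len (x i) = i * L" using ex_len by (intro choice) blast
  then obtain x where x: "\<And>i. x i \<in> carrier G" "\<And>i. len (x i) = i * L" by blast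
  define A where "A i = {\<omega> \<in> space (M p). in_infinite \<omega> (x i)}" for i
  have A: "A i \<in> sets (M p)" for i unfolding A_def using x by (intro in_infinite_sets)
  have pA: "prob (A i) = \<theta>" for i unfolding A_def \<theta>_def using x by (intro prob_in_infinite)
  have pair: "prob (A i \<inter> A j) \<le> C * decay ^ L" if "i < j" for i j
  proof -
    have "len (x j) \<le> len (x i) + len (inv (x i) \<otimes> x j)"
      using len_mult_le[of "x i" "inv (x i) \<otimes> x j"] x by (simp flip: m_assoc)
    moreover have "Suc i * L \<le> j * L" using that by (intro mult_right_mono) auto
    ultimately have far: "L \<le> len (inv (x i) \<otimes> x j)" using x(2) by simp
    have "prob (A i \<inter> A j) \<le> prob {\<omega> \<in> space (M p). (x j, x i) \<in> (E \<omega>)\<^sup>*}"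
    proof (rule finite_measure_mono_AE)
      show "AE \<omega> in M p. \<omega> \<in> A i \<inter> A j \<longrightarrow> \<omega> \<in> {\<omega> \<in> space (M p). (x j, x i) \<in> (E \<omega>)\<^sup>*}"
        using AE
      proof eventually_elim
        case (elim \<omega>)
        show ?case using ex1_infinite_componentD(2)[OF elim, of "x j" "x i"] by (simp add: A_def)
      qed
    qed (use x reach_sets in auto)
    also have "\<dots> \<le> C * decay ^ len (inv (x i) \<otimes> x j)"
      unfolding C_def using p x by (intro prob_reach_le)
    also have "\<dots> \<le> C * decay ^ L"
      using far C decay_bounds by (intro mult_left_mono power_decreasing) auto
    finally show ?thesis .
  qed
  have "(\<Sum>j<N. \<Sum>i<j. prob (A i \<inter> A j)) \<le> (\<Sum>j<N. \<Sum>i<j. C * decay ^ L)"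
    using pair by (intro sum_mono) auto
  also have "\<dots> = (\<Sum>j<N. real j * (C * decay ^ L))" by simp
  also have "\<dots> \<le> (\<Sum>j<N. real N * (C * decay ^ L))"
    using C decay_bounds by (intro sum_mono mult_right_mono) auto
  also have "\<dots> < 1" using L by (simp add: mult_ac)
  finally have "(\<Sum>i<N. prob (A i)) - 1 < prob (\<Union>i<N. A i)"
    using Bonferroni[where A = A and n = N, OF A] by linarith
  also have "\<dots> \<le> 1" by simp
  finally show False using N\<theta> by (simp add: pA)
qed

end

section \<open>Percolation on the ShortLex tree\<close>

text \<open>Two uses of 1 + x \<le> exp x. The product is the chance that no child survives, and a
  rational bound in the sum of the survival chances suits the recursion.\<close>

lemma prod_one_minus_le:
  fixes f :: "'x \<Rightarrow> real"
  assumes "finite A" "\<And>x. x \<in> A \<Longrightarrow> 0 \<le> f x \<and> f x \<le> 1"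
  shows "(\<Prod>x\<in>A. 1 - f x) \<le> 1 / (1 + (\<Sum>x\<in>A. f x))"
proof -
  have "(\<Prod>x\<in>A. 1 - f x) \<le> (\<Prod>x\<in>A. exp (- f x))"
    using assms(2) exp_ge_add_one_self[of "- f x" for x] by (intro prod_mono) auto
  also have "\<dots> = exp (- (\<Sum>x\<in>A. f x))"
    using assms(1) by (simp add: exp_sum sum_negf[symmetric])
  also have "\<dots> = 1 / exp (\<Sum>x\<in>A. f x)" by (simp add: exp_minus inverse_eq_divide)
  also have "\<dots> \<le> 1 / (1 + (\<Sum>x\<in>A. f x))"
    using assms(2) sum_nonneg[of A f] exp_ge_add_one_self[of "\<Sum>x\<in>A. f x"]
    by (intro divide_left_mono) auto
  finally show ?thesis .
qed

context coxeter_percolation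
begin

text \<open>The word \<open>w\<close> stands for the last step of its path from \<open>\<one>\<close>.\<close>

definition ind :: "'s list \<Rightarrow> 'i" where
  "ind w = \<iota> (act \<one> (butlast w)) (act \<one> w)"

abbreviation normal :: "'s list \<Rightarrow> bool" where
  "normal w \<equiv> adm S {} w"

lemma normal_S: "normal w \<Longrightarrow> set w \<subseteq> S"
  by (rule adm_set)

lemma normal_snoc: "normal w \<Longrightarrow> s \<in> S - run S {} w \<Longrightarrow> normal (w @ [s])"
  by (simp add: adm_append)

lemma ind_snoc: "ind (w @ [s]) = \<iota> (act \<one> w) (act \<one> w \<otimes> r s)"
  by (simp add: ind_def act_append)

lemma ind_I: "normal w \<Longrightarrow> w \<noteq> [] \<Longrightarrow> ind w \<in> I"
proof -
  assume w: "normal w" "w \<noteq> []"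
  then obtain u s where us: "w = u @ [s]" by (metis rev_exhaust)
  have "s \<in> S" "set u \<subseteq> S" using normal_S[OF w(1)] us by auto
  then show ?thesis unfolding us ind_snoc by (intro \<iota>_I act_closed) auto
qed

text \<open>Normal forms are unique, so steps with the same endpoint come from the same word. A
  variable shared by reverse steps would make each word one letter longer than the other.\<close>

lemma ind_inj:
  assumes "normal w" "normal w'" "w \<noteq> []" "w' \<noteq> []" "ind w = ind w'"
  shows "w = w'"
proof -
  obtain u s where us: "w = u @ [s]" using assms(3) by (metis rev_exhaust)
  obtain v t where vt: "w' = v @ [t]" using assms(4) by (metis rev_exhaust)
  have n: "normal u" "normal v" using assms us vt by (auto simp: adm_append)
  have S: "s \<in> S" "t \<in> S" "set u \<subseteq> S" "set v \<subseteq> S"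
    using normal_S[OF assms(1)] normal_S[OF assms(2)] us vt by auto
  have acts: "act \<one> w = act \<one> u \<otimes> r s" "act \<one> w' = act \<one> v \<otimes> r t"
    by (simp_all add: us vt act_append)
  have "act \<one> w = act \<one> w' \<or> act \<one> u = act \<one> w' \<and> act \<one> v = act \<one> w"
    using \<iota>_eq[of "act \<one> u" "act \<one> v" s t] assms(5) S unfolding us vt ind_snoc
    by (auto simp: act_append)
  then show ?thesis
  proof
    assume "act \<one> w = act \<one> w'"
    then show ?thesis using adm_act_inj[OF subset_refl] assms by blast
  next
    assume "act \<one> u = act \<one> w' \<and> act \<one> v = act \<one> w"
    then have "u = w'" "v = w" using adm_act_inj[OF subset_refl] assms n by blast+
    then have "length u = Suc (length v)" "length v = Suc (length u)" using us vt by auto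
    then show ?thesis by simp
  qed
qed

text \<open>Survival of the subtree at \<open>w\<close> for that many generations. The step into
  \<open>w\<close> itself is not tested, so this event is independent of the variable
  \<open>ind w\<close>.\<close>

primrec extends :: "nat \<Rightarrow> 's list \<Rightarrow> ('i \<Rightarrow> bool) \<Rightarrow> bool" where
  "extends 0 w \<omega> = True"
| "extends (Suc n) w \<omega> \<longleftrightarrow> (\<exists>s\<in>S - run S {} w. \<omega> (ind (w @ [s])) \<and> extends n (w @ [s]) \<omega>)"

definition below :: "'s list \<Rightarrow> 'i set" where
  "below w = {ind (w @ v) | v. v \<noteq> [] \<and> normal (w @ v)}"

lemma below_I: "below w \<subseteq> I"
  by (auto simp: below_def intro: ind_I)

lemma below_snoc:
  assumes "normal w" "s \<in> S - run S {} w"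
  shows "insert (ind (w @ [s])) (below (w @ [s])) \<subseteq> below w"
proof
  fix i assume "i \<in> insert (ind (w @ [s])) (below (w @ [s]))"
  then consider "i = ind (w @ [s])" | v where "i = ind (w @ ([s] @ v))" "normal (w @ ([s] @ v))"
    by (auto simp: below_def)
  then show "i \<in> below w"
    using normal_snoc[OF assms] unfolding below_def by cases blast+
qed

lemma ind_notin_below: "normal w \<Longrightarrow> w \<noteq> [] \<Longrightarrow> ind w \<notin> below w"
  using ind_inj by (fastforce simp: below_def)

lemma below_disjoint:
  assumes "normal w" "s \<in> S - run S {} w" "t \<in> S - run S {} w" "s \<noteq> t"
  shows "insert (ind (w @ [s])) (below (w @ [s])) \<inter> insert (ind (w @ [t])) (below (w @ [t])) = {}"
proof -
  have in_form: "\<exists>v. i = ind (w @ [a] @ v) \<and> normal (w @ [a] @ v)"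
    if "i \<in> insert (ind (w @ [a])) (below (w @ [a]))" "a \<in> S - run S {} w" for i a
  proof (cases "i = ind (w @ [a])")
    case True
    then show ?thesis using normal_snoc[OF assms(1) that(2)] by (intro exI[of _ "[]"]) simp
  next
    case False
    then show ?thesis using that by (auto simp: below_def)
  qed
  show ?thesis
  proof (rule equals0I)
    fix i assume i: "i \<in> insert (ind (w @ [s])) (below (w @ [s])) \<inter> insert (ind (w @ [t])) (below (w @ [t]))"
    obtain u v where "i = ind (w @ [s] @ u)" "normal (w @ [s] @ u)" "i = ind (w @ [t] @ v)" "normal (w @ [t] @ v)"
      using in_form[OF IntD1[OF i] assms(2)] in_form[OF IntD2[OF i] assms(3)] by blast
    then have "w @ [s] @ u = w @ [t] @ v" using ind_inj[of "w @ [s] @ u" "w @ [t] @ v"] by simp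
    then show False using assms(4) by simp
  qed
qed

lemma extends_cong:
  "normal w \<Longrightarrow> (\<And>i. i \<in> below w \<Longrightarrow> \<omega> i = \<omega>' i) \<Longrightarrow> extends n w \<omega> \<Longrightarrow> extends n w \<omega>'"
proof (induction n arbitrary: w)
  case (Suc n)
  obtain s where s: "s \<in> S - run S {} w" "\<omega> (ind (w @ [s]))" "extends n (w @ [s]) \<omega>"
    using Suc.prems(3) by auto
  note sub = below_snoc[OF Suc.prems(1) s(1)]
  have "extends n (w @ [s]) \<omega>'"
    using sub Suc.prems(2) by (intro Suc.IH[OF normal_snoc[OF Suc.prems(1) s(1)] _ s(3)]) blast
  moreover have "\<omega>' (ind (w @ [s]))" using sub Suc.prems(2) s(2) by blast
  ultimately show ?case using s(1) by auto
qed simp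

lemma extends_sets: "normal w \<Longrightarrow> {\<omega> \<in> space (M p). extends n w \<omega>} \<in> sets (M p)"
proof (induction n arbitrary: w)
  case (Suc n)
  have "{\<omega> \<in> space (M p). \<omega> (ind (w @ [s])) \<and> extends n (w @ [s]) \<omega>} \<in> sets (M p)"
    if s: "s \<in> S - run S {} w" for s
    using Suc.IH[OF normal_snoc[OF Suc.prems s]] ind_I[OF normal_snoc[OF Suc.prems s]]
    by (intro sets.sets_Collect_conj sets_bernoulli_coord) auto
  then show ?case
    unfolding extends.simps using finite_S by (intro sets.sets_Collect_finite_Ex) auto
qed simp

lemma extends_mono: "extends (Suc n) w \<omega> \<Longrightarrow> extends n w \<omega>"
proof (induction n arbitrary: w)
  case (Suc n)
  from Suc.prems obtain s where "s \<in> S - run S {} w" "\<omega> (ind (w @ [s]))" "extends (Suc n) (w @ [s]) \<omega>"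
    unfolding extends.simps(2)[of "Suc n"] by blast
  moreover from this(3) have "extends n (w @ [s]) \<omega>" by (rule Suc.IH)
  ultimately show ?case unfolding extends.simps(2)[of n] by blast
qed simp

lemma extends_path:
  "normal w \<Longrightarrow> extends n w \<omega> \<Longrightarrow> act \<one> w \<in> V \<omega> \<Longrightarrow>
    \<exists>y. (act \<one> w, y) \<in> (E \<omega>)\<^sup>* \<and> len y = length w + n"
proof (induction n arbitrary: w)
  case 0
  have "len (act \<one> w) = length w"
    using len_ascending[OF one_closed adm_ascending[OF one_closed subset_refl _ 0(1)]]
    by (simp add: len_one D_one)
  then show ?case by auto
next
  case (Suc n)
  obtain s where s: "s \<in> S - run S {} w" "\<omega> (ind (w @ [s]))" "extends n (w @ [s]) \<omega>"
    using Suc.prems(2) by auto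
  have step: "(act \<one> w, act \<one> (w @ [s])) \<in> E \<omega>"
    using E_I[OF Suc.prems(3), of s] s by (simp add: ind_snoc act_append)
  then have "act \<one> (w @ [s]) \<in> V \<omega>" using E_step by blast
  then obtain y where "(act \<one> (w @ [s]), y) \<in> (E \<omega>)\<^sup>*" "len y = length (w @ [s]) + n"
    using Suc.IH[OF normal_snoc[OF Suc.prems(1) s(1)] s(3)] by blast
  then show ?case using step by (intro exI[of _ y]) (auto intro: converse_rtrancl_into_rtrancl)
qed

section \<open>Survival probabilities\<close>

lemma prob_open_extends:
  assumes p: "p \<in> {0..1}" and w: "normal w" "w \<noteq> []"
  shows "measure (M p) {\<omega> \<in> space (M p). \<omega> (ind w) \<and> extends n w \<omega>}
    = p * measure (M p) {\<omega> \<in> space (M p). extends n w \<omega>}"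
proof -
  define A where "A b = (if b then {\<omega> \<in> space (M p). \<omega> (ind w)} else {\<omega> \<in> space (M p). extends n w \<omega>})" for b
  define K where "K b = (if b then {ind w} else below w)" for b
  have "measure (M p) (\<Inter>b\<in>UNIV. A b) = (\<Prod>b\<in>UNIV. measure (M p) (A b))"
  proof (rule prob_INT_independent[where K = K])
    show "disjoint_family_on K UNIV"
      using ind_notin_below[OF w] by (auto simp: disjoint_family_on_def K_def)
    show "K b \<subseteq> I" for b using ind_I[OF w] below_I by (auto simp: K_def)
    show "A b \<in> sets (M p)" for b
      using extends_sets[OF w(1)] sets_bernoulli_coord[OF ind_I[OF w]] by (auto simp: A_def)
    show "depends_on (A b) I (K b)" for b
    proof (cases b)
      case False
      show ?thesis
        unfolding depends_on_def
      proof (intro ballI impI)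
        fix \<omega> \<omega>' assume \<omega>: "\<omega> \<in> (\<Pi>\<^sub>E i\<in>I. UNIV)" "\<omega>' \<in> (\<Pi>\<^sub>E i\<in>I. UNIV)"
          "\<forall>i\<in>K b. \<omega> i = \<omega>' i" "\<omega> \<in> A b"
        then have "extends n w \<omega>'"
          using extends_cong[OF w(1), of \<omega> \<omega>' n] False by (simp add: A_def K_def)
        then show "\<omega>' \<in> A b" using \<omega>(2) False by (simp add: A_def space_bernoulli)
      qed
    qed (auto simp: depends_on_def A_def K_def space_bernoulli)
  qed (use I_nonempty in auto)
  also have "(\<Inter>b\<in>UNIV. A b) = {\<omega> \<in> space (M p). \<omega> (ind w) \<and> extends n w \<omega>}"
    by (auto simp: A_def UNIV_bool)
  also have "(\<Prod>b\<in>UNIV. measure (M p) (A b)) = p * measure (M p) {\<omega> \<in> space (M p). extends n w \<omega>}"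
    using prob_bernoulli_coord[OF ind_I[OF w] p] by (simp add: A_def UNIV_bool)
  finally show ?thesis .
qed

text \<open>The recursion of a branching process: subtrees of different children use disjoint sets
  of variables, so their failures are independent.\<close>

lemma prob_extends_Suc:
  assumes p: "p \<in> {0..1}" and w: "normal w"
  shows "measure (M p) {\<omega> \<in> space (M p). extends (Suc n) w \<omega>}
    = 1 - (\<Prod>s\<in>S - run S {} w. 1 - p * measure (M p) {\<omega> \<in> space (M p). extends n (w @ [s]) \<omega>})"
proof -
  interpret prob_space "M p" by (rule prob_space_bernoulli)
  let ?L = "S - run S {} w"
  define F where "F s = {\<omega> \<in> space (M p). \<omega> (ind (w @ [s])) \<and> extends n (w @ [s]) \<omega>}" for s
  define K where "K s = insert (ind (w @ [s])) (below (w @ [s]))" for s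
  have F: "F s \<in> sets (M p)" if s: "s \<in> ?L" for s
    unfolding F_def using extends_sets[OF normal_snoc[OF w s]] ind_I[OF normal_snoc[OF w s]]
    by (intro sets.sets_Collect_conj sets_bernoulli_coord) auto
  have pF: "prob (F s) = p * prob {\<omega> \<in> space (M p). extends n (w @ [s]) \<omega>}" if "s \<in> ?L" for s
    unfolding F_def by (rule prob_open_extends[OF p normal_snoc[OF w that]]) simp
  have eq: "{\<omega> \<in> space (M p). extends (Suc n) w \<omega>} = (\<Union>s\<in>?L. F s)" by (auto simp: F_def)
  show ?thesis
  proof (cases "?L = {}")
    case True
    then show ?thesis unfolding eq True by simp
  next
    case False
    have "prob (\<Inter>s\<in>?L. space (M p) - F s) = (\<Prod>s\<in>?L. prob (space (M p) - F s))"
    proof (rule prob_INT_independent[where K = K])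
      show "disjoint_family_on K ?L"
        using below_disjoint[OF w] unfolding disjoint_family_on_def K_def by blast
      show "K s \<subseteq> I" if "s \<in> ?L" for s
        using below_snoc[OF w that] below_I unfolding K_def by blast
      show "space (M p) - F s \<in> sets (M p)" if "s \<in> ?L" for s using F[OF that] by auto
      show "depends_on (space (M p) - F s) I (K s)" if s: "s \<in> ?L" for s
        unfolding depends_on_def
      proof (intro ballI impI)
        fix \<omega> \<omega>' assume \<omega>: "\<omega> \<in> (\<Pi>\<^sub>E i\<in>I. UNIV)" "\<omega>' \<in> (\<Pi>\<^sub>E i\<in>I. UNIV)"
          "\<forall>i\<in>K s. \<omega> i = \<omega>' i" "\<omega> \<in> space (M p) - F s"
        have "\<omega>' \<notin> F s"
        proof
          assume "\<omega>' \<in> F s"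
          then have "\<omega>' (ind (w @ [s]))" "extends n (w @ [s]) \<omega>'" by (auto simp: F_def)
          then have "\<omega> (ind (w @ [s]))" "extends n (w @ [s]) \<omega>"
            using \<omega>(3) extends_cong[OF normal_snoc[OF w s], of \<omega>' \<omega> n] by (auto simp: K_def)
          then show False using \<omega>(4) by (auto simp: F_def)
        qed
        then show "\<omega>' \<in> space (M p) - F s" using \<omega>(2) by (simp add: space_bernoulli)
      qed
    qed (use False finite_S I_nonempty in auto)
    also have "\<dots> = (\<Prod>s\<in>?L. 1 - p * prob {\<omega> \<in> space (M p). extends n (w @ [s]) \<omega>})"
      using F pF by (intro prod.cong) (auto simp: prob_compl)
    also have "(\<Inter>s\<in>?L. space (M p) - F s) = space (M p) - (\<Union>s\<in>?L. F s)" using False by auto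
    also have "prob \<dots> = 1 - prob (\<Union>s\<in>?L. F s)"
      using F finite_S by (intro prob_compl) auto
    finally show ?thesis unfolding eq by simp
  qed
qed

text \<open>Any \<open>u = 1 + tree_growth\<close> with \<open>u * (k - u) \<ge> k * (k + 20) / 12\<close> makes the clique polynomial
  nonpositive; the value chosen also exceeds \<open>1 + \<mu>\<close>.\<close>

definition tree_growth :: real where "tree_growth = 2 / 3 * card S + 1 / 2"

text \<open>The argument t / (1 + t) of the clique polynomial that belongs to growth rate
  \<open>tree_growth\<close>, where t is the reciprocal of the rate.\<close>

definition fugacity :: real where "fugacity = 1 / (1 + tree_growth)"

definition weight :: "'s list \<Rightarrow> real" where
  "weight w = clique_poly nb (run S {} w) fugacity"

lemma clique_poly_nonpos: "clique_poly nb S fugacity \<le> 0"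
proof -
  define k where "k = real (card S)"
  define e where "e = real (card {c \<in> cliques nb S. card c = 2})"
  have k: "k \<ge> 18" using card_S by (simp add: k_def)
  have "12 * card {c \<in> cliques nb S. card c = 2} \<le> card S * (card S + 20)"
    using card_edge_cliques[of S nb] sum_degree_le[of S nb] finite_S nb_sym nb_irrefl card_common
    by (simp add: mult.assoc[symmetric])
  then have "real (12 * card {c \<in> cliques nb S. card c = 2}) \<le> real (card S * (card S + 20))"
    by (rule of_nat_mono)
  then have e: "12 * e \<le> k * (k + 20)" by (simp add: e_def k_def)
  define u where "u = 1 + tree_growth"
  have u: "u = 2 / 3 * k + 3 / 2" "u > 0" using k by (simp_all add: u_def tree_growth_def k_def)
  \<comment> \<open>The bound k \<ge> 18 enters here: the slack in
    \<open>k * (k + 20) / 12 \<le> u * (k - u)\<close> is this product plus 15 / 4.\<close>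
  have "0 \<le> (k - 18) * (5 / 36 * k + 1 / 3)" using k by simp
  moreover have "u * (k - u) = k * (k + 20) / 12 + (k - 18) * (5 / 36 * k + 1 / 3) + 15 / 4"
    by (simp add: u(1) field_simps)
  ultimately have "k * (k + 20) / 12 \<le> u * (k - u)" by linarith
  moreover have "u * (k - u) = k * u - u * u" by (simp add: algebra_simps)
  ultimately have "u * u - k * u + e \<le> 0" using e by linarith
  then have "(u * u - k * u + e) / (u * u) \<le> 0" using u(2) by (simp add: divide_nonpos_pos)
  also have "(u * u - k * u + e) / (u * u) = 1 - k * fugacity + e * fugacity\<^sup>2"
    using u(2) by (simp add: fugacity_def u_def[symmetric] power2_eq_square field_simps)
  finally have "1 - k * fugacity + e * fugacity\<^sup>2 \<le> 0" .
  moreover have "clique_poly nb S fugacity \<le> 1 - k * fugacity + e * fugacity\<^sup>2"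
    unfolding k_def e_def using finite_S card_clique u(2)
    by (intro clique_poly_le) (auto simp: fugacity_def u_def)
  ultimately show ?thesis by simp
qed

text \<open>For z = \<open>fugacity\<close> the quotient (1 - z) / z is \<open>tree_growth\<close>.
  The telescoping identity then gives equality up to the clique polynomial of \<open>S\<close>,
  whose sign favours the children.\<close>

lemma sum_weight:
  assumes "normal w"
  shows "tree_growth * weight w \<le> (\<Sum>s\<in>S - run S {} w. weight (w @ [s]))"
proof -
  have fugacity: "fugacity > 0" "1 - fugacity = fugacity * tree_growth" by (auto simp: fugacity_def tree_growth_def field_simps add_pos_nonneg)
  have "fugacity * (tree_growth * weight w) = (1 - fugacity) * weight w" using fugacity by simp
  also have "\<dots> \<le> (1 - fugacity) * (clique_poly nb (run S {} w) fugacity - clique_poly nb S fugacity)"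
    using clique_poly_nonpos fugacity by (intro mult_left_mono) (auto simp: weight_def tree_growth_def)
  also have "\<dots> = fugacity * (\<Sum>s\<in>S - run S {} w. clique_poly nb (upd S (run S {} w) s) fugacity)"
    using run_subset[OF subset_refl _ assms] by (intro sum_clique_poly_upd[symmetric]) auto
  also have "\<dots> = fugacity * (\<Sum>s\<in>S - run S {} w. weight (w @ [s]))"
    by (simp add: weight_def run_append)
  finally show ?thesis using fugacity(1) by simp
qed

text \<open>Weights can be negative further down, but the root has weight 1, so those of its
  children have a positive sum.\<close>

lemma ex_weight_pos: "\<exists>s\<in>S. weight [s] > 0"
proof (rule ccontr)
  assume "\<not> ?thesis"
  then have "(\<Sum>s\<in>S. weight [s]) \<le> 0" by (intro sum_nonpos) (auto simp: not_less)
  moreover have "tree_growth \<le> (\<Sum>s\<in>S. weight [s])"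
    using sum_weight[of "[]"] by (simp add: weight_def[of "[]"])
  moreover have "tree_growth > 0" by (simp add: tree_growth_def add_nonneg_pos)
  ultimately show False by simp
qed

text \<open>Induction over generations. With t = \<open>\<epsilon> * weight w\<close> the children's
  chances sum to at least c t for some c > 1, and 1 - 1 / (1 + c t) \<ge> t as long as c t \<le> c -
  1. Nonpositive t need no argument.\<close>

lemma prob_extends_ge:
  assumes p: "p \<in> {0..1}" "p * tree_growth > 1"
  shows "\<exists>\<epsilon>>0. \<forall>n w. normal w \<longrightarrow>
    \<epsilon> * weight w \<le> measure (M p) {\<omega> \<in> space (M p). extends n w \<omega>}"
proof -
  interpret prob_space "M p" by (rule prob_space_bernoulli)
  define c where "c = p * tree_growth"
  define B where "B = 1 + (\<Sum>X\<in>Pow S. \<bar>clique_poly nb X fugacity\<bar>)"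
  \<comment> \<open>Small enough that \<open>\<epsilon> * weight w \<le> (c - 1) / c\<close> for
    every state; \<open>B\<close> bounds all weights, as there are only finitely many
    states.\<close>
  define \<epsilon> where "\<epsilon> = (c - 1) / (c * B)"
  have c: "c > 1" using p by (simp add: c_def)
  have B: "B > 0" unfolding B_def by (intro add_pos_nonneg sum_nonneg) auto
  have \<epsilon>: "\<epsilon> > 0" using c B by (simp add: \<epsilon>_def)
  have wB: "\<epsilon> * weight w \<le> (c - 1) / c" if "normal w" for w
  proof -
    have "run S {} w \<in> Pow S" using run_subset[OF subset_refl _ that] by auto
    then have "\<bar>weight w\<bar> \<le> (\<Sum>X\<in>Pow S. \<bar>clique_poly nb X fugacity\<bar>)"
      unfolding weight_def using finite_S by (intro member_le_sum) auto
    then have "weight w \<le> B" by (simp add: B_def)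
    then have "\<epsilon> * weight w \<le> \<epsilon> * B" using \<epsilon> by (intro mult_left_mono) auto
    also have "\<dots> = (c - 1) / c" using B by (simp add: \<epsilon>_def)
    finally show ?thesis .
  qed
  have "\<epsilon> * weight w \<le> prob {\<omega> \<in> space (M p). extends n w \<omega>}" if "normal w" for n w
    using that
  proof (induction n arbitrary: w)
    case 0
    have "(c - 1) / c \<le> 1" using c by simp
    then show ?case using wB[OF 0] by (simp add: prob_space)
  next
    case (Suc n)
    let ?L = "S - run S {} w"
    define t where "t = \<epsilon> * weight w"
    show ?case
    proof (cases "t \<le> 0")
      case True
      then show ?thesis unfolding t_def by (rule order_trans) (rule measure_nonneg)
    next
      case False
      define f where "f s = p * prob {\<omega> \<in> space (M p). extends n (w @ [s]) \<omega>}" for s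
      have "(\<Sum>s\<in>?L. f s) \<ge> (\<Sum>s\<in>?L. p * (\<epsilon> * weight (w @ [s])))"
        unfolding f_def using p Suc normal_snoc by (intro sum_mono mult_left_mono) auto
      moreover have "(\<Sum>s\<in>?L. p * (\<epsilon> * weight (w @ [s]))) \<ge> c * t"
        using sum_weight[OF Suc.prems] p \<epsilon>
          mult_left_mono[of "tree_growth * weight w" "\<Sum>s\<in>?L. weight (w @ [s])" "p * \<epsilon>"]
        by (simp add: sum_distrib_left c_def t_def mult_ac)
      ultimately have ct: "c * t \<le> (\<Sum>s\<in>?L. f s)" by simp
      have "(\<Prod>s\<in>?L. 1 - f s) \<le> 1 / (1 + (\<Sum>s\<in>?L. f s))"
        using finite_S p by (intro prod_one_minus_le) (auto simp: f_def mult_le_one)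
      also have "\<dots> \<le> 1 / (1 + c * t)" 
      proof (rule divide_left_mono)
        have "c * t > 0" using False c by simp
        then show "0 < (1 + (\<Sum>s\<in>?L. f s)) * (1 + c * t)" using ct by (intro mult_pos_pos) linarith+
      qed (use ct in auto)
      also have "\<dots> \<le> 1 - t"
      proof -
        have "t \<le> (c - 1) / c" using wB[OF Suc.prems] by (simp add: t_def)
        then have "c * t \<le> c - 1" using c by (simp add: field_simps)
        then have "t * (c * t) \<le> t * (c - 1)" using False by (intro mult_left_mono) auto
        then have "1 \<le> (1 - t) * (1 + c * t)" by (simp add: algebra_simps)
        moreover have "1 + c * t > 0" using False c by (simp add: add_pos_nonneg)
        ultimately show ?thesis by (simp add: divide_le_eq)
      qed
      finally show ?thesis
        unfolding prob_extends_Suc[OF p(1) Suc.prems] by (simp add: f_def t_def)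
    qed
  qed
  then show ?thesis using \<epsilon> by blast
qed

lemma prob_ex_infinite_pos:
  assumes p: "p \<in> {0..1}" "p * tree_growth > 1"
  shows "measure (M p) {\<omega> \<in> space (M p). \<exists>C\<in>connected_components (sub \<omega>). infinite C} > 0"
proof -
  interpret prob_space "M p" by (rule prob_space_bernoulli)
  \<comment> \<open>The argument starts one generation below the root: an open step into
    \<open>act \<one> [s]\<close> puts this element into \<open>V \<omega>\<close> by
    \<open>V_I\<close>, whereas \<open>\<one>\<close> itself may be deleted in site
    percolation.\<close>
  obtain s where s: "s \<in> S" "weight [s] > 0" using ex_weight_pos by blast
  have n: "normal [s]" using s by simp
  obtain \<epsilon> where \<epsilon>: "\<epsilon> > 0" "\<And>n w. normal w \<Longrightarrow> \<epsilon> * weight w \<le> prob {\<omega> \<in> space (M p). extends n w \<omega>}"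
    using prob_extends_ge[OF p] by blast
  define A where "A n = {\<omega> \<in> space (M p). \<omega> (ind [s]) \<and> extends n [s] \<omega>}" for n
  have A: "range A \<subseteq> sets (M p)"
    unfolding A_def using extends_sets[OF n] ind_I[OF n]
    by (auto intro!: sets.sets_Collect_conj sets_bernoulli_coord)
  have "decseq A" unfolding A_def using extends_mono by (intro decseq_SucI) blast
  then have lim: "(\<lambda>n. prob (A n)) \<longlonglongrightarrow> prob (\<Inter>n. A n)" using A finite_Lim_measure_decseq by blast
  have "p * (\<epsilon> * weight [s]) \<le> prob (A m)" for m
    unfolding A_def prob_open_extends[OF p(1) n not_Cons_self2[of s "[]"]]
    using p \<epsilon>(2)[OF n] by (intro mult_left_mono) auto
  then have "p * (\<epsilon> * weight [s]) \<le> prob (\<Inter>n. A n)"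
    using lim by (intro LIMSEQ_le_const) auto
  moreover have "p > 0" using p by (cases "p = 0") auto
  ultimately have pos: "0 < prob (\<Inter>n. A n)" using \<epsilon>(1) s(2) by (smt (verit) mult_pos_pos)
  have "(\<Inter>n. A n) \<subseteq> {\<omega> \<in> space (M p). \<exists>C\<in>connected_components (sub \<omega>). infinite C}"
  proof
    fix \<omega> assume "\<omega> \<in> (\<Inter>n. A n)"
    then have \<omega>: "\<omega> \<in> space (M p)" "\<omega> (ind [s])" "\<And>n. extends n [s] \<omega>" by (auto simp: A_def)
    have x: "act \<one> [s] \<in> V \<omega>"
      using V_I[OF one_closed s(1), of \<omega>] \<omega>(2) by (simp add: ind_def)
    \<comment> \<open>Survival for every number of generations puts elements of every positive
      length into this one cluster, without choosing an infinite branch.\<close>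
    have "infinite (cluster \<omega> (act \<one> [s]))"
    proof
      assume fin: "finite (cluster \<omega> (act \<one> [s]))"
      have "\<exists>y\<in>cluster \<omega> (act \<one> [s]). len y = Suc n" for n
        using extends_path[OF n \<omega>(3) x] by (auto simp: cluster_def)
      then have "range Suc \<subseteq> len ` cluster \<omega> (act \<one> [s])"
        by (metis image_eqI image_subsetI)
      then have "finite (range Suc)" using fin finite_surj by blast
      then show False using finite_imageD[of Suc UNIV] by simp
    qed
    moreover have "act \<one> [s] \<in> carrier G" using x V_carrier by blast
    ultimately have "\<exists>x\<in>carrier G. in_infinite \<omega> x" using x unfolding in_infinite_def by blast
    then show "\<omega> \<in> {\<omega> \<in> space (M p). \<exists>C\<in>connected_components (sub \<omega>). infinite C}"
      using \<omega>(1) by (simp add: ex_infinite_component_iff)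
  qed
  then have "prob (\<Inter>n. A n) \<le> prob {\<omega> \<in> space (M p). \<exists>C\<in>connected_components (sub \<omega>). infinite C}"
    by (intro finite_measure_mono ex_infinite_component_sets)
  then show ?thesis using pos by simp
qed

end

section \<open>Bond and site percolation\<close>

context coxeter_percolation
begin

text \<open>At parameter 1 the cluster is the whole group, so the infimum defining
  \<open>uniqueness_prob\<close> is over a nonempty set.\<close>

lemma AE_unique_one: "AE \<omega> in M 1. \<exists>!C. C \<in> connected_components (sub \<omega>) \<and> infinite C"
proof -
  interpret prob_space "M 1" by (rule prob_space_bernoulli)
  have "AE \<omega> in M 1. \<omega> i" if "i \<in> I" for i
  proof -
    have "prob {\<omega> \<in> space (M 1). \<omega> i} = 1" using prob_bernoulli_coord[OF that, of 1] by simp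
    then show ?thesis using sets_bernoulli_coord[OF that, of 1] by (simp add: prob_Collect_eq_1)
  qed
  then have "AE \<omega> in M 1. \<forall>i\<in>I. \<omega> i" by (intro AE_ball_countable' countable_I)
  then show ?thesis
  proof eventually_elim
    case (elim \<omega>)
    obtain s where s: "s \<in> S" using card_S by (metis card.empty equals0I not_numeral_le_zero)
    have V: "x \<in> V \<omega>" if "x \<in> carrier G" for x
      using V_I[of "x \<otimes> r s" s \<omega>] \<iota>_I[of "x \<otimes> r s" s] elim s that r_closed by simp
    have reach: "(x, act x w) \<in> (E \<omega>)\<^sup>*" if "x \<in> carrier G" "set w \<subseteq> S" for x w
      using that
    proof (induction w arbitrary: x)
      case (Cons t w)
      then have "(x, x \<otimes> r t) \<in> E \<omega>" using elim V \<iota>_I by (intro E_I) auto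
      then show ?case
        using Cons.IH[of "x \<otimes> r t"] Cons.prems r_closed by (auto intro: converse_rtrancl_into_rtrancl)
    qed simp
    have cl: "cluster \<omega> x = carrier G" if x: "x \<in> carrier G" for x
    proof (intro equalityI subsetI)
      fix y assume "y \<in> cluster \<omega> x"
      then have "y \<in> V \<omega>" using V[OF x] E_rtrancl_V by (auto simp: cluster_def)
      then show "y \<in> carrier G" using V_carrier by blast
    next
      fix y assume y: "y \<in> carrier G"
      have "inv x \<otimes> y \<in> carrier G" using x y by simp
      then obtain w where w: "set w \<subseteq> S" "inv x \<otimes> y = act \<one> w" using ex_reduced by blast
      have "act x w = x \<otimes> (inv x \<otimes> y)" using act_one[OF x w(1)] w(2) by simp
      also have "\<dots> = y" using x y by (simp flip: m_assoc)
      finally show "y \<in> cluster \<omega> x" using reach[OF x w(1)] by (simp add: cluster_def)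
    qed
    have "infinite (carrier G)"
    proof
      assume "finite (carrier G)"
      moreover have "UNIV \<subseteq> len ` carrier G" using ex_len by (metis image_eqI subsetI)
      ultimately have "finite (UNIV :: nat set)" using finite_surj by blast
      then show False by simp
    qed
    moreover have "connected_components (sub \<omega>) = {carrier G}"
    proof -
      have "V \<omega> = carrier G" using V V_carrier by blast
      then show ?thesis
        unfolding connected_components_eq using cl one_closed by (auto intro: image_eqI[of _ _ \<one>])
    qed
    ultimately show ?case by auto
  qed
qed

theorem critical_prob_less_uniqueness_prob:
  assumes "M' = bernoulli I"
  shows "critical_prob M' sub < uniqueness_prob M' sub"
proof -
  \<comment> \<open>The constant 3 / 8 lies midway between 1 / 4 in \<open>\<mu>\<close> and 1 / 2
    in \<open>tree_growth\<close>.\<close>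
  define q where "q = 1 / (2 / 3 * card S + 3 / 8)"
  have \<mu>: "\<mu> > 0" by (simp add: \<mu>_def add_nonneg_pos)
  have q: "q \<in> {0..1}" "q * tree_growth > 1" "q < 1 / \<mu>"
    using card_S by (auto simp: q_def tree_growth_def \<mu>_def field_simps)
  have "critical_prob M' sub \<le> q"
    unfolding critical_prob_def assms
    by (rule cInf_lower) (use q prob_ex_infinite_pos[OF q(1,2)] in \<open>auto intro: bdd_belowI[of _ 0]\<close>)
  also have "q < 1 / \<mu>" by (rule q)
  also have "1 / \<mu> \<le> uniqueness_prob M' sub"
    unfolding uniqueness_prob_def assms
  proof (rule cInf_greatest)
    show "{p \<in> {0..1}. AE \<omega> in M p. \<exists>!C. C \<in> connected_components (sub \<omega>) \<and> infinite C} \<noteq> {}"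
      using AE_unique_one by (intro ex_in_conv[THEN iffD1] exI[of _ 1]) simp
    fix p assume "p \<in> {p \<in> {0..1}. AE \<omega> in M p. \<exists>!C. C \<in> connected_components (sub \<omega>) \<and> infinite C}"
    then have "\<not> p * \<mu> < 1" using not_unique[of p] by auto
    then show "1 / \<mu> \<le> p" using \<mu> by (simp add: field_simps)
  qed
  finally show ?thesis .
qed

end

section \<open>The Cayley graph and its two percolation models\<close>

context sparse_coxeter
begin

abbreviation \<Gamma> where "\<Gamma> \<equiv> cayley_graph G (r ` S)"

lemma fst_\<Gamma>: "fst \<Gamma> = carrier G"
  by (simp add: cayley_graph_def)

lemma edge_iff: "{x, y} \<in> snd \<Gamma> \<longleftrightarrow> x \<in> carrier G \<and> y \<in> carrier G \<and> (\<exists>s\<in>S. y = x \<otimes> r s)"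
proof -
  have ne: "x \<noteq> x \<otimes> r s" if "x \<in> carrier G" "s \<in> S" for x s
    using in_D_step_iff[OF that] by auto
  have sym: "\<exists>s\<in>S. x = y \<otimes> r s" if "x \<in> carrier G" "s \<in> S" "y = x \<otimes> r s" for x y s
    using that by (intro bexI[of _ s]) auto
  show ?thesis
  proof
    assume "{x, y} \<in> snd \<Gamma>"
    then obtain v w s where "{x, y} = {v, w}" "v \<in> carrier G" "w \<in> carrier G" "s \<in> S" "v = w \<otimes> r s"
      unfolding cayley_graph_def by auto
    then show "x \<in> carrier G \<and> y \<in> carrier G \<and> (\<exists>s\<in>S. y = x \<otimes> r s)"
      using sym[of w s v] by (auto simp: doubleton_eq_iff)
  next
    assume "x \<in> carrier G \<and> y \<in> carrier G \<and> (\<exists>s\<in>S. y = x \<otimes> r s)"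
    then obtain s where s: "x \<in> carrier G" "y \<in> carrier G" "s \<in> S" "y = x \<otimes> r s" by blast
    have "{x, y} = {y, x} \<and> y \<in> carrier G \<and> x \<in> carrier G \<and> y \<noteq> x \<and> (\<exists>s\<in>r ` S. y = x \<otimes> s)"
      using s ne[of x s] by auto
    then show "{x, y} \<in> snd \<Gamma>" unfolding cayley_graph_def snd_conv by blast
  qed
qed

lemma edge_form: "e \<in> snd \<Gamma> \<Longrightarrow> \<exists>x y. e = {x, y}"
  by (auto simp: cayley_graph_def)

lemma edge_translate:
  assumes "g \<in> carrier G" "x \<in> carrier G" "y \<in> carrier G"
  shows "{g \<otimes> x, g \<otimes> y} \<in> snd \<Gamma> \<longleftrightarrow> {x, y} \<in> snd \<Gamma>"
proof -
  have "g \<otimes> y = g \<otimes> x \<otimes> r s \<longleftrightarrow> y = x \<otimes> r s" if "s \<in> S" for s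
    using assms that r_closed by (simp add: m_assoc)
  then show ?thesis using assms by (auto simp: edge_iff)
qed

lemma countable_edges: "countable (snd \<Gamma>)"
proof -
  have "snd \<Gamma> \<subseteq> (\<lambda>(x, y). {x, y}) ` (carrier G \<times> carrier G)"
    by (auto simp: cayley_graph_def)
  then show ?thesis
    by (rule countable_subset) (intro countable_image countable_SIGMA countable_carrier)
qed

lemma bij_translate: "g \<in> carrier G \<Longrightarrow> bij_betw (\<lambda>x. g \<otimes> x) (carrier G) (carrier G)"
  by (rule bij_betwI[where g = "\<lambda>x. inv g \<otimes> x"]) (auto simp flip: m_assoc)

lemma bij_translate_edges:
  assumes g: "g \<in> carrier G"
  shows "bij_betw (\<lambda>e. (\<lambda>x. g \<otimes> x) ` e) (snd \<Gamma>) (snd \<Gamma>)"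
proof (rule bij_betwI[where g = "\<lambda>e. (\<lambda>x. inv g \<otimes> x) ` e"])
  have "(\<lambda>x. h \<otimes> x) ` e \<in> snd \<Gamma>" if h: "h \<in> carrier G" and e: "e \<in> snd \<Gamma>" for h e
  proof -
    obtain x y where xy: "e = {x, y}" using edge_form e by blast
    then have "x \<in> carrier G" "y \<in> carrier G" using e edge_iff by auto
    then show ?thesis using edge_translate[OF h] e xy by simp
  qed
  then show "(\<lambda>e. (\<lambda>x. g \<otimes> x) ` e) \<in> snd \<Gamma> \<rightarrow> snd \<Gamma>" "(\<lambda>e. (\<lambda>x. inv g \<otimes> x) ` e) \<in> snd \<Gamma> \<rightarrow> snd \<Gamma>"
    using g by auto
  fix e assume e: "e \<in> snd \<Gamma>"
  then obtain x y where xy: "e = {x, y}" using edge_form by blast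
  then have "x \<in> carrier G" "y \<in> carrier G" using e edge_iff by auto
  then show "(\<lambda>x. inv g \<otimes> x) ` (\<lambda>x. g \<otimes> x) ` e = e" "(\<lambda>x. g \<otimes> x) ` (\<lambda>x. inv g \<otimes> x) ` e = e"
    using g xy by (simp_all flip: m_assoc)
qed

lemma bond_percolation:
  "coxeter_percolation G S r nb D len (snd \<Gamma>) (\<lambda>x y. {x, y}) (bond_subgraph \<Gamma>)"
proof (unfold_locales, goal_cases)
  \<comment> \<open>Cases 8, 9 and 10 are \<open>V_sets\<close>, \<open>E_sets\<close> and
    \<open>translation\<close>; for the last, translations act on edges as images of sets.\<close>
  case (8 x p)
  then show ?case by (auto simp: bond_subgraph_def fst_\<Gamma>)
next
  case (9 x y p)
  show ?case
    by (cases "{x, y} \<in> snd \<Gamma>") (auto simp: bond_subgraph_def intro: sets_bernoulli_coord)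
next
  case (10 g)
  then show ?case
    using bij_translate_edges[of g] edge_translate[of g]
    by (intro exI[of _ "\<lambda>e. (\<lambda>x. g \<otimes> x) ` e"]) (auto simp: bond_subgraph_def fst_\<Gamma>)
qed (auto simp: countable_edges edge_iff r_closed
    bond_subgraph_def fst_\<Gamma> doubleton_eq_iff)

lemma site_percolation:
  "coxeter_percolation G S r nb D len (fst \<Gamma>) (\<lambda>x y. y) (site_subgraph \<Gamma>)"
proof (unfold_locales, goal_cases)
  case (8 x p)
  then show ?case by (simp add: site_subgraph_def fst_\<Gamma> sets_bernoulli_coord)
next
  case (9 x y p)
  have "{\<omega> \<in> space (bernoulli (fst \<Gamma>) p). {x, y} \<in> snd \<Gamma> \<and> \<omega> x \<and> \<omega> y} \<in> sets (bernoulli (fst \<Gamma>) p)"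
    using 9 by (intro sets.sets_Collect_conj sets_bernoulli_coord sets.sets_Collect_const) (auto simp: fst_\<Gamma>)
  then show ?case by (simp add: site_subgraph_def)
next
  case (10 g)
  then show ?case
    using bij_translate[of g] edge_translate[of g]
    by (intro exI[of _ "\<lambda>x. g \<otimes> x"]) (auto simp: site_subgraph_def fst_\<Gamma>)
qed (auto simp: countable_carrier edge_iff r_closed
    site_subgraph_def fst_\<Gamma>)

lemma pc_less_pu: "pc_bond \<Gamma> < pu_bond \<Gamma> \<and> pc_site \<Gamma> < pu_site \<Gamma>"
proof -
  have "bond_measure \<Gamma> = bernoulli (snd \<Gamma>)" "site_measure \<Gamma> = bernoulli (fst \<Gamma>)"
    by (auto simp: bond_measure_def site_measure_def bernoulli_def)
  then show ?thesis
    unfolding pc_bond_def pu_bond_def pc_site_def pu_site_def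
    using coxeter_percolation.critical_prob_less_uniqueness_prob[OF bond_percolation]
      coxeter_percolation.critical_prob_less_uniqueness_prob[OF site_percolation] by blast
qed

end

lemma (in right_angled_polyhedron) sparse_coxeter:
  assumes "card (faces P) \<ge> 18"
  shows "sparse_coxeter (reflection_group P) \<Phi> hreflection nb D len"
proof -
  interpret right_angled_coxeter "reflection_group P" \<Phi> hreflection nb D len by (rule coxeter)
  show ?thesis
  proof unfold_locales
    show "card (D g) \<le> 3" if "g \<in> carrier (reflection_group P)" for g using that by (rule card_D_le)
    show "card c \<le> 3" if "c \<in> cliques nb \<Phi>" for c
      using that by (intro card_clique_le) (simp add: cliques_def)
    show "card {u \<in> \<Phi>. nb u s \<and> nb u t} \<le> 2" if "s \<in> \<Phi>" "t \<in> \<Phi>" "s \<noteq> t" for s t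
      using that by (rule card_common_neighbours)
    show "18 \<le> card \<Phi>" using assms by (simp add: card_normals)
  qed
qed

theorem theorem1p9:
  fixes P :: "minkowski set" and k :: nat
    and S :: "(minkowski \<Rightarrow> minkowski) set"
    and G :: "(minkowski \<Rightarrow> minkowski) monoid"
    and \<Gamma> :: "(minkowski \<Rightarrow> minkowski) ugraph"
  assumes "convex_polyhedron P" and "compact P" and "right_angled P"
    and "card (faces P) = k" and "k \<ge> 18"
    and "S = face_reflections P"
    and "G = reflection_group P"
    and "\<Gamma> = cayley_graph G S"
  shows "pc_bond \<Gamma> < pu_bond \<Gamma> \<and> pc_site \<Gamma> < pu_site \<Gamma>"
proof -
  obtain x0 where x0: "x0 \<in> (top_of_set H3) interior_of P"
    using assms(1) unfolding convex_polyhedron_def by blast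
  interpret right_angled_polyhedron P x0
  proof
    show "\<exists>N. finite N \<and> (\<forall>n\<in>N. unit_normal n) \<and> P = H3 \<inter> (\<Inter>n\<in>N. half_space n)"
      using assms(1) by (simp add: convex_polyhedron_def)
    show "x0 \<in> P" by (rule subsetD[OF interior_of_subset x0])
    show "lorentz x0 n < 0" if "unit_normal n" "P \<subseteq> half_space n" for n
      using interior_point_strict[OF x0 that] .
  qed (use assms in auto)
  interpret sparse_coxeter "reflection_group P" "face_normals P" hreflection nb D len
    using assms by (intro sparse_coxeter) simp
  show ?thesis using pc_less_pu by (simp add: assms face_reflections_def)
qed

end
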